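(* Let $n$ be an even positive integer and let $\nu$ be a Lévy measure on $\mathbb R$ with $\int_{\mathbb R}|y|^n\nu(dy)<\infty$ satisfying assumption $(R_\alpha)$: there exist $\alpha\in(0,2)$, nonnegative constants $c_+,c_-$ with $c_++c_->0$ and a function $g$ regularly varying at zero with index $-\alpha$ such that $$\nu((x,\infty))\sim c_+g(x)\quad\text{and}\quad\nu((-\infty,-x))\sim c_-g(x)\quad\text{as }x\downarrow0.$$ Then there exists a function $f$, regularly varying at infinity with index $1-n/\alpha$, and constants $0<\underline c\le\overline c<\infty$ such that $$\underline c\,f(\Lambda)\le\mathcal E_n(\Lambda)\le\overline c\,f(\Lambda)$$ for all $\Lambda$ sufficiently large. The function $f$ is given explicitly by $f(\Lambda)=(g^{\leftarrow}(\Lambda))^n\Lambda$, where $g^{\leftarrow}$ is a generalized inverse of $g$.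
   Context: $\mathcal M$ is the set of all positive finite measures on $\mathbb R$ and $m_k=\int_{\mathbb R}y^k\nu(dy)$ for $2\le k\le n$. $\mathcal E_n(\Lambda)$ is the minimum of $J(\bar\nu)=\int_{\mathbb R}|y|^n|\nu-\bar\nu|(dy)$ over all $\bar\nu\in\mathcal M$ satisfying $\bar\nu(\mathbb R)=\Lambda$ and $\int_{\mathbb R}y^k\bar\nu(dy)=m_k$ for $k=2,\dots,n-1$, where $|\nu-\bar\nu|$ is the total variation measure of $\nu-\bar\nu$. A positive measurable function $g$ on a right neighbourhood of $0$ is regularly varying at zero with index $\rho$ if $g(\lambda x)/g(x)\to\lambda^\rho$ as $x\downarrow0$ for every $\lambda>0$; regular variation at infinity is defined analogously with $x\to\infty$. If $c_\pm=0$, the relation $\sim c_\pm g$ means $o(g)$. The generalized inverse is, e.g., $g^{\leftarrow}(\Lambda)=\inf\{x>0:g(x)<\Lambda\}$. *)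

theory Defs
  imports "HOL-Analysis.Analysis" "HOL-Library.Landau_Symbols"
begin

definition levy_measure :: "real measure \<Rightarrow> bool" where
  "levy_measure \<nu> \<longleftrightarrow>
     sets \<nu> = sets borel \<and> emeasure \<nu> {0} = 0 \<and>
     (\<integral>\<^sup>+ y. ennreal (min 1 (y\<^sup>2)) \<partial>\<nu>) < \<infinity>"

text \<open>Only the values on a one-sided neighbourhood of the limit point matter, so a function
  given merely there may be extended arbitrarily to the whole line.\<close>

definition regularly_varying_at_zero :: "(real \<Rightarrow> real) \<Rightarrow> real \<Rightarrow> bool" where
  "regularly_varying_at_zero g \<rho> \<longleftrightarrow>
     (\<exists>\<delta>>0. (\<forall>x\<in>{0<..<\<delta>}. g x > 0) \<and>
        g \<in> borel_measurable (restrict_space borel {0<..<\<delta>})) \<and>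
     (\<forall>l>0. ((\<lambda>x. g (l * x) / g x) \<longlongrightarrow> l powr \<rho>) (at_right 0))"

definition regularly_varying_at_infinity :: "(real \<Rightarrow> real) \<Rightarrow> real \<Rightarrow> bool" where
  "regularly_varying_at_infinity f \<rho> \<longleftrightarrow>
     (\<exists>X. (\<forall>x\<in>{X<..}. f x > 0) \<and>
        f \<in> borel_measurable (restrict_space borel {X<..})) \<and>
     (\<forall>l>0. ((\<lambda>x. f (l * x) / f x) \<longlongrightarrow> l powr \<rho>) at_top)"

text \<open>The relation \<open>h(x) \<sim> c g(x)\<close> as \<open>x \<down> 0\<close>, read as \<open>h = o(g)\<close> if \<open>c = 0\<close>
  (where plain asymptotic equivalence would force \<open>h\<close> to vanish near \<open>0\<close>).\<close>

definition equiv_at_zero :: "(real \<Rightarrow> real) \<Rightarrow> real \<Rightarrow> (real \<Rightarrow> real) \<Rightarrow> bool" where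
  "equiv_at_zero h c g \<longleftrightarrow>
     (if c = 0 then h \<in> o[at_right 0](g) else h \<sim>[at_right 0] (\<lambda>x. c * g x))"

text \<open>For large arguments and \<open>g\<close> regularly varying at zero with negative index, the set below
  is nonempty and the infimum is determined by the values of \<open>g\<close> near \<open>0\<close>.\<close>

definition gen_inverse :: "(real \<Rightarrow> real) \<Rightarrow> real \<Rightarrow> real" where
  "gen_inverse g \<Lambda> = Inf {x. 0 < x \<and> g x < \<Lambda>}"

text \<open>The total variation measure \<open>|M - N|\<close>, as a supremum over finite measurable partitions.
  It is meant for finite \<open>N\<close> on the same \<open>\<sigma>\<close>-algebra as \<open>M\<close>; then \<open>M - N\<close> is a signed measure
  with values in \<open>(-\<infinity>, \<infinity>]\<close>, even when \<open>M\<close> is infinite, and the set function below is indeed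
  countably additive, so that it is the measure returned by \<^const>\<open>measure_of\<close>. The difference
  is taken in \<^typ>\<open>ereal\<close> because subtraction on \<^typ>\<open>ennreal\<close> is truncated.\<close>

definition tv_diff :: "'a measure \<Rightarrow> 'a measure \<Rightarrow> 'a measure" where
  "tv_diff M N = measure_of (space M) (sets M)
     (\<lambda>A. SUP P\<in>{P. finite P \<and> disjoint P \<and> P \<subseteq> sets M \<and> \<Union>P = A}.
        \<Sum>B\<in>P. e2ennreal \<bar>enn2ereal (emeasure M B) - enn2ereal (emeasure N B)\<bar>)"

definition J :: "real measure \<Rightarrow> nat \<Rightarrow> real measure \<Rightarrow> ennreal" where
  "J \<nu> n \<mu> = (\<integral>\<^sup>+ y. ennreal (\<bar>y\<bar> ^ n) \<partial>tv_diff \<nu> \<mu>)"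

definition admissible :: "real measure \<Rightarrow> nat \<Rightarrow> real \<Rightarrow> real measure set" where
  "admissible \<nu> n \<Lambda> =
     {\<mu>. sets \<mu> = sets borel \<and> finite_measure \<mu> \<and> measure \<mu> UNIV = \<Lambda> \<and>
        (\<forall>k\<in>{2..n - 1}. has_bochner_integral \<mu> (\<lambda>y. y ^ k) (\<integral>y. y ^ k \<partial>\<nu>))}"

text \<open>A genuine minimum, not an infimum: a statement about this value can only be derived
  for those \<open>\<Lambda>\<close> at which the minimum is attained.\<close>

definition min_error :: "real measure \<Rightarrow> nat \<Rightarrow> real \<Rightarrow> ennreal" where
  "min_error \<nu> n \<Lambda> = (LEAST e. e \<in> J \<nu> n ` admissible \<nu> n \<Lambda>)"

end

theory Submission
  imports Defs "HOL-Probability.Giry_Monad" "HOL-Probability.Helly_Selection" "HOL-Computational_Algebra.Polynomial"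
begin

text \<open>
  Put \<open>G = gen_inverse g \<Lambda>\<close>; up to constants, \<open>G\<close> is the scale at which the two-sided tail
  \<open>U x = \<nu> {y. x < \<bar>y\<bar>}\<close> passes the level \<open>\<Lambda>\<close>. A measure of mass \<open>\<Lambda>\<close> cannot follow \<open>\<nu>\<close> below that
  scale, and it can follow it above. So the mass that is lost is of order \<open>\<Lambda>\<close>, it sits at distance of
  order \<open>G\<close> from the origin, and the error should be of order \<open>f \<Lambda> = G ^ n * \<Lambda>\<close>.

  Lower bound (\<open>error_lower_bound\<close>). At a small multiple \<open>\<delta> * G\<close> the tail \<open>U\<close> exceeds \<open>2 * \<Lambda>\<close>, so an
  admissible measure differs from \<open>\<nu>\<close> by at least \<open>\<Lambda>\<close> beyond \<open>\<delta> * G\<close>.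

  Upper bound (\<open>error_upper_bound\<close>). One deletes \<open>\<nu>\<close> on \<open>[-\<delta> r, \<delta> r]\<close>, where \<open>r\<close> is a large multiple of
  \<open>G\<close>, and puts the missing mass into an atom at the origin, which is free of cost. This
  destroys the moments of order \<open>2, ..., n - 1\<close>; they are restored by changing the density of
  \<open>\<nu>\<close>, by at most \<open>1\<close> in absolute value, on \<open>n - 2\<close> separated shells at scale \<open>r\<close> (\<open>moment_transfer\<close>).
  That such a change exists is linear algebra: averages over separated intervals are
  independent functionals on polynomials, with a dual basis bounded independently of the averages
  (\<open>mean_value_dual_basis\<close>). That it is small enough comes from \<open>\<alpha> < 2\<close>: the second moment of
  \<open>\<nu>\<close> within \<open>\<delta> r\<close> is of order \<open>\<delta> powr (2 - \<alpha>) * r\<^sup>2 * U r\<close> (\<open>V_negligible\<close>), whereas that of each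
  shell is of order \<open>r\<^sup>2 * U r\<close> (\<open>shell_mass\<close>).

  The error is defined as a minimum, so it also has to be shown that the minimum is attained
  (\<open>moment_functional_attains_minimum\<close>). This is weak compactness together with lower semicontinuity of the
  weighted total variation, which is obtained by testing with continuous functions.

  Regular variation of \<open>f\<close> follows from that of \<open>G\<close> with index \<open>- 1 / \<alpha>\<close> (\<open>G_regularly_varying\<close>).
\<close>

section \<open>Averages over separated intervals as functionals on polynomials\<close>

text \<open>Gaussian elimination, one row at a time: a row that vanishes on all columns imposes nothing,
  and any other row is solved for one pivot column, which is then removed. Rows and columns are
  indexed by arbitrary finite sets so that no renumbering is needed after a pivot.\<close>

lemma homogeneous_system_nontrivial:
  fixes M :: "'a \<Rightarrow> 'b \<Rightarrow> real"
  assumes "finite R" "finite C" "card R < card C"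
  shows "\<exists>c. (\<exists>j\<in>C. c j \<noteq> 0) \<and> (\<forall>i\<in>R. (\<Sum>j\<in>C. c j * M i j) = 0)"
  using assms
proof (induction R arbitrary: C M rule: finite_induct)
  case empty
  then obtain j where "j \<in> C" by (auto simp: card_gt_0_iff)
  then show ?case by (intro exI[of _ "\<lambda>_. 1"]) auto
next
  case (insert i0 R)
  show ?case
  proof (cases "\<forall>j\<in>C. M i0 j = 0")
    case True
    then show ?thesis using insert.IH[of C M] insert.prems insert.hyps by (auto simp: card_insert_if)
  next
    case False
    then obtain j0 where j0: "j0 \<in> C" "M i0 j0 \<noteq> 0" by auto
    define C' where "C' = C - {j0}"
    have C': "finite C'" "card R < card C'" "C = insert j0 C'" "j0 \<notin> C'"
      using insert j0 by (auto simp: C'_def)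
    define M' where "M' i j = M i j - M i j0 * M i0 j / M i0 j0" for i j
    obtain c where c: "\<exists>j\<in>C'. c j \<noteq> 0" "\<forall>i\<in>R. (\<Sum>j\<in>C'. c j * M' i j) = 0"
      using insert.IH[of C' M'] C' by auto
    define z where "z = - (\<Sum>j\<in>C'. c j * M i0 j) / M i0 j0"
    define c' where "c' = c(j0 := z)"
    have sum: "(\<Sum>j\<in>C. c' j * M i j) = z * M i j0 + (\<Sum>j\<in>C'. c j * M i j)" for i
    proof -
      have "(\<Sum>j\<in>C'. c' j * M i j) = (\<Sum>j\<in>C'. c j * M i j)"
        using C' by (intro sum.cong) (auto simp: c'_def)
      then show ?thesis using C' by (simp add: c'_def)
    qed
    have "(\<Sum>j\<in>C'. c j * M' i j) = (\<Sum>j\<in>C'. c j * M i j) + z * M i j0" for i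
      unfolding M'_def z_def by (simp add: right_diff_distrib sum_subtractf sum_distrib_left sum_divide_distrib mult_ac)
    then have "\<forall>i\<in>insert i0 R. (\<Sum>j\<in>C. c' j * M i j) = 0"
      using c(2) j0 by (auto simp: sum z_def)
    moreover have "\<exists>j\<in>C. c' j \<noteq> 0" using c(1) C' by (auto simp: c'_def)
    ultimately show ?thesis by blast
  qed
qed

lemma poly_common_kernel:
  fixes L :: "'a \<Rightarrow> real poly \<Rightarrow> real"
  assumes "finite R"
    and add: "\<And>i p q. i \<in> R \<Longrightarrow> L i (p + q) = L i p + L i q"
    and smult: "\<And>i c p. i \<in> R \<Longrightarrow> L i (smult c p) = c * L i p"
  obtains p where "p \<noteq> 0" "degree p \<le> card R" "\<And>i. i \<in> R \<Longrightarrow> L i p = 0"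
proof -
  define m where "m = card R"
  have L0: "L i 0 = 0" if "i \<in> R" for i using smult[OF that, of 0 0] by simp
  have Lsum: "L i (\<Sum>j\<in>C. smult (c j) (q j)) = (\<Sum>j\<in>C. c j * L i (q j))"
    if "i \<in> R" for i c and q :: "nat \<Rightarrow> real poly" and C
    by (induction C rule: infinite_finite_induct) (use that in \<open>auto simp: L0 add smult\<close>)
  obtain c where c: "\<exists>j\<in>{..m}. c j \<noteq> 0" "\<forall>i\<in>R. (\<Sum>j\<le>m. c j * L i (monom 1 j)) = 0"
    using homogeneous_system_nontrivial[of R "{..m}" "\<lambda>i j. L i (monom 1 j)"] assms(1)
    by (auto simp: m_def)
  define p where "p = (\<Sum>j\<le>m. smult (c j) (monom 1 j))"
  have "coeff p j = c j" if "j \<le> m" for j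
    using that by (simp add: p_def coeff_sum if_distrib[of "(*) _"] cong: if_cong)
  then have "p \<noteq> 0" using c(1) by force
  moreover have "degree p \<le> m"
    unfolding p_def by (rule degree_sum_le) (auto intro: order_trans[OF degree_smult_le] order_trans[OF degree_monom_le])
  moreover have "L i p = 0" if "i \<in> R" for i
    unfolding p_def using Lsum[OF that] c(2) that by simp
  ultimately show ?thesis using that by (auto simp: m_def)
qed

lemma poly_zero_of_many_roots:
  fixes p :: "real poly"
  assumes "finite A" "\<And>a. a \<in> A \<Longrightarrow> poly p a = 0" "degree p < card A"
  shows "p = 0"
proof (rule ccontr)
  assume "p \<noteq> 0"
  then have "card A \<le> card {x. poly p x = 0}" using assms by (intro card_mono poly_roots_finite) auto
  also have "\<dots> \<le> degree p" by (rule card_poly_roots_bound) fact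
  finally show False using assms by simp
qed

text \<open>The functionals to which this applies are weighted averages \<open>L i\<close> over intervals separated by
  gaps of length \<open>1/2\<close>. All that matters about an average is that it equals the value at some point of its
  interval, a point depending on the polynomial. This gives unisolvence: a polynomial of degree
  below \<open>d\<close> killed by all the \<open>L i\<close> has \<open>d\<close> distinct roots. It also gives the bound, which does
  not depend on the averages: a dual polynomial \<open>P i\<close> takes the value \<open>1\<close> at a point of interval \<open>i\<close>
  and \<open>0\<close> at a point of each other interval, hence it is a Lagrange basis polynomial, a product of
  at most \<open>d\<close> quotients each at most \<open>(d + 3) / (1/2)\<close> on \<open>[-1, 1]\<close>. The uniformity is what makes
  the construction of competitors work at all small scales simultaneously.\<close>

lemma mean_value_dual_basis:
  fixes L :: "nat \<Rightarrow> real poly \<Rightarrow> real"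
  assumes add: "\<And>i p q. i < d \<Longrightarrow> L i (p + q) = L i p + L i q"
    and smult: "\<And>i c p. i < d \<Longrightarrow> L i (smult c p) = c * L i p"
    and mean: "\<And>i p. i < d \<Longrightarrow> \<exists>t\<in>{real i + 1..real i + 3/2}. L i p = poly p t"
  obtains P where "\<And>i. i < d \<Longrightarrow> degree (P i) < d"
    "\<And>i j. i < d \<Longrightarrow> j < d \<Longrightarrow> L j (P i) = (if i = j then 1 else 0)"
    "\<And>q. degree q < d \<Longrightarrow> q = (\<Sum>i<d. smult (L i q) (P i))"
    "\<And>i y. i < d \<Longrightarrow> \<bar>y\<bar> \<le> 1 \<Longrightarrow> \<bar>poly (P i) y\<bar> \<le> (2 * (real d + 3)) ^ d"
proof -
  have L0: "L i 0 = 0" if "i < d" for i using smult[OF that, of 0 0] by simp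
  have inj: "p = 0" if p: "degree p < d" "\<And>i. i < d \<Longrightarrow> L i p = 0" for p
  proof -
    have "\<forall>i. \<exists>t. i < d \<longrightarrow> t \<in> {real i + 1..real i + 3/2} \<and> poly p t = 0"
      using mean[where p = p] p(2) by fastforce
    then obtain t where t: "\<And>i. i < d \<Longrightarrow> t i \<in> {real i + 1..real i + 3/2}" "\<And>i. i < d \<Longrightarrow> poly p (t i) = 0"
      by metis
    have "t i \<noteq> t j" if "i < j" "j < d" for i j
      using t(1)[of i] t(1)[of j] that by auto
    then have inj: "inj_on t {..<d}" by (intro inj_onI) (metis lessThan_iff linorder_neqE_nat)
    show ?thesis
      by (rule poly_zero_of_many_roots[of "t ` {..<d}"]) (use t p inj in \<open>auto simp: card_image\<close>)
  qed
  have "\<exists>p. degree p < d \<and> (\<forall>j<d. L j p = (if i = j then 1 else 0))" if i: "i < d" for i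
  proof -
    obtain p where p: "p \<noteq> 0" "degree p \<le> card ({..<d} - {i})" "\<And>j. j \<in> {..<d} - {i} \<Longrightarrow> L j p = 0"
      using poly_common_kernel[of "{..<d} - {i}" L] add smult by auto
    have d: "degree p < d" using p(2) i by simp
    have nz: "L i p \<noteq> 0"
    proof
      assume "L i p = 0"
      then have "p = 0" using p d by (intro inj) auto
      with p show False by simp
    qed
    show ?thesis
      by (rule exI[of _ "smult (1 / L i p) p"]) (use nz p d i in \<open>auto simp: smult\<close>)
  qed
  then obtain P where P: "\<And>i. i < d \<Longrightarrow> degree (P i) < d"
    "\<And>i j. i < d \<Longrightarrow> j < d \<Longrightarrow> L j (P i) = (if i = j then 1 else 0)" by metis
  have Lsum: "L i (\<Sum>j\<in>C. smult (c j) (q j)) = (\<Sum>j\<in>C. c j * L i (q j))"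
    if "i < d" for i c and q :: "nat \<Rightarrow> real poly" and C
    by (induction C rule: infinite_finite_induct) (use that in \<open>auto simp: L0 add smult\<close>)
  have rep: "q = (\<Sum>i<d. smult (L i q) (P i))" if q: "degree q < d" for q
  proof -
    let ?s = "\<Sum>i<d. smult (L i q) (P i)"
    have "degree ?s < d" using P(1) q
      by (intro degree_sum_less) (auto intro: le_less_trans[OF degree_smult_le])
    then have deg: "degree (q + smult (-1) ?s) < d" using q by (intro degree_add_less) auto
    have "q + smult (-1) ?s = 0"
    proof (rule inj[OF deg])
      fix j assume j: "j < d"
      have "L j ?s = (\<Sum>i<d. L i q * (if i = j then 1 else 0))"
        using P(2) j by (subst Lsum[OF j]) (auto intro!: sum.cong)
      also have "\<dots> = L j q" using j by (simp add: if_distrib[of "(*) _"] cong: if_cong)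
      finally have s: "L j ?s = L j q" .
      show "L j (q + smult (-1) ?s) = 0"
        unfolding add[OF j] smult[OF j] s by simp
    qed
    then show ?thesis by simp
  qed
  have bound: "\<bar>poly (P i) y\<bar> \<le> (2 * (real d + 3)) ^ d" if i: "i < d" and y: "\<bar>y\<bar> \<le> 1" for i y
  proof -
    have "\<forall>j. \<exists>t. j < d \<longrightarrow> t \<in> {real j + 1..real j + 3/2} \<and> poly (P i) t = L j (P i)"
      using mean[where p = "P i"] by fastforce
    then obtain t where t: "\<And>j. j < d \<Longrightarrow> t j \<in> {real j + 1..real j + 3/2}"
        "\<And>j. j < d \<Longrightarrow> poly (P i) (t j) = L j (P i)"
      by metis
    have tij: "1/2 \<le> \<bar>t i - t j\<bar>" if "i \<noteq> j" "i < d" "j < d" for i j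
    proof (cases "i < j")
      case True
      then have "real i + 1 \<le> real j" by linarith
      then show ?thesis using t(1)[of i] t(1)[of j] that by auto
    next
      case False
      then have "real j + 1 \<le> real i" using that by linarith
      then show ?thesis using t(1)[of i] t(1)[of j] that by auto
    qed
    then have inj: "inj_on t {..<d}" by (intro inj_onI) (fastforce)
    define S where "S = {..<d} - {i}"
    define Q where "Q = (\<Prod>j\<in>S. smult (1 / (t i - t j)) [:- t j, 1:])"
    have polyQ: "poly Q y = (\<Prod>j\<in>S. (y - t j) / (t i - t j))" for y
      by (simp add: Q_def poly_prod diff_divide_distrib)
    have "degree Q \<le> (\<Sum>j\<in>S. 1)" unfolding Q_def
      by (intro order_trans[OF degree_prod_sum_le] sum_mono) (auto simp: S_def intro: order_trans[OF degree_smult_le])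
    also have "\<dots> < d" using i by (simp add: S_def)
    finally have degQ: "degree Q < d" .
    \<comment> \<open>Both polynomials agree at the \<open>d\<close> points \<open>t j\<close>.\<close>
    have eq: "P i - Q = 0"
    proof (rule poly_zero_of_many_roots[of "t ` {..<d}"])
      show "degree (P i - Q) < card (t ` {..<d})"
        using inj degQ P(1)[OF i] by (auto simp: card_image intro: degree_diff_less)
      fix a assume "a \<in> t ` {..<d}"
      then obtain j where j: "j < d" "a = t j" by auto
      show "poly (P i - Q) a = 0"
      proof (cases "j = i")
        case True
        have "poly Q (t i) = (\<Prod>j\<in>S. 1)"
          unfolding polyQ using tij i by (intro prod.cong) (fastforce simp: S_def)+
        then show ?thesis using j True t(2) P(2) i by auto
      next
        case False
        then have "poly Q (t j) = 0"
          unfolding polyQ using j by (intro prod_zero) (auto simp: S_def)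
        then show ?thesis using j False t(2) P(2) i by auto
      qed
    qed auto
    then have "\<bar>poly (P i) y\<bar> = (\<Prod>j\<in>S. \<bar>y - t j\<bar> / \<bar>t i - t j\<bar>)"
      using polyQ by (simp add: abs_prod)
    also have "\<dots> \<le> (\<Prod>j\<in>S. 2 * (real d + 3))"
    proof (intro prod_mono conjI)
      fix j assume j: "j \<in> S"
      have "\<bar>y - t j\<bar> \<le> real d + 3" using y t(1)[of j] j by (auto simp: S_def)
      moreover have "1/2 \<le> \<bar>t i - t j\<bar>" using j i tij by (auto simp: S_def)
      ultimately have "\<bar>y - t j\<bar> / \<bar>t i - t j\<bar> \<le> (real d + 3) / (1/2)" by (intro frac_le) auto
      then show "\<bar>y - t j\<bar> / \<bar>t i - t j\<bar> \<le> 2 * (real d + 3)" by simp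
    qed auto
    also have "\<dots> = (2 * (real d + 3)) ^ (d - 1)" using i by (simp add: S_def)
    also have "\<dots> \<le> (2 * (real d + 3)) ^ d" by (intro power_increasing) auto
    finally show ?thesis .
  qed
  show ?thesis by (rule that[OF P rep bound])
qed

section \<open>Sums of measures and the total variation of a difference\<close>

definition sum_measure :: "'a measure \<Rightarrow> 'a measure \<Rightarrow> 'a measure" where
  "sum_measure M N = measure_of (space M) (sets M) (\<lambda>A. emeasure M A + emeasure N A)"

lemma sets_sum_measure [simp, measurable_cong]: "sets (sum_measure M N) = sets M"
  by (simp add: sum_measure_def)

lemma space_sum_measure [simp]: "space (sum_measure M N) = space M"
  by (simp add: sum_measure_def)

lemma emeasure_sum_measure:
  assumes "sets N = sets M"
  shows "emeasure (sum_measure M N) A = emeasure M A + emeasure N A"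
proof (cases "A \<in> sets M")
  case True
  have "countably_additive (sets M) (\<lambda>A. emeasure M A + emeasure N A)"
  proof (rule countably_additiveI)
    fix F :: "nat \<Rightarrow> 'a set"
    assume F: "range F \<subseteq> sets M" "disjoint_family F" "\<Union>(range F) \<in> sets M"
    show "(\<Sum>i. emeasure M (F i) + emeasure N (F i))
        = emeasure M (\<Union>(range F)) + emeasure N (\<Union>(range F))"
      using F assms by (subst suminf_add[symmetric]) (auto simp: suminf_emeasure)
  qed
  then show ?thesis
    unfolding sum_measure_def using True
    by (intro emeasure_measure_of_sigma sets.sigma_algebra_axioms) (auto simp: positive_def)
next
  case False
  then show ?thesis using assms by (simp add: emeasure_notin_sets)
qed

lemma nn_integral_sum_measure:
  assumes N: "sets N = sets M" and u: "u \<in> borel_measurable M"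
  shows "(\<integral>\<^sup>+x. u x \<partial>sum_measure M N) = (\<integral>\<^sup>+x. u x \<partial>M) + (\<integral>\<^sup>+x. u x \<partial>N)"
  using u
proof (induction rule: borel_measurable_induct)
  case (cong f g)
  have "(\<integral>\<^sup>+x. f x \<partial>P) = (\<integral>\<^sup>+x. g x \<partial>P)" if "space P = space M" for P
    using cong that by (intro nn_integral_cong) auto
  then show ?case using cong sets_eq_imp_space_eq[OF N] by simp
next
  case (set A)
  then show ?case using N by (simp add: emeasure_sum_measure)
next
  case (mult u c)
  then have "u \<in> borel_measurable N" using N measurable_cong_sets by blast
  then show ?case using mult by (simp add: nn_integral_cmult distrib_left)
next
  case (add u v)
  then have "u \<in> borel_measurable N" "v \<in> borel_measurable N" using N measurable_cong_sets by blast+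
  then show ?case using add by (simp add: nn_integral_add ac_simps)
next
  case (seq U)
  then have *: "\<And>i. U i \<in> borel_measurable N" using N measurable_cong_sets by blast
  have "(\<integral>\<^sup>+x. (SUP i. U i) x \<partial>P) = (SUP i. \<integral>\<^sup>+x. U i x \<partial>P)" if "\<And>i. U i \<in> borel_measurable P" for P
    using nn_integral_monotone_convergence_SUP[OF seq(3) that] by (simp add: image_comp)
  moreover have "incseq (\<lambda>i. \<integral>\<^sup>+x. U i x \<partial>P)" for P
    using seq(3) by (auto simp: incseq_def le_fun_def intro!: nn_integral_mono)
  ultimately show ?case using seq *
    by (simp add: ennreal_SUP_add)
qed

lemma sigma_finite_sum_measure:
  assumes "sigma_finite_measure M" "finite_measure N" and N: "sets N = sets M"
  shows "sigma_finite_measure (sum_measure M N)"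
proof -
  interpret M: sigma_finite_measure M by fact
  interpret N: finite_measure N by fact
  obtain A where A: "countable A" "A \<subseteq> sets M" "\<Union>A = space M" "\<forall>a\<in>A. emeasure M a \<noteq> \<infinity>"
    using M.sigma_finite_countable by auto
  show ?thesis
    by standard (use A N in \<open>auto intro!: exI[of _ A] simp: emeasure_sum_measure\<close>)
qed

lemma absolutely_continuous_sum_measure:
  assumes N: "sets N = sets M"
  shows "absolutely_continuous (sum_measure M N) M" "absolutely_continuous (sum_measure M N) N"
  using N by (auto simp: absolutely_continuous_def null_sets_def emeasure_sum_measure)

text \<open>Finiteness almost everywhere makes it possible to choose the density real-valued everywhere,
  which keeps the later computations with \<open>\<bar>f - h\<bar>\<close> inside the reals.\<close>

lemma (in sigma_finite_measure) real_density_exists: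
  assumes "absolutely_continuous M N" "sets N = sets M" "sigma_finite_measure N"
  obtains f :: "'a \<Rightarrow> real" where "f \<in> borel_measurable M" "\<And>x. 0 \<le> f x"
    "N = density M (\<lambda>x. ennreal (f x))"
proof
  let ?f = "\<lambda>x. enn2real (RN_deriv M N x)"
  have "AE x in M. RN_deriv M N x = ennreal (?f x)"
    using RN_deriv_finite[OF assms(3,1,2)] by (auto simp: top.not_eq_extremum)
  then have "density M (RN_deriv M N) = density M (\<lambda>x. ennreal (?f x))"
    by (intro density_cong) auto
  then show "N = density M (\<lambda>x. ennreal (?f x))"
    using density_RN_deriv[OF assms(1,2)] by simp
qed auto

text \<open>This is the step that turns the supremum over partitions into an honest measure. No
  partition does better than \<open>\<integral>\<bar>f - h\<bar>\<close>, and splitting a set along the Hahn set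
  \<open>{x. h x \<le> f x}\<close> attains it. Finiteness of \<open>\<mu>\<close> excludes \<open>\<infinity> - \<infinity>\<close>, so the argument also covers
  sets on which \<open>\<nu>\<close> is infinite.\<close>

lemma tv_diff_density:
  assumes "sigma_finite_measure L"
    and [measurable]: "f \<in> borel_measurable L" "h \<in> borel_measurable L"
    and pos: "\<And>x. 0 \<le> f x" "\<And>x. 0 \<le> h x"
    and \<nu>: "\<nu> = density L (\<lambda>x. ennreal (f x))" and \<mu>: "\<mu> = density L (\<lambda>x. ennreal (h x))"
    and fin: "finite_measure \<mu>"
  shows "tv_diff \<nu> \<mu> = density L (\<lambda>x. ennreal \<bar>f x - h x\<bar>)"
proof -
  define T where "T = density L (\<lambda>x. ennreal \<bar>f x - h x\<bar>)"
  define H where "H = {x\<in>space L. h x \<le> f x}"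
  have [measurable]: "H \<in> sets L" unfolding H_def by measurable
  have sp: "space \<nu> = space L" "sets \<nu> = sets L" "sets T = sets L" by (auto simp: \<nu> T_def)
  have fin\<mu>: "emeasure \<mu> B \<noteq> \<infinity>" for B using finite_measure.emeasure_finite[OF fin] by simp
  define D where "D B = e2ennreal \<bar>enn2ereal (emeasure \<nu> B) - enn2ereal (emeasure \<mu> B)\<bar>" for B
  have D_eq: "D B = z" if "emeasure \<nu> B = emeasure \<mu> B + z" for B z
    using that fin\<mu>[of B] unfolding D_def
    by (cases "emeasure \<mu> B"; cases z)
       (auto simp: ennreal_plus[symmetric] plus_ennreal.rep_eq enn2ereal_ennreal ennreal_def[symmetric]
          simp flip: ennreal.rep_eq simp del: ennreal_plus)
  have D_eq': "D B = z" if "emeasure \<mu> B = emeasure \<nu> B + z" for B z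
    using that fin\<mu>[of B] unfolding D_def
    by (cases "emeasure \<nu> B"; cases z)
       (auto simp: ennreal_plus[symmetric] plus_ennreal.rep_eq enn2ereal_ennreal ennreal_def[symmetric]
          simp flip: ennreal.rep_eq simp del: ennreal_plus)
  have DH: "D B = emeasure T B" if B: "B \<in> sets L" "B \<subseteq> H" for B
  proof (rule D_eq)
    have [measurable]: "B \<in> sets L" by fact
    have "emeasure \<mu> B + emeasure T B = (\<integral>\<^sup>+x. ennreal (h x) * indicator B x + ennreal \<bar>f x - h x\<bar> * indicator B x \<partial>L)"
      unfolding \<mu> T_def by (simp add: emeasure_density nn_integral_add)
    also have "\<dots> = (\<integral>\<^sup>+x. ennreal (f x) * indicator B x \<partial>L)"
      using B(2) pos by (intro nn_integral_cong) (auto simp: H_def indicator_def simp flip: ennreal_plus)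
    finally show "emeasure \<nu> B = emeasure \<mu> B + emeasure T B"
      unfolding \<nu> by (simp add: emeasure_density)
  qed
  have DH': "D B = emeasure T B" if B: "B \<in> sets L" "B \<inter> H = {}" for B
  proof (rule D_eq')
    have [measurable]: "B \<in> sets L" by fact
    have "emeasure \<nu> B + emeasure T B = (\<integral>\<^sup>+x. ennreal (f x) * indicator B x + ennreal \<bar>f x - h x\<bar> * indicator B x \<partial>L)"
      unfolding \<nu> T_def by (simp add: emeasure_density nn_integral_add)
    also have "\<dots> = (\<integral>\<^sup>+x. ennreal (h x) * indicator B x \<partial>L)"
      using B(2) pos by (intro nn_integral_cong) (force simp: H_def indicator_def simp flip: ennreal_plus)
    finally show "emeasure \<mu> B = emeasure \<nu> B + emeasure T B"
      unfolding \<mu> by (simp add: emeasure_density)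
  qed
  have D_le: "D B \<le> emeasure T B" if [measurable]: "B \<in> sets L" for B
  proof -
    have *: "emeasure \<nu> B \<le> emeasure \<mu> B + emeasure T B" "emeasure \<mu> B \<le> emeasure \<nu> B + emeasure T B"
      unfolding \<nu> \<mu> T_def using pos
      by (auto simp: emeasure_density simp flip: nn_integral_add
          intro!: nn_integral_mono simp: indicator_def simp flip: ennreal_plus)
    show ?thesis using * fin\<mu>[of B] unfolding D_def
      by (cases "emeasure \<mu> B"; cases "emeasure \<nu> B"; cases "emeasure T B")
       (auto simp: ennreal_plus[symmetric] enn2ereal_ennreal top_unique
          simp flip: ennreal.rep_eq simp del: ennreal_plus)
  qed
  have SUP_eq: "(SUP P\<in>{P. finite P \<and> disjoint P \<and> P \<subseteq> sets \<nu> \<and> \<Union>P = A}. \<Sum>B\<in>P. D B) = emeasure T A"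
    (is "(SUP P\<in>?S. _) = _") if A: "A \<in> sets L" for A
  proof (rule antisym)
    show "(SUP P\<in>?S. \<Sum>B\<in>P. D B) \<le> emeasure T A"
    proof (rule SUP_least)
      fix P assume P: "P \<in> ?S"
      then have "(\<Sum>B\<in>P. D B) \<le> (\<Sum>B\<in>P. emeasure T B)"
        using sp D_le by (intro sum_mono) auto
      also have "\<dots> = emeasure T (\<Union>P)"
        using P sp sum_emeasure[of "\<lambda>x. x" P T]
        by (auto simp: disjoint_family_on_def disjoint_def)
      finally show "(\<Sum>B\<in>P. D B) \<le> emeasure T A" using P by simp
    qed
    have *: "emeasure T A = emeasure T (A \<inter> H) + emeasure T (A - H)"
      using A sp by (subst plus_emeasure) (auto intro!: arg_cong[of _ _ "emeasure T"])
    \<comment> \<open>The two pieces coincide only if both are empty; a set of sets would then count them once.\<close>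
    let ?P = "if A \<inter> H = A - H then {A \<inter> H} else {A \<inter> H, A - H}"
    have "A \<inter> H = A - H \<Longrightarrow> A = {}" by blast
    then have "(\<Sum>B\<in>?P. D B) = emeasure T A"
      using A DH[of "A \<inter> H"] DH'[of "A - H"] * by (auto simp: Int_Diff)
    moreover have "?P \<in> ?S" using A sp by (auto simp: disjoint_def)
    ultimately show "emeasure T A \<le> (SUP P\<in>?S. \<Sum>B\<in>P. D B)"
      by (intro SUP_upper2[of ?P]) auto
  qed
  have "tv_diff \<nu> \<mu> = measure_of (space T) (sets T) (emeasure T)"
    unfolding tv_diff_def using SUP_eq sp
    by (auto intro!: measure_of_eq simp: D_def T_def sets.sigma_sets_eq dest: sets.sets_into_space)
  also have "\<dots> = T" by (rule measure_of_of_measure)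
  finally show ?thesis unfolding T_def .
qed

text \<open>The dominating measure is \<open>\<nu> + \<mu>\<close>; once both measures are densities, each comparison
  between \<open>\<nu>\<close>, \<open>\<mu>\<close> and \<open>\<bar>\<nu> - \<mu>\<bar>\<close> becomes a pointwise one between \<open>f\<close>, \<open>h\<close> and \<open>\<bar>f - h\<bar>\<close>.\<close>

locale joint_densities =
  fixes \<nu> \<mu> L :: "'a measure" and f h :: "'a \<Rightarrow> real"
  assumes dominating: "sigma_finite_measure L" and sets_L: "sets L = sets \<nu>"
    and f_measurable [measurable]: "f \<in> borel_measurable L"
    and h_measurable [measurable]: "h \<in> borel_measurable L"
    and f_nonneg: "\<And>x. 0 \<le> f x" and h_nonneg: "\<And>x. 0 \<le> h x"
    and \<nu>_density: "\<nu> = density L (\<lambda>x. ennreal (f x))"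
    and \<mu>_density: "\<mu> = density L (\<lambda>x. ennreal (h x))"
    and \<mu>_finite: "finite_measure \<mu>"
begin

lemmas pos = f_nonneg h_nonneg

lemma tv_diff_eq: "tv_diff \<nu> \<mu> = density L (\<lambda>x. ennreal \<bar>f x - h x\<bar>)"
  by (rule tv_diff_density[OF dominating f_measurable h_measurable f_nonneg h_nonneg
        \<nu>_density \<mu>_density \<mu>_finite])

lemmas eq = \<nu>_density \<mu>_density tv_diff_eq

end

lemma joint_densities_exist:
  assumes "sigma_finite_measure \<nu>" "finite_measure \<mu>" and s: "sets \<mu> = sets \<nu>"
  obtains L f h where "joint_densities \<nu> \<mu> L f h"
proof -
  define L where "L = sum_measure \<nu> \<mu>"
  have sf: "sigma_finite_measure L"
    unfolding L_def using assms by (intro sigma_finite_sum_measure) auto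
  interpret L: sigma_finite_measure L by fact
  interpret \<mu>: finite_measure \<mu> by fact
  have sets: "sets L = sets \<nu>" by (simp add: L_def)
  have ac: "absolutely_continuous L \<nu>" "absolutely_continuous L \<mu>"
    unfolding L_def using absolutely_continuous_sum_measure[OF s] by auto
  obtain f where f: "f \<in> borel_measurable L" "\<And>x. 0 \<le> f x" "\<nu> = density L (\<lambda>x. ennreal (f x))"
    using L.real_density_exists[OF ac(1)] sets assms(1) by metis
  obtain h where h: "h \<in> borel_measurable L" "\<And>x. 0 \<le> h x" "\<mu> = density L (\<lambda>x. ennreal (h x))"
    using L.real_density_exists[OF ac(2)] sets s \<mu>.sigma_finite_measure_axioms by metis
  show ?thesis
    by (rule that, unfold_locales) (fact sf sets f h assms(2))+
qed

lemma sets_tv_diff: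
  assumes "sigma_finite_measure \<nu>" "finite_measure \<mu>" and s: "sets \<mu> = sets \<nu>"
  shows "sets (tv_diff \<nu> \<mu>) = sets \<nu>"
proof -
  obtain L f h where "joint_densities \<nu> \<mu> L f h" using joint_densities_exist[OF assms(1-3)] .
  then interpret joint_densities \<nu> \<mu> L f h .
  show ?thesis by (simp add: tv_diff_eq sets_L)
qed

lemma nn_integral_le_tv_diff:
  assumes "sigma_finite_measure \<nu>" "finite_measure \<mu>" and s: "sets \<mu> = sets \<nu>"
    and u: "u \<in> borel_measurable \<nu>"
  shows "(\<integral>\<^sup>+x. u x \<partial>\<nu>) \<le> (\<integral>\<^sup>+x. u x \<partial>\<mu>) + (\<integral>\<^sup>+x. u x \<partial>tv_diff \<nu> \<mu>)"
    and "(\<integral>\<^sup>+x. u x \<partial>\<mu>) \<le> (\<integral>\<^sup>+x. u x \<partial>\<nu>) + (\<integral>\<^sup>+x. u x \<partial>tv_diff \<nu> \<mu>)"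
proof -
  obtain L f h where "joint_densities \<nu> \<mu> L f h" using joint_densities_exist[OF assms(1-3)] .
  then interpret joint_densities \<nu> \<mu> L f h .
  note L = sets_L
  have [measurable]: "u \<in> borel_measurable L" using u L measurable_cong_sets by blast
  have eqs: "(\<integral>\<^sup>+x. u x \<partial>\<nu>) = (\<integral>\<^sup>+x. ennreal (f x) * u x \<partial>L)"
    "(\<integral>\<^sup>+x. u x \<partial>\<mu>) = (\<integral>\<^sup>+x. ennreal (h x) * u x \<partial>L)"
    "(\<integral>\<^sup>+x. u x \<partial>tv_diff \<nu> \<mu>) = (\<integral>\<^sup>+x. ennreal \<bar>f x - h x\<bar> * u x \<partial>L)"
    unfolding eq(3) unfolding eq(1,2) by (simp_all add: nn_integral_density)
  have *: "ennreal (f x) * u x \<le> ennreal (h x) * u x + ennreal \<bar>f x - h x\<bar> * u x"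
    "ennreal (h x) * u x \<le> ennreal (f x) * u x + ennreal \<bar>f x - h x\<bar> * u x" for x
    unfolding distrib_right[symmetric] using pos
    by (auto simp flip: ennreal_plus intro!: mult_right_mono)
  show "(\<integral>\<^sup>+x. u x \<partial>\<nu>) \<le> (\<integral>\<^sup>+x. u x \<partial>\<mu>) + (\<integral>\<^sup>+x. u x \<partial>tv_diff \<nu> \<mu>)"
    unfolding eqs by (subst nn_integral_add[symmetric]) (auto intro!: nn_integral_mono *)
  show "(\<integral>\<^sup>+x. u x \<partial>\<mu>) \<le> (\<integral>\<^sup>+x. u x \<partial>\<nu>) + (\<integral>\<^sup>+x. u x \<partial>tv_diff \<nu> \<mu>)"
    unfolding eqs by (subst nn_integral_add[symmetric]) (auto intro!: nn_integral_mono *)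
qed

text \<open>Minimality of the total variation measure. On the Hahn set the first inequality, and off it
  the second, bounds \<open>\<bar>\<nu> - \<mu>\<bar>\<close> by \<open>D\<close> after cancelling the smaller of the two values, which is finite.\<close>

lemma nn_integral_tv_diff_le:
  assumes "sigma_finite_measure \<nu>" "finite_measure \<mu>" and s: "sets \<mu> = sets \<nu>"
    and D: "sets D = sets \<nu>"
    and le: "\<And>B. B \<in> sets \<nu> \<Longrightarrow> emeasure \<nu> B \<le> emeasure \<mu> B + emeasure D B"
      "\<And>B. B \<in> sets \<nu> \<Longrightarrow> emeasure \<mu> B \<le> emeasure \<nu> B + emeasure D B"
  shows "(\<integral>\<^sup>+x. u x \<partial>tv_diff \<nu> \<mu>) \<le> (\<integral>\<^sup>+x. u x \<partial>D)"
proof -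
  interpret \<mu>: finite_measure \<mu> by fact
  obtain L f h where "joint_densities \<nu> \<mu> L f h" using joint_densities_exist[OF assms(1-3)] .
  then interpret joint_densities \<nu> \<mu> L f h .
  note L = sets_L
  define T where "T = tv_diff \<nu> \<mu>"
  have T: "T = density L (\<lambda>x. ennreal \<bar>f x - h x\<bar>)" "sets T = sets L" by (auto simp: T_def eq(3))
  define A where "A = {x\<in>space L. h x \<le> f x}"
  have [measurable]: "A \<in> sets L" unfolding A_def by measurable
  have TA: "emeasure T B \<le> emeasure D B" if B: "B \<in> sets L" "B \<subseteq> A" for B
  proof -
    have [measurable]: "B \<in> sets L" by fact
    have "emeasure \<mu> B + emeasure T B
        = (\<integral>\<^sup>+x. ennreal (h x) * indicator B x + ennreal \<bar>f x - h x\<bar> * indicator B x \<partial>L)"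
      unfolding eq(2) T by (simp add: emeasure_density nn_integral_add)
    also have "\<dots> = (\<integral>\<^sup>+x. ennreal (f x) * indicator B x \<partial>L)"
      using B(2) pos by (intro nn_integral_cong) (auto simp: A_def indicator_def simp flip: ennreal_plus)
    also have "\<dots> = emeasure \<nu> B" unfolding eq(1) by (simp add: emeasure_density)
    also have "\<dots> \<le> emeasure \<mu> B + emeasure D B" using le(1) B L by auto
    finally show ?thesis using \<mu>.emeasure_finite[of B]
      by (simp add: ennreal_add_left_cancel_le)
  qed
  have TA': "emeasure T B \<le> emeasure D B" if B: "B \<in> sets L" "B \<inter> A = {}" for B
  proof -
    have [measurable]: "B \<in> sets L" by fact
    have *: "emeasure \<nu> B + emeasure T B
        = (\<integral>\<^sup>+x. ennreal (f x) * indicator B x + ennreal \<bar>f x - h x\<bar> * indicator B x \<partial>L)"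
      unfolding eq(1) T by (simp add: emeasure_density nn_integral_add)
    also have "\<dots> = (\<integral>\<^sup>+x. ennreal (h x) * indicator B x \<partial>L)"
      using B(2) pos by (intro nn_integral_cong) (force simp: A_def indicator_def simp flip: ennreal_plus)
    also have "\<dots> = emeasure \<mu> B" unfolding eq(2) by (simp add: emeasure_density)
    finally have *: "emeasure \<nu> B + emeasure T B = emeasure \<mu> B" .
    then have "emeasure \<nu> B \<noteq> \<infinity>"
      using \<mu>.emeasure_finite[of B] by (metis ennreal_add_eq_top infinity_ennreal_def)
    moreover have "emeasure \<nu> B + emeasure T B \<le> emeasure \<nu> B + emeasure D B"
      using le(2)[of B] B L * by auto
    ultimately show ?thesis by (simp add: ennreal_add_left_cancel_le)
  qed
  have "emeasure T B \<le> emeasure D B" for B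
  proof (cases "B \<in> sets L")
    case True
    then have [measurable]: "B \<in> sets L" .
    have split: "emeasure N B = emeasure N (B \<inter> A) + emeasure N (B - A)" if "sets N = sets L" for N
      using that True by (subst plus_emeasure) (auto intro!: arg_cong[of _ _ "emeasure N"])
    have "sets D = sets L" using D L by simp
    from split[OF T(2)] split[OF this] show ?thesis
      using TA[of "B \<inter> A"] TA'[of "B - A"] by (auto intro!: add_mono)
  next
    case False
    then show ?thesis using T(2) by (simp add: emeasure_notin_sets)
  qed
  then have "T \<le> D"
    using T(2) D L sets_eq_imp_space_eq[of T D] by (auto simp: le_measure_iff le_fun_def)
  then show ?thesis unfolding T_def[symmetric]
    using T(2) D L by (intro nn_integral_mono_measure) auto
qed

text \<open>Together with the converse approximation below, this writes the weighted total variation as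
  a supremum of quantities that are continuous under weak convergence of \<open>\<mu>\<close>; lower semicontinuity
  of the error functional is the consequence that is needed.\<close>

lemma tv_diff_test_function_le:
  fixes u \<phi> :: "'a \<Rightarrow> real"
  assumes "sigma_finite_measure \<nu>" "finite_measure \<mu>" and s: "sets \<mu> = sets \<nu>"
    and u: "integrable \<nu> u" "integrable \<mu> u" "\<And>x. 0 \<le> u x"
    and \<phi>: "\<phi> \<in> borel_measurable \<nu>" "\<And>x. \<bar>\<phi> x\<bar> \<le> 1"
  shows "ennreal ((\<integral>x. \<phi> x * u x \<partial>\<nu>) - (\<integral>x. \<phi> x * u x \<partial>\<mu>)) \<le> (\<integral>\<^sup>+x. ennreal (u x) \<partial>tv_diff \<nu> \<mu>)"
proof -
  obtain L f h where "joint_densities \<nu> \<mu> L f h" using joint_densities_exist[OF assms(1-3)] .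
  then interpret joint_densities \<nu> \<mu> L f h .
  note L = sets_L
  have [measurable]: "u \<in> borel_measurable L"
    unfolding measurable_cong_sets[OF L refl] by (rule borel_measurable_integrable[OF u(1)])
  have [measurable]: "\<phi> \<in> borel_measurable L"
    unfolding measurable_cong_sets[OF L refl] by (rule \<phi>(1))
  have int: "integrable L (\<lambda>x. f x * u x)" "integrable L (\<lambda>x. h x * u x)"
    using u(1,2) pos unfolding eq(1,2) by (simp_all add: integrable_density)
  have ints: "integrable L (\<lambda>x. f x * (\<phi> x * u x))" "integrable L (\<lambda>x. h x * (\<phi> x * u x))"
    by (rule Bochner_Integration.integrable_bound[OF int(1)],
        use \<phi>(2) in \<open>auto simp: abs_mult intro!: mult_left_mono mult_left_le_one_le\<close>)
       (rule Bochner_Integration.integrable_bound[OF int(2)],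
        use \<phi>(2) in \<open>auto simp: abs_mult intro!: mult_left_mono mult_left_le_one_le\<close>)
  have I: "integrable L (\<lambda>x. \<bar>f x - h x\<bar> * u x)"
  proof -
    have "integrable L (\<lambda>x. \<bar>f x * u x - h x * u x\<bar>)"
      by (intro Bochner_Integration.integrable_diff integrable_abs int)
    also have "(\<lambda>x. \<bar>f x * u x - h x * u x\<bar>) = (\<lambda>x. \<bar>f x - h x\<bar> * u x)"
      using u(3) by (auto simp: abs_mult simp flip: left_diff_distrib)
    finally show ?thesis .
  qed
  have "(\<integral>x. \<phi> x * u x \<partial>\<nu>) - (\<integral>x. \<phi> x * u x \<partial>\<mu>) = (\<integral>x. f x * (\<phi> x * u x) - h x * (\<phi> x * u x) \<partial>L)"
    unfolding eq(1,2) using ints pos by (simp add: integral_density)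
  also have "\<dots> = (\<integral>x. \<phi> x * (\<bar>f x - h x\<bar> * sgn (f x - h x) * u x) \<partial>L)"
    by (intro Bochner_Integration.integral_cong) (auto simp: abs_mult_sgn algebra_simps)
  also have "\<dots> \<le> (\<integral>x. \<bar>f x - h x\<bar> * u x \<partial>L)"
  proof (rule integral_mono)
    show "integrable L (\<lambda>x. \<bar>f x - h x\<bar> * u x)" by (rule I)
    have *: "\<bar>\<phi> x * (\<bar>f x - h x\<bar> * sgn (f x - h x) * u x)\<bar> \<le> \<bar>f x - h x\<bar> * u x" for x
    proof -
      have "\<bar>\<phi> x * (\<bar>f x - h x\<bar> * sgn (f x - h x) * u x)\<bar> = \<bar>\<phi> x\<bar> * (\<bar>f x - h x\<bar> * u x)"
        using u(3)[of x] by (auto simp: abs_mult sgn_if)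
      also have "\<dots> \<le> 1 * (\<bar>f x - h x\<bar> * u x)"
        using \<phi>(2)[of x] u(3)[of x] by (intro mult_right_mono) auto
      finally show ?thesis by simp
    qed
    show "integrable L (\<lambda>x. \<phi> x * (\<bar>f x - h x\<bar> * sgn (f x - h x) * u x))"
      by (rule Bochner_Integration.integrable_bound[OF I]) (use * u(3) in \<open>auto\<close>)
    show "\<phi> x * (\<bar>f x - h x\<bar> * sgn (f x - h x) * u x) \<le> \<bar>f x - h x\<bar> * u x" for x
      using *[of x] by linarith
  qed
  finally have "ennreal ((\<integral>x. \<phi> x * u x \<partial>\<nu>) - (\<integral>x. \<phi> x * u x \<partial>\<mu>)) \<le> ennreal (\<integral>x. \<bar>f x - h x\<bar> * u x \<partial>L)"
    by (rule ennreal_leI)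
  also have "\<dots> \<le> (\<integral>\<^sup>+x. ennreal (\<bar>f x - h x\<bar> * u x) \<partial>L)"
    using I u(3) by (intro nn_integral_eq_integral[symmetric] eq_refl) auto
  also have "\<dots> = (\<integral>\<^sup>+x. ennreal (u x) \<partial>tv_diff \<nu> \<mu>)"
    unfolding eq(3) by (simp add: nn_integral_density ennreal_mult u(3))
  finally show ?thesis .
qed

text \<open>Inner regularity puts most of the mass on two disjoint compact sets, one on each side of \<open>A\<close>,
  and Urysohn's lemma separates them. The cutoff to \<open>[-R, R]\<close> is there because \<open>\<phi>\<close> will be
  multiplied by the unbounded weight \<open>\<bar>y\<bar> ^ n\<close>, and only bounded continuous functions pass to weak
  limits.\<close>

lemma continuous_near_indicator:
  fixes \<rho> :: "real measure"
  assumes fin: "finite_measure \<rho>" and s: "sets \<rho> = sets borel" and A: "A \<in> sets borel" and e: "0 < e"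
  obtains \<phi> :: "real \<Rightarrow> real" and R and K K' where "continuous_on UNIV \<phi>" "\<And>x. \<bar>\<phi> x\<bar> \<le> 1"
    "\<And>x. R \<le> \<bar>x\<bar> \<Longrightarrow> \<phi> x = 0" "0 < R"
    "K \<in> sets borel" "K' \<in> sets borel" "K \<subseteq> A" "K' \<subseteq> - A"
    "\<And>x. x \<in> K \<Longrightarrow> \<phi> x = 1" "\<And>x. x \<in> K' \<Longrightarrow> \<phi> x = -1"
    "measure \<rho> (- (K \<union> K')) \<le> e"
proof -
  interpret finite_measure \<rho> by fact
  have approx: "\<exists>K. K \<subseteq> B \<and> compact K \<and> measure \<rho> (B - K) \<le> e / 2" if B: "B \<in> sets borel" for B
  proof -
    have "emeasure \<rho> B = (SUP K \<in> {K. K \<subseteq> B \<and> compact K}. emeasure \<rho> K)"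
      using inner_regular[OF s] B by simp
    then have "\<exists>K\<in>{K. K \<subseteq> B \<and> compact K}. emeasure \<rho> B < emeasure \<rho> K + ennreal (e / 2)"
      using e emeasure_finite[of B] by (intro SUP_approx_ennreal) auto
    then obtain K where K: "K \<subseteq> B" "compact K" "emeasure \<rho> B < emeasure \<rho> K + ennreal (e/2)" by auto
    have "ennreal (measure \<rho> B) < ennreal (measure \<rho> K + e/2)"
      using K(3) e by (simp add: emeasure_eq_measure)
    then have "measure \<rho> B < measure \<rho> K + e/2" by (simp add: ennreal_less_iff)
    moreover have "measure \<rho> (B - K) = measure \<rho> B - measure \<rho> K"
      using K B s by (intro finite_measure_Diff) (auto intro: borel_closed compact_imp_closed)
    ultimately show ?thesis using K by auto
  qed
  obtain K where K: "K \<subseteq> A" "compact K" "measure \<rho> (A - K) \<le> e/2" using approx[OF A] by auto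
  obtain K' where K': "K' \<subseteq> - A" "compact K'" "measure \<rho> (- A - K') \<le> e/2" using approx[of "-A"] A by auto
  have borel: "K \<in> sets borel" "K' \<in> sets borel" using K K' by (auto intro: borel_closed compact_imp_closed)
  have "bounded (K \<union> K')" using K K' by (auto intro: compact_imp_bounded)
  then obtain R where R: "0 < R" "\<And>x. x \<in> K \<union> K' \<Longrightarrow> \<bar>x\<bar> \<le> R" by (auto simp: bounded_pos)
  obtain \<psi> :: "real \<Rightarrow> real" where \<psi>: "continuous_on UNIV \<psi>" "\<And>x. \<psi> x \<in> closed_segment 1 (-1)"
    "\<And>x. x \<in> K \<Longrightarrow> \<psi> x = 1" "\<And>x. x \<in> K' \<Longrightarrow> \<psi> x = -1"
    using Urysohn[of K K' "1::real" "-1"] K K' compact_imp_closed by blast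
  define cut where "cut x = max 0 (min 1 (R + 1 - \<bar>x\<bar>))" for x :: real
  have \<psi>1: "\<bar>\<psi> x\<bar> \<le> 1" for x using \<psi>(2)[of x] by (auto simp: closed_segment_eq_real_ivl abs_le_iff split: if_splits)
  have "measure \<rho> (- (K \<union> K')) = measure \<rho> ((A - K) \<union> (- A - K'))"
    using K(1) K'(1) by (intro arg_cong[of _ _ "measure \<rho>"]) auto
  also have "\<dots> \<le> measure \<rho> (A - K) + measure \<rho> (- A - K')"
    using borel A s by (intro measure_Un_le) auto
  finally have m: "measure \<rho> (- (K \<union> K')) \<le> e" using K K' by simp
  show ?thesis
  proof (rule that[of "\<lambda>x. cut x * \<psi> x" "R + 1" K K'])
    show "continuous_on UNIV (\<lambda>x. cut x * \<psi> x)" unfolding cut_def by (intro continuous_intros \<psi>)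
    show "\<bar>cut x * \<psi> x\<bar> \<le> 1" for x
      using \<psi>1[of x] by (auto simp: cut_def abs_mult intro!: mult_le_one)
    show "cut x * \<psi> x = 0" if "R + 1 \<le> \<bar>x\<bar>" for x using that by (simp add: cut_def)
    show "cut x * \<psi> x = 1" if "x \<in> K" for x using that R(2)[of x] \<psi> by (simp add: cut_def)
    show "cut x * \<psi> x = -1" if "x \<in> K'" for x using that R(2)[of x] \<psi> by (simp add: cut_def)
  qed (use R K K' borel m in auto)
qed

text \<open>The optimal test function is \<open>sgn (f - h)\<close>. Replacing it by a continuous \<open>\<phi>\<close> with the same values
  outside a set \<open>E\<close> costs at most \<open>2 \<integral> u (f + h)\<close> over \<open>E\<close>, which is why \<open>E\<close> is made small for the
  finite measure \<open>\<rho>\<close> with density \<open>u (f + h)\<close>.\<close>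

lemma tv_diff_test_function_exists:
  fixes u :: "real \<Rightarrow> real"
  assumes "sigma_finite_measure \<nu>" "finite_measure \<mu>" and s: "sets \<mu> = sets \<nu>" and b: "sets \<nu> = sets borel"
    and u: "integrable \<nu> u" "integrable \<mu> u" "\<And>x. 0 \<le> u x" and e: "0 < e"
  obtains \<phi> :: "real \<Rightarrow> real" and R where "continuous_on UNIV \<phi>" "\<And>x. \<bar>\<phi> x\<bar> \<le> 1"
    "\<And>x. R \<le> \<bar>x\<bar> \<Longrightarrow> \<phi> x = 0" "0 < R"
    "(\<integral>\<^sup>+x. ennreal (u x) \<partial>tv_diff \<nu> \<mu>)
       \<le> ennreal ((\<integral>x. \<phi> x * u x \<partial>\<nu>) - (\<integral>x. \<phi> x * u x \<partial>\<mu>) + e)"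
proof -
  obtain L f h where "joint_densities \<nu> \<mu> L f h" using joint_densities_exist[OF assms(1-3)] .
  then interpret joint_densities \<nu> \<mu> L f h .
  note L = sets_L
  have [measurable]: "u \<in> borel_measurable L"
    unfolding measurable_cong_sets[OF L refl] by (rule borel_measurable_integrable[OF u(1)])
  have sL: "sets L = sets borel" using L b by simp
  have spL: "space L = UNIV" using sets_eq_imp_space_eq[OF sL] by simp
  have int: "integrable L (\<lambda>x. f x * u x)" "integrable L (\<lambda>x. h x * u x)"
    using u(1,2) pos unfolding eq(1,2) by (simp_all add: integrable_density)
  define w where "w x = f x * u x + h x * u x" for x
  have w: "integrable L w" "\<And>x. 0 \<le> w x"
    using int pos u(3) by (auto simp: w_def[abs_def])
  have [measurable]: "w \<in> borel_measurable L" using w by auto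
  define \<rho> where "\<rho> = density L (\<lambda>x. ennreal (w x))"
  have fin: "finite_measure \<rho>"
  proof (rule finite_measureI)
    have "emeasure \<rho> (space \<rho>) = (\<integral>\<^sup>+x. ennreal (w x) \<partial>L)"
      by (auto simp: \<rho>_def emeasure_density intro!: nn_integral_cong)
    then show "emeasure \<rho> (space \<rho>) \<noteq> \<infinity>"
      using w by (simp add: nn_integral_eq_integral)
  qed
  define A where "A = {x\<in>space L. h x \<le> f x}"
  have "A \<in> sets L" unfolding A_def by measurable
  then have A: "A \<in> sets borel" using sL by simp
  have \<rho>s: "sets \<rho> = sets borel" using sL by (simp add: \<rho>_def)
  have e2: "0 < e / 2" using e by simp
  show thesis
  proof (rule continuous_near_indicator[OF fin \<rho>s A e2])
    fix \<phi> :: "real \<Rightarrow> real" and R K K'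
    assume \<phi>: "continuous_on UNIV \<phi>" "\<And>x. \<bar>\<phi> x\<bar> \<le> 1"
      "\<And>x. R \<le> \<bar>x\<bar> \<Longrightarrow> \<phi> x = 0" "0 < R"
      "K \<in> sets borel" "K' \<in> sets borel" "K \<subseteq> A" "K' \<subseteq> - A"
      "\<And>x. x \<in> K \<Longrightarrow> \<phi> x = 1" "\<And>x. x \<in> K' \<Longrightarrow> \<phi> x = -1"
      "measure \<rho> (- (K \<union> K')) \<le> e / 2"
    have [measurable]: "\<phi> \<in> borel_measurable L"
      unfolding measurable_cong_sets[OF sL refl] using \<phi>(1) by (rule borel_measurable_continuous_onI)
    define E where "E = - (K \<union> K')"
    have [measurable]: "E \<in> sets L" using \<phi>(5,6) sL unfolding E_def by (auto simp: Compl_eq_Diff_UNIV)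
    have mE: "(\<integral>x. w x * indicator E x \<partial>L) \<le> e / 2"
    proof -
      have "ennreal (\<integral>x. w x * indicator E x \<partial>L) = (\<integral>\<^sup>+x. ennreal (w x * indicator E x) \<partial>L)"
        using w by (intro nn_integral_eq_integral[symmetric] integrable_real_mult_indicator) (auto)
      also have "\<dots> = emeasure \<rho> E"
        unfolding \<rho>_def by (subst emeasure_density) (auto intro!: nn_integral_cong simp: ennreal_indicator ennreal_mult' w split: split_indicator)
      also have "\<dots> \<le> ennreal (e/2)"
        using \<phi>(11) finite_measure.emeasure_eq_measure[OF fin] by (auto simp: E_def intro: ennreal_leI)
      finally show ?thesis using e by (simp add: ennreal_le_iff)
    qed
    have ints: "integrable L (\<lambda>x. f x * (\<phi> x * u x))" "integrable L (\<lambda>x. h x * (\<phi> x * u x))"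
      by (rule Bochner_Integration.integrable_bound[OF int(1)],
          use \<phi>(2) in \<open>auto simp: abs_mult intro!: mult_left_mono mult_left_le_one_le\<close>)
         (rule Bochner_Integration.integrable_bound[OF int(2)],
          use \<phi>(2) in \<open>auto simp: abs_mult intro!: mult_left_mono mult_left_le_one_le\<close>)
    have I: "integrable L (\<lambda>x. \<bar>f x - h x\<bar> * u x)"
    proof -
      have "integrable L (\<lambda>x. \<bar>f x * u x - h x * u x\<bar>)"
        by (intro Bochner_Integration.integrable_diff integrable_abs int)
      also have "(\<lambda>x. \<bar>f x * u x - h x * u x\<bar>) = (\<lambda>x. \<bar>f x - h x\<bar> * u x)"
        using u(3) by (auto simp: abs_mult simp flip: left_diff_distrib)
      finally show ?thesis .
    qed
    have IE: "integrable L (\<lambda>x. w x * indicator E x)"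
      using w by (intro integrable_real_mult_indicator) auto
    have key: "\<bar>f x - h x\<bar> * u x \<le> f x * (\<phi> x * u x) - h x * (\<phi> x * u x) + 2 * (w x * indicator E x)" for x
    proof -
      consider "x \<in> K" | "x \<in> K'" | "x \<in> E" by (auto simp: E_def)
      then show ?thesis
      proof cases
        case 1
        then have "h x \<le> f x" using \<phi>(7) by (auto simp: A_def)
        then show ?thesis using 1 \<phi>(9)[of x] by (auto simp: E_def algebra_simps)
      next
        case 2
        then have "f x < h x" using \<phi>(8) spL by (auto simp: A_def)
        then show ?thesis using 2 \<phi>(10)[of x] by (auto simp: E_def algebra_simps)
      next
        case 3
        have a: "\<bar>f x - h x\<bar> * u x \<le> w x"
          unfolding w_def distrib_right[symmetric] using pos[of x] u(3)[of x] by (intro mult_right_mono) auto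
        have "\<bar>\<phi> x * ((f x - h x) * u x)\<bar> \<le> 1 * w x"
          unfolding abs_mult using \<phi>(2)[of x] a u(3)[of x] by (intro mult_mono) (auto simp: abs_mult)
        then show ?thesis using a 3 by (auto simp: algebra_simps abs_le_iff)
      qed
    qed
    have "(\<integral>\<^sup>+x. ennreal (u x) \<partial>tv_diff \<nu> \<mu>) = (\<integral>\<^sup>+x. ennreal (\<bar>f x - h x\<bar> * u x) \<partial>L)"
      unfolding eq(3) by (simp add: nn_integral_density ennreal_mult u(3))
    also have "\<dots> = ennreal (\<integral>x. \<bar>f x - h x\<bar> * u x \<partial>L)"
      using I u(3) by (intro nn_integral_eq_integral) auto
    also have "\<dots> \<le> ennreal (\<integral>x. f x * (\<phi> x * u x) - h x * (\<phi> x * u x) + 2 * (w x * indicator E x) \<partial>L)"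
      using key by (intro ennreal_leI integral_mono I Bochner_Integration.integrable_add
          Bochner_Integration.integrable_diff integrable_mult_right ints IE)
    also have "(\<integral>x. f x * (\<phi> x * u x) - h x * (\<phi> x * u x) + 2 * (w x * indicator E x) \<partial>L)
        = (\<integral>x. \<phi> x * u x \<partial>\<nu>) - (\<integral>x. \<phi> x * u x \<partial>\<mu>) + 2 * (\<integral>x. w x * indicator E x \<partial>L)"
      unfolding eq(1,2) using ints IE pos by (simp add: integral_density)
    also have "ennreal \<dots> \<le> ennreal ((\<integral>x. \<phi> x * u x \<partial>\<nu>) - (\<integral>x. \<phi> x * u x \<partial>\<mu>) + e)"
      using mE by (intro ennreal_leI) auto
    finally show thesis by (rule that[of \<phi> R, rotated -1]) (fact \<phi>)+
  qed
qed

section \<open>Existence of a minimizing measure\<close>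

lemma integrable_power_of_moment:
  fixes Q :: "real measure"
  assumes "finite_measure Q" and s: "sets Q = sets borel"
    and M: "integrable Q (\<lambda>y. \<bar>y\<bar> ^ n)" and k: "k \<le> n"
  shows "integrable Q (\<lambda>y. y ^ k)"
proof -
  interpret finite_measure Q by fact
  have [measurable]: "(\<lambda>y. y ^ k) \<in> borel_measurable Q"
    unfolding measurable_cong_sets[OF s refl] by measurable
  have "\<bar>y\<bar> ^ k \<le> 1 + \<bar>y\<bar> ^ n" for y :: real
  proof (cases "\<bar>y\<bar> \<le> 1")
    case True
    then have "\<bar>y\<bar> ^ k \<le> 1" by (intro power_le_one) auto
    then show ?thesis by (simp add: add_increasing2)
  next
    case False
    then have "\<bar>y\<bar> ^ k \<le> \<bar>y\<bar> ^ n" using k by (intro power_increasing) auto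
    then show ?thesis by simp
  qed
  then show ?thesis
    by (intro Bochner_Integration.integrable_bound[of Q "\<lambda>y. 1 + \<bar>y\<bar> ^ n" "\<lambda>y. y ^ k"])
       (auto simp: M power_abs)
qed

definition truncate :: "real \<Rightarrow> real \<Rightarrow> real" where
  "truncate R y = max (- R) (min R y)"

lemma continuous_truncate: "continuous_on A (truncate R)"
  unfolding truncate_def by (intro continuous_intros)

lemma truncate_bounds: "0 \<le> R \<Longrightarrow> \<bar>truncate R y\<bar> \<le> R" "0 \<le> R \<Longrightarrow> \<bar>truncate R y\<bar> \<le> \<bar>y\<bar>"
  by (auto simp: truncate_def)

text \<open>Uniform integrability in quantitative form: a bound on the \<open>n\<close>-th absolute moment controls the
  tails of all lower moments at the rate \<open>1 / R\<close>.\<close>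

lemma truncated_moment_error:
  fixes Q :: "real measure"
  assumes fin: "finite_measure Q" and s: "sets Q = sets borel"
    and int: "integrable Q (\<lambda>y. \<bar>y\<bar> ^ n)" and M: "(\<integral>y. \<bar>y\<bar> ^ n \<partial>Q) \<le> M" and k: "k < n" and R: "1 \<le> R"
  shows "\<bar>(\<integral>y. y ^ k \<partial>Q) - (\<integral>y. truncate R y ^ k \<partial>Q)\<bar> \<le> 2 * M / R"
proof -
  interpret finite_measure Q by fact
  have i: "integrable Q (\<lambda>y. y ^ k)" using integrable_power_of_moment[OF fin s int] k by simp
  have [measurable]: "(\<lambda>y. truncate R y ^ k) \<in> borel_measurable Q"
    unfolding measurable_cong_sets[OF s refl]
    by (intro borel_measurable_continuous_onI continuous_on_power continuous_truncate)
  have ic: "integrable Q (\<lambda>y. truncate R y ^ k)"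
    using truncate_bounds[of R] R
    by (intro Bochner_Integration.integrable_bound[OF i]) (auto simp: power_abs power_mono)
  have pt: "\<bar>y ^ k - truncate R y ^ k\<bar> \<le> 2 / R * \<bar>y\<bar> ^ n" for y
  proof (cases "\<bar>y\<bar> \<le> R")
    case True
    then have "truncate R y = y" by (auto simp: truncate_def)
    then show ?thesis using R by simp
  next
    case False
    have "\<bar>y ^ k - truncate R y ^ k\<bar> \<le> \<bar>y\<bar> ^ k + \<bar>truncate R y\<bar> ^ k"
      using abs_triangle_ineq4[of "y ^ k" "truncate R y ^ k"] by (simp add: power_abs)
    also have "\<dots> \<le> 2 * \<bar>y\<bar> ^ k" using truncate_bounds(2)[of R y] R by (simp add: power_mono)
    also have "\<dots> \<le> 2 * (\<bar>y\<bar> ^ n / R)"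
    proof -
      have "\<bar>y\<bar> ^ k * R \<le> \<bar>y\<bar> ^ k * \<bar>y\<bar>" using False by (intro mult_left_mono) auto
      also have "\<dots> = \<bar>y\<bar> ^ Suc k" by simp
      also have "\<dots> \<le> \<bar>y\<bar> ^ n" using k False R by (intro power_increasing) auto
      finally show ?thesis using R by (simp add: pos_le_divide_eq)
    qed
    finally show ?thesis by simp
  qed
  have "\<bar>(\<integral>y. y ^ k \<partial>Q) - (\<integral>y. truncate R y ^ k \<partial>Q)\<bar> = \<bar>\<integral>y. y ^ k - truncate R y ^ k \<partial>Q\<bar>"
    using i ic by simp
  also have "\<dots> \<le> (\<integral>y. \<bar>y ^ k - truncate R y ^ k\<bar> \<partial>Q)" by (rule integral_abs_bound)
  also have "\<dots> \<le> (\<integral>y. 2 / R * \<bar>y\<bar> ^ n \<partial>Q)"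
    using i ic int pt by (intro integral_mono integrable_abs Bochner_Integration.integrable_diff) auto
  also have "\<dots> = 2 / R * (\<integral>y. \<bar>y\<bar> ^ n \<partial>Q)" by simp
  also have "\<dots> \<le> 2 / R * M" using M R by (intro mult_left_mono) auto
  finally show ?thesis by simp
qed

text \<open>Helly's selection theorem for measures of mass \<open>\<Lambda>\<close> instead of \<open>1\<close>; the moment bound gives
  tightness by Markov's inequality.\<close>

lemma moment_bounded_weak_compactness:
  fixes q :: "nat \<Rightarrow> real measure"
  assumes q: "\<And>j. finite_measure (q j)" "\<And>j. sets (q j) = sets borel" "\<And>j. measure (q j) UNIV = \<Lambda>"
    and \<Lambda>: "0 < \<Lambda>" and n: "0 < n"
    and M: "\<And>j. (\<integral>\<^sup>+y. ennreal (\<bar>y\<bar> ^ n) \<partial>q j) \<le> ennreal M" and M0: "0 \<le> M"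
  obtains Q r where "strict_mono (r :: nat \<Rightarrow> nat)" "finite_measure Q" "sets Q = sets borel" "measure Q UNIV = \<Lambda>"
    "\<forall>\<phi>::real \<Rightarrow> real. continuous_on UNIV \<phi> \<longrightarrow> (\<exists>B. \<forall>x. \<bar>\<phi> x\<bar> \<le> B) \<longrightarrow>
       (\<lambda>j. \<integral>y. \<phi> y \<partial>q (r j)) \<longlonglongrightarrow> (\<integral>y. \<phi> y \<partial>Q)"
proof -
  define p where "p j = density (q j) (\<lambda>_. ennreal (1 / \<Lambda>))" for j
  have sp: "sets (p j) = sets borel" "space (p j) = UNIV" "space (q j) = UNIV" for j
    using q(2) sets_eq_imp_space_eq[OF q(2)] by (auto simp: p_def)
  have em: "emeasure (p j) A = ennreal (1 / \<Lambda>) * emeasure (q j) A" if "A \<in> sets borel" for A j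
    using that q(2) by (simp add: p_def emeasure_density_const)
  have "emeasure (p j) (space (p j)) = 1" for j
  proof -
    have "emeasure (q j) UNIV = ennreal \<Lambda>"
      using finite_measure.emeasure_eq_measure[OF q(1)] q(3) by simp
    then show ?thesis using em[of UNIV j] sp \<Lambda> by (simp flip: ennreal_mult')
  qed
  then have prob: "prob_space (p j)" for j by (intro prob_spaceI)
  then have rd: "real_distribution (p j)" for j
    unfolding real_distribution_def real_distribution_axioms_def using sp by auto
  have "tight p"
    unfolding tight_def
  proof (intro conjI allI impI rd)
    fix e :: real assume e: "0 < e"
    define R where "R = 1 + 2 * M / (\<Lambda> * e)"
    have R: "1 \<le> R" using M0 \<Lambda> e by (simp add: R_def)
    have tail: "measure (p j) {-R<..R} > 1 - e" for j
    proof -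
      interpret p: prob_space "p j" by (rule prob)
      let ?T = "{y. R \<le> \<bar>y\<bar>}"
      have T: "?T \<in> sets borel" by measurable
      have "ennreal R * emeasure (q j) ?T = (\<integral>\<^sup>+y. ennreal R * indicator ?T y \<partial>q j)"
        using T q(2) by (subst nn_integral_cmult_indicator) auto
      also have "\<dots> \<le> (\<integral>\<^sup>+y. ennreal (\<bar>y\<bar> ^ n) \<partial>q j)"
      proof (intro nn_integral_mono)
        fix y
        have "R \<le> \<bar>y\<bar> ^ n" if "R \<le> \<bar>y\<bar>"
        proof -
          have "\<bar>y\<bar> ^ 1 \<le> \<bar>y\<bar> ^ n" using that R n by (intro power_increasing) auto
          then show ?thesis using that by simp
        qed
        then show "ennreal R * indicator ?T y \<le> ennreal (\<bar>y\<bar> ^ n)"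
          by (auto simp: indicator_def intro!: ennreal_leI)
      qed
      also have "\<dots> \<le> ennreal M" by (rule M)
      finally have "ennreal R * emeasure (q j) ?T \<le> ennreal M" .
      then have "R * measure (q j) ?T \<le> M"
        using R M0 finite_measure.emeasure_eq_measure[OF q(1)] by (simp flip: ennreal_mult')
      then have "measure (q j) ?T \<le> M / R" using R by (simp add: field_simps)
      also have "\<dots> < \<Lambda> * e"
      proof -
        have "\<Lambda> * e * R = \<Lambda> * e + 2 * M" using \<Lambda> e by (simp add: R_def field_simps)
        moreover have "0 < \<Lambda> * e" using \<Lambda> e by simp
        ultimately have "M < \<Lambda> * e * R" using M0 by linarith
        then show ?thesis using R by (simp add: field_simps)
      qed
      finally have "measure (q j) ?T < \<Lambda> * e" .
      moreover have "measure (p j) ?T = measure (q j) ?T / \<Lambda>"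
        using em[OF T] \<Lambda> by (simp add: measure_def enn2real_mult)
      ultimately have pT: "measure (p j) ?T < e" using \<Lambda> by (simp add: pos_divide_less_eq mult.commute)
      have "1 = measure (p j) UNIV" using p.prob_space sp by simp
      also have "UNIV = {-R<..R} \<union> ?T" by auto
      also have "measure (p j) \<dots> \<le> measure (p j) {-R<..R} + measure (p j) ?T"
        using T sp by (intro measure_Un_le) auto
      finally show ?thesis using pT by simp
    qed
    show "\<exists>a b. a < b \<and> (\<forall>j. 1 - e < measure (p j) {a<..b})"
      using tail R by (intro exI[of _ "-R"] exI[of _ R]) auto
  qed
  then obtain r P where r: "strict_mono r" "real_distribution P" "weak_conv_m (p \<circ> id \<circ> r) P"
    using tight_imp_convergent_subsubsequence[of p id] strict_mono_id by blast
  interpret P: real_distribution P by fact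
  define Q where "Q = density P (\<lambda>_. ennreal \<Lambda>)"
  have emQ: "emeasure Q A = ennreal \<Lambda> * emeasure P A" if "A \<in> sets borel" for A
    using that by (simp add: Q_def emeasure_density_const)
  have sQ: "sets Q = sets borel" "space Q = UNIV"
    using sets_eq_imp_space_eq[of P borel] by (auto simp: Q_def)
  have QU: "emeasure Q UNIV = ennreal \<Lambda>"
    using emQ[of UNIV] P.emeasure_space_1 sets_eq_imp_space_eq[of P borel] by simp
  show ?thesis
  proof (rule that[of r Q])
    show "finite_measure Q" using QU sQ by (intro finite_measureI) auto
    show "measure Q UNIV = \<Lambda>" using QU \<Lambda> by (simp add: measure_def)
    show "\<forall>\<phi>::real \<Rightarrow> real. continuous_on UNIV \<phi> \<longrightarrow> (\<exists>B. \<forall>x. \<bar>\<phi> x\<bar> \<le> B) \<longrightarrow>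
       (\<lambda>j. \<integral>y. \<phi> y \<partial>q (r j)) \<longlonglongrightarrow> (\<integral>y. \<phi> y \<partial>Q)"
    proof (intro allI impI)
      fix \<phi> :: "real \<Rightarrow> real"
      assume c: "continuous_on UNIV \<phi>" and "\<exists>B. \<forall>x. \<bar>\<phi> x\<bar> \<le> B"
      then obtain B where B: "\<And>x. \<bar>\<phi> x\<bar> \<le> B" by auto
      have meas: "\<phi> \<in> borel_measurable borel" using c by (rule borel_measurable_continuous_onI)
      have "(\<lambda>j. integral\<^sup>L ((p \<circ> id \<circ> r) j) \<phi>) \<longlonglongrightarrow> integral\<^sup>L P \<phi>"
        using rd r(2,3) c B
        by (intro weak_conv_imp_integral_bdd_continuous_conv[of "p \<circ> id \<circ> r" P \<phi> B])
           (auto simp: continuous_on_eq_continuous_at)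
      then have "(\<lambda>j. \<Lambda> * integral\<^sup>L (p (r j)) \<phi>) \<longlonglongrightarrow> \<Lambda> * integral\<^sup>L P \<phi>"
        by (intro tendsto_mult_left) simp
      moreover have "\<Lambda> * integral\<^sup>L (p j) \<phi> = (\<integral>y. \<phi> y \<partial>q j)" for j
        unfolding p_def using \<Lambda> meas measurable_cong_sets[OF q(2) refl]
        by (subst integral_density) auto
      moreover have "\<Lambda> * integral\<^sup>L P \<phi> = (\<integral>y. \<phi> y \<partial>Q)"
        unfolding Q_def using \<Lambda> meas measurable_cong_sets[OF P.events_eq_borel refl]
        by (subst integral_density) auto
      ultimately show "(\<lambda>j. \<integral>y. \<phi> y \<partial>q (r j)) \<longlonglongrightarrow> (\<integral>y. \<phi> y \<partial>Q)" by simp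
    qed
  qed (use r sQ in auto)
qed


lemma integrable_abs_power_iff:
  fixes Q :: "real measure"
  assumes "sets Q = sets borel"
  shows "integrable Q (\<lambda>y. \<bar>y\<bar> ^ n) \<longleftrightarrow> (\<integral>\<^sup>+y. ennreal (\<bar>y\<bar> ^ n) \<partial>Q) < \<infinity>"
proof -
  have "(\<lambda>y. \<bar>y\<bar> ^ n) \<in> borel_measurable Q"
    unfolding measurable_cong_sets[OF assms refl] by measurable
  then show ?thesis by (simp add: integrable_iff_bounded)
qed

lemma nn_integral_power_le_of_truncations:
  fixes Q :: "real measure"
  assumes s: "sets Q = sets borel"
    and le: "\<And>m::nat. (\<integral>\<^sup>+y. ennreal (min (\<bar>y\<bar> ^ n) m) \<partial>Q) \<le> M"
  shows "(\<integral>\<^sup>+y. ennreal (\<bar>y\<bar> ^ n) \<partial>Q) \<le> M"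
proof -
  have meas: "(\<lambda>y. ennreal (min (\<bar>y\<bar> ^ n) (real m))) \<in> borel_measurable Q" for m
    unfolding measurable_cong_sets[OF s refl] by measurable
  have "liminf (\<lambda>m. ennreal (min (\<bar>y\<bar> ^ n) (real m))) = ennreal (\<bar>y\<bar> ^ n)" for y :: real
  proof (intro lim_imp_Liminf tendsto_ennrealI)
    have "eventually (\<lambda>m. \<bar>y\<bar> ^ n \<le> real m) sequentially"
      by (meson eventually_sequentiallyI of_nat_mono order_trans real_arch_simple)
    then have "eventually (\<lambda>m. min (\<bar>y\<bar> ^ n) (real m) = \<bar>y\<bar> ^ n) sequentially"
      by eventually_elim simp
    then show "(\<lambda>m. min (\<bar>y\<bar> ^ n) (real m)) \<longlonglongrightarrow> \<bar>y\<bar> ^ n"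
      by (rule tendsto_eventually)
  qed simp
  then have "(\<integral>\<^sup>+y. ennreal (\<bar>y\<bar> ^ n) \<partial>Q) = (\<integral>\<^sup>+y. liminf (\<lambda>m. ennreal (min (\<bar>y\<bar> ^ n) (real m))) \<partial>Q)"
    by simp
  also have "\<dots> \<le> liminf (\<lambda>m. \<integral>\<^sup>+y. ennreal (min (\<bar>y\<bar> ^ n) (real m)) \<partial>Q)"
    by (rule nn_integral_liminf[OF meas])
  also have "\<dots> \<le> liminf (\<lambda>m::nat. M)"
    by (intro Liminf_mono always_eventually allI le)
  finally show ?thesis by (simp add: Liminf_const)
qed

text \<open>The direct approach of the calculus of variations. Along a minimizing sequence the \<open>n\<close>-th
  moments are bounded by that of \<open>\<nu>\<close> plus the error, so a subsequence converges weakly. The mass and the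
  moments of order below \<open>n\<close> survive in the limit because the \<open>n\<close>-th moments are bounded, so
  the limit \<open>Q\<close> is admissible, and the error does not jump up because it is a supremum of weakly continuous
  functionals. The infimum is taken over finite errors only, so that the whole sequence has
  bounded moments.\<close>

lemma moment_functional_attains_minimum:
  fixes \<nu> :: "real measure"
  assumes sf: "sigma_finite_measure \<nu>" and b: "sets \<nu> = sets borel"
    and int: "integrable \<nu> (\<lambda>y. \<bar>y\<bar> ^ n)" and n: "0 < n" and \<Lambda>: "0 < \<Lambda>"
    and feasible: "\<mu>0 \<in> admissible \<nu> n \<Lambda>" "J \<nu> n \<mu>0 < \<infinity>"
  obtains \<mu> where "\<mu> \<in> admissible \<nu> n \<Lambda>" "\<forall>\<mu>'\<in>admissible \<nu> n \<Lambda>. J \<nu> n \<mu> \<le> J \<nu> n \<mu>'"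
proof -
  define S where "S = J \<nu> n ` {\<mu>\<in>admissible \<nu> n \<Lambda>. J \<nu> n \<mu> < \<infinity>}"
  have "S \<noteq> {}" using feasible by (auto simp: S_def)
  then obtain e where e: "decseq e" "range e \<subseteq> S" "Inf S = (INF i. e i)"
    using ennreal_Inf_countable_INF by blast
  have "\<forall>j. \<exists>q. q \<in> admissible \<nu> n \<Lambda> \<and> J \<nu> n q = e j \<and> e j < \<infinity>"
  proof
    fix j
    have "e j \<in> S" using e(2) by auto
    then obtain q where "q \<in> admissible \<nu> n \<Lambda>" "J \<nu> n q < \<infinity>" "e j = J \<nu> n q"
      unfolding S_def by blast
    then show "\<exists>q. q \<in> admissible \<nu> n \<Lambda> \<and> J \<nu> n q = e j \<and> e j < \<infinity>" by auto
  qed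
  then obtain q where q: "\<And>j. q j \<in> admissible \<nu> n \<Lambda>" "\<And>j. J \<nu> n (q j) = e j" "\<And>j. e j < \<infinity>"
    by metis
  have adm: "finite_measure (q j)" "sets (q j) = sets borel" "measure (q j) UNIV = \<Lambda>" for j
    using q(1)[of j] by (auto simp: admissible_def)
  have qmom: "(\<integral>y. y ^ k \<partial>q j) = (\<integral>y. y ^ k \<partial>\<nu>)" if "k \<in> {2..n - 1}" for j k
    using q(1)[of j] that by (auto simp: admissible_def has_bochner_integral_iff)
  define u where "u y = \<bar>y\<bar> ^ n" for y :: real
  have u: "continuous_on A u" "\<And>y. 0 \<le> u y" for A unfolding u_def by (auto intro!: continuous_intros)
  define M where "M = (\<integral>y. u y \<partial>\<nu>) + enn2real (e 0)"
  have M0: "0 \<le> M" using u by (simp add: M_def)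
  have qM: "(\<integral>\<^sup>+y. ennreal (u y) \<partial>q j) \<le> ennreal M" for j
  proof -
    have "(\<lambda>y. ennreal (u y)) \<in> borel_measurable \<nu>"
      unfolding measurable_cong_sets[OF b refl] u_def by measurable
    then have "(\<integral>\<^sup>+y. ennreal (u y) \<partial>q j) \<le> (\<integral>\<^sup>+y. ennreal (u y) \<partial>\<nu>) + J \<nu> n (q j)"
      unfolding J_def u_def[symmetric] using adm b
      by (intro nn_integral_le_tv_diff(2)[OF sf]) auto
    also have "\<dots> \<le> (\<integral>\<^sup>+y. ennreal (u y) \<partial>\<nu>) + e 0"
      using q(2) e(1) by (auto simp: decseq_def intro: add_left_mono)
    also have "(\<integral>\<^sup>+y. ennreal (u y) \<partial>\<nu>) = ennreal (\<integral>y. u y \<partial>\<nu>)"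
      using int u by (intro nn_integral_eq_integral) (auto simp: u_def)
    also have "\<dots> + e 0 = ennreal M"
      using q(3)[of 0] u by (simp add: M_def)
    finally show ?thesis .
  qed
  obtain Q r where r: "strict_mono (r :: nat \<Rightarrow> nat)" and Q: "finite_measure Q" "sets Q = sets borel" "measure Q UNIV = \<Lambda>"
    and conv: "\<forall>\<phi>::real \<Rightarrow> real. continuous_on UNIV \<phi> \<longrightarrow> (\<exists>B. \<forall>x. \<bar>\<phi> x\<bar> \<le> B) \<longrightarrow>
       (\<lambda>j. \<integral>y. \<phi> y \<partial>q (r j)) \<longlonglongrightarrow> (\<integral>y. \<phi> y \<partial>Q)"
    using moment_bounded_weak_compactness[OF adm \<Lambda> n qM[unfolded u_def] M0] .
  have intq: "integrable (q j) u" for j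
    unfolding u_def integrable_abs_power_iff[OF adm(2)] using qM[of j] by (auto simp: u_def intro: le_less_trans)
  have qMi: "(\<integral>y. u y \<partial>q j) \<le> M" for j
    using qM[of j] M0 u intq by (subst (asm) nn_integral_eq_integral) (auto simp: ennreal_le_iff)
  have "(\<integral>\<^sup>+y. ennreal (min (u y) m) \<partial>Q) \<le> ennreal M" for m :: nat
  proof -
    define \<phi> where "\<phi> y = min (u y) (real m)" for y
    have \<phi>: "continuous_on UNIV \<phi>" "\<bar>\<phi> y\<bar> \<le> real m" "0 \<le> \<phi> y" for y
    proof -
      show "continuous_on UNIV \<phi>" unfolding \<phi>_def by (intro continuous_intros u)
      show "0 \<le> \<phi> y" using u(2)[of y] by (simp add: \<phi>_def)
      then show "\<bar>\<phi> y\<bar> \<le> real m" by (simp add: \<phi>_def)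
    qed
    have lim: "(\<lambda>j. \<integral>y. \<phi> y \<partial>q (r j)) \<longlonglongrightarrow> (\<integral>y. \<phi> y \<partial>Q)" using conv \<phi> by blast
    have i\<phi>: "integrable N \<phi>" if "finite_measure N" "sets N = sets borel" for N
    proof -
      interpret finite_measure N by fact
      have "\<phi> \<in> borel_measurable N" unfolding measurable_cong_sets[OF that(2) refl]
        using \<phi>(1) by (rule borel_measurable_continuous_onI)
      then show ?thesis using \<phi>(2) by (intro integrable_const_bound[of _ "real m"]) auto
    qed
    have "(\<integral>y. \<phi> y \<partial>q j) \<le> M" for j
    proof -
      have "(\<integral>y. \<phi> y \<partial>q j) \<le> (\<integral>y. u y \<partial>q j)"
        by (intro integral_mono i\<phi> adm intq) (simp add: \<phi>_def)
      then show ?thesis using qMi[of j] by linarith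
    qed
    then have "(\<integral>y. \<phi> y \<partial>Q) \<le> M" using LIMSEQ_le_const2[OF lim] by blast
    then have "ennreal (\<integral>y. \<phi> y \<partial>Q) \<le> ennreal M" by (rule ennreal_leI)
    also have "ennreal (\<integral>y. \<phi> y \<partial>Q) = (\<integral>\<^sup>+y. ennreal (\<phi> y) \<partial>Q)"
      using i\<phi> Q \<phi>(3) by (intro nn_integral_eq_integral[symmetric]) auto
    finally show ?thesis by (simp add: \<phi>_def)
  qed
  then have QM: "(\<integral>\<^sup>+y. ennreal (u y) \<partial>Q) \<le> ennreal M"
    unfolding u_def by (rule nn_integral_power_le_of_truncations[OF Q(2)])
  then have intQ: "integrable Q u"
    unfolding u_def integrable_abs_power_iff[OF Q(2)] by (auto intro: le_less_trans)
  have QMi: "(\<integral>y. u y \<partial>Q) \<le> M"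
    using QM M0 u intQ by (subst (asm) nn_integral_eq_integral) (auto simp: ennreal_le_iff)
  have Qmom: "has_bochner_integral Q (\<lambda>y. y ^ k) (\<integral>y. y ^ k \<partial>\<nu>)" if k: "k \<in> {2..n - 1}" for k
  proof -
    define m where "m = (\<integral>y. y ^ k \<partial>\<nu>)"
    define d where "d = \<bar>(\<integral>y. y ^ k \<partial>Q) - m\<bar>"
    have kn: "k < n" using k n by auto
    have dR: "d \<le> 4 * M / R" if R: "1 \<le> R" for R
    proof -
      have "(\<lambda>j. \<integral>y. truncate R y ^ k \<partial>q (r j)) \<longlonglongrightarrow> (\<integral>y. truncate R y ^ k \<partial>Q)"
        using R truncate_bounds(1)[of R]
        by (intro conv[rule_format] continuous_on_power continuous_truncate exI[of _ "R ^ k"])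
           (auto simp: power_abs intro!: power_mono)
      then have "(\<lambda>j. \<bar>m - (\<integral>y. truncate R y ^ k \<partial>q (r j))\<bar>) \<longlonglongrightarrow> \<bar>m - (\<integral>y. truncate R y ^ k \<partial>Q)\<bar>"
        by (intro tendsto_intros)
      moreover have "\<bar>m - (\<integral>y. truncate R y ^ k \<partial>q j)\<bar> \<le> 2 * M / R" for j
        using truncated_moment_error[OF adm(1,2) intq[unfolded u_def] qMi[unfolded u_def] kn R, of j] qmom[OF k]
        by (simp add: m_def)
      ultimately have "\<bar>m - (\<integral>y. truncate R y ^ k \<partial>Q)\<bar> \<le> 2 * M / R"
        by (intro LIMSEQ_le_const2) auto
      moreover have "\<bar>(\<integral>y. y ^ k \<partial>Q) - (\<integral>y. truncate R y ^ k \<partial>Q)\<bar> \<le> 2 * M / R"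
        by (rule truncated_moment_error[OF Q(1,2) intQ[unfolded u_def] QMi[unfolded u_def] kn R])
      ultimately show ?thesis unfolding d_def by linarith
    qed
    have "d = 0"
    proof (rule ccontr)
      assume "d \<noteq> 0"
      then have d: "0 < d" by (simp add: d_def)
      have "d \<le> 4 * M / (1 + 4 * M / d)" using d M0 by (intro dR) auto
      then have "d * (1 + 4 * M / d) \<le> 4 * M" using d M0 by (simp add: pos_le_divide_eq add_pos_nonneg)
      then show False using d by (simp add: distrib_left)
    qed
    then show ?thesis
      using integrable_power_of_moment[OF Q(1,2) intQ[unfolded u_def], of k] kn
      by (simp add: has_bochner_integral_iff d_def m_def)
  qed
  have Qadm: "Q \<in> admissible \<nu> n \<Lambda>" using Q Qmom by (simp add: admissible_def)
  have "J \<nu> n Q \<le> Inf S"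
  proof (rule ennreal_le_epsilon)
    fix \<epsilon> :: real assume \<epsilon>: "0 < \<epsilon>"
    show "J \<nu> n Q \<le> Inf S + ennreal \<epsilon>"
    proof (rule tv_diff_test_function_exists[OF sf Q(1) _ b int[folded u_def] intQ u(2) \<epsilon>])
      show "sets Q = sets \<nu>" using Q b by simp
      fix \<phi> :: "real \<Rightarrow> real" and R
      assume \<phi>: "continuous_on UNIV \<phi>" "\<And>x. \<bar>\<phi> x\<bar> \<le> 1" "\<And>x. R \<le> \<bar>x\<bar> \<Longrightarrow> \<phi> x = 0" "0 < R"
        and le: "(\<integral>\<^sup>+x. ennreal (u x) \<partial>tv_diff \<nu> Q)
          \<le> ennreal ((\<integral>x. \<phi> x * u x \<partial>\<nu>) - (\<integral>x. \<phi> x * u x \<partial>Q) + \<epsilon>)"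
      define a where "a = (\<integral>x. \<phi> x * u x \<partial>\<nu>) - (\<integral>x. \<phi> x * u x \<partial>Q)"
      have bd: "\<bar>\<phi> x * u x\<bar> \<le> R ^ n" for x
      proof (cases "\<bar>x\<bar> \<le> R")
        case True
        then have "\<bar>\<phi> x\<bar> * u x \<le> 1 * R ^ n"
          using \<phi>(2)[of x] u(2)[of x] by (intro mult_mono) (auto simp: u_def intro!: power_mono)
        then show ?thesis using u(2)[of x] by (simp add: abs_mult)
      qed (use \<phi>(3)[of x] \<phi>(4) in auto)
      have "(\<lambda>j. \<integral>x. \<phi> x * u x \<partial>q (r j)) \<longlonglongrightarrow> (\<integral>x. \<phi> x * u x \<partial>Q)"
        using bd by (intro conv[rule_format] continuous_on_mult \<phi>(1) u(1)) auto
      then have lim1: "(\<lambda>j. ennreal ((\<integral>x. \<phi> x * u x \<partial>\<nu>) - (\<integral>x. \<phi> x * u x \<partial>q (r j)))) \<longlonglongrightarrow> ennreal a"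
        unfolding a_def by (intro tendsto_ennrealI tendsto_intros)
      have "e \<longlonglongrightarrow> Inf S" unfolding e(3) by (rule LIMSEQ_INF[OF e(1)])
      then have lim2: "(\<lambda>j. e (r j)) \<longlonglongrightarrow> Inf S"
        using LIMSEQ_subseq_LIMSEQ[OF _ r] by (auto simp: comp_def)
      have "ennreal ((\<integral>x. \<phi> x * u x \<partial>\<nu>) - (\<integral>x. \<phi> x * u x \<partial>q j)) \<le> e j" for j
      proof -
        have "\<phi> \<in> borel_measurable \<nu>" unfolding measurable_cong_sets[OF b refl]
          using \<phi>(1) by (rule borel_measurable_continuous_onI)
        moreover have "sets (q j) = sets \<nu>" using adm(2) b by simp
        ultimately have "ennreal ((\<integral>x. \<phi> x * u x \<partial>\<nu>) - (\<integral>x. \<phi> x * u x \<partial>q j))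
            \<le> (\<integral>\<^sup>+x. ennreal (u x) \<partial>tv_diff \<nu> (q j))"
          using int[folded u_def] intq u(2) \<phi>(2)
          by (intro tv_diff_test_function_le[where \<phi> = \<phi>] sf adm(1))
        then show ?thesis using q(2)[of j] by (simp add: J_def u_def)
      qed
      then have "ennreal a \<le> Inf S" by (intro LIMSEQ_le[OF lim1 lim2]) auto
      moreover have "ennreal (a + \<epsilon>) \<le> ennreal a + ennreal \<epsilon>"
        using \<epsilon> by (cases "0 \<le> a") (auto simp: ennreal_neg intro!: ennreal_leI)
      moreover have "J \<nu> n Q \<le> ennreal (a + \<epsilon>)" using le by (simp add: J_def a_def u_def)
      ultimately show "J \<nu> n Q \<le> Inf S + ennreal \<epsilon>"
        by (meson add_right_mono order_trans)
    qed
  qed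
  then have min: "J \<nu> n Q \<le> J \<nu> n \<mu>'" if "\<mu>' \<in> admissible \<nu> n \<Lambda>" for \<mu>'
  proof (cases "J \<nu> n \<mu>' < \<infinity>")
    case True
    then have "J \<nu> n \<mu>' \<in> S" using that by (auto simp: S_def)
    then show ?thesis using \<open>J \<nu> n Q \<le> Inf S\<close> Inf_lower order_trans by blast
  next
    case False
    then show ?thesis by (simp add: not_less top_unique)
  qed
  show ?thesis by (rule that[OF Qadm]) (use min in blast)
qed

section \<open>Regular variation of the generalized inverse\<close>

text \<open>Both branches of the asymptotic relation say that the ratio tends to \<open>c\<close>. This common form
  lets the cases \<open>c = 0\<close> and \<open>c > 0\<close> be treated alike from here on.\<close>

lemma equiv_at_zero_ratio:
  assumes "equiv_at_zero h c g" and pos: "eventually (\<lambda>x. 0 < g x) (at_right 0)"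
  shows "((\<lambda>x. h x / g x) \<longlongrightarrow> c) (at_right 0)"
proof (cases "c = 0")
  case True
  then have "h \<in> o[at_right 0](g)" using assms by (simp add: equiv_at_zero_def)
  then show ?thesis using True by (auto dest: smalloD_tendsto)
next
  case False
  then have "h \<sim>[at_right 0] (\<lambda>x. c * g x)" using assms by (simp add: equiv_at_zero_def)
  moreover have "eventually (\<lambda>x. h x \<noteq> 0 \<or> c * g x \<noteq> 0) (at_right 0)"
    using pos by eventually_elim (use False in auto)
  ultimately have "((\<lambda>x. h x / (c * g x)) \<longlongrightarrow> 1) (at_right 0)"
    by (rule asymp_equivD_strong)
  then have "((\<lambda>x. c * (h x / (c * g x))) \<longlongrightarrow> c * 1) (at_right 0)"
    by (rule tendsto_mult_left)
  then show ?thesis using False by simp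
qed

lemma filterlim_scale_at_right_0:
  assumes "0 < (l::real)" shows "filterlim (\<lambda>x. l * x) (at_right 0) (at_right 0)"
  using assms unfolding filterlim_at
  by (auto intro!: tendsto_eq_intros simp: eventually_at_filter)

lemma regularly_varying_ratio:
  assumes g: "regularly_varying_at_zero g \<rho>" and u: "((\<lambda>x. u x / g x) \<longlongrightarrow> c) (at_right 0)"
    and pos: "eventually (\<lambda>x. 0 < g x) (at_right 0)" and l: "0 < l"
  shows "((\<lambda>x. u (l * x) / g x) \<longlongrightarrow> c * l powr \<rho>) (at_right 0)"
proof -
  have "((\<lambda>x. u (l * x) / g (l * x)) \<longlongrightarrow> c) (at_right 0)"
    by (rule filterlim_compose[OF u filterlim_scale_at_right_0[OF l]])
  then have "((\<lambda>x. u (l * x) / g (l * x) * (g (l * x) / g x)) \<longlongrightarrow> c * l powr \<rho>) (at_right 0)"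
    using g l by (intro tendsto_mult) (auto simp: regularly_varying_at_zero_def)
  moreover have "eventually (\<lambda>x. u (l * x) / g (l * x) * (g (l * x) / g x) = u (l * x) / g x) (at_right 0)"
    using eventually_compose_filterlim[OF pos filterlim_scale_at_right_0[OF l]]
    by eventually_elim simp
  ultimately show ?thesis by (rule Lim_transform_eventually)
qed

lemma regularly_varying_at_zero_eventually_pos:
  assumes "regularly_varying_at_zero g \<rho>"
  shows "eventually (\<lambda>x. 0 < g x) (at_right 0)"
  using assms unfolding regularly_varying_at_zero_def eventually_at_right_field by force

text \<open>For a bare regularly varying function this would need the uniform convergence theorem. Here
  \<open>g\<close> is comparable with a monotone function \<open>u\<close>, and \<open>u (x / 2) \<ge> b * u x\<close> with a fixed \<open>b > 1\<close> can
  simply be iterated.\<close>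

lemma regularly_varying_at_zero_blowup:
  assumes g: "regularly_varying_at_zero g (- \<alpha>)" and \<alpha>: "0 < \<alpha>"
    and u: "((\<lambda>x. u x / g x) \<longlongrightarrow> c) (at_right 0)" and c: "0 < c"
    and anti: "\<And>x y. 0 < x \<Longrightarrow> x \<le> y \<Longrightarrow> u y \<le> u x"
  shows "filterlim u at_top (at_right 0)" "filterlim g at_top (at_right 0)"
proof -
  note pos = regularly_varying_at_zero_eventually_pos[OF g]
  have upos: "eventually (\<lambda>x. 0 < u x) (at_right 0)"
    using order_tendstoD(1)[OF u c] pos by eventually_elim (simp add: zero_less_divide_iff)
  \<comment> \<open>Any number strictly between \<open>1\<close> and \<open>2 powr \<alpha>\<close> would do.\<close>
  define b where "b = (1/2) powr (- \<alpha> / 2)"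
  have b: "1 < b" "b < (1/2) powr (- \<alpha>)"
    using \<alpha> by (auto simp: b_def powr_def mult_neg_neg divide_neg_pos ln_div)
  have "((\<lambda>x. (u (1/2 * x) / g x) / (u x / g x)) \<longlongrightarrow> (c * (1/2) powr (- \<alpha>)) / c) (at_right 0)"
    using c by (intro tendsto_divide regularly_varying_ratio[OF g u pos] u) auto
  then have "eventually (\<lambda>x. b < (u (1/2 * x) / g x) / (u x / g x)) (at_right 0)"
    using b c by (intro order_tendstoD(1)) auto
  then have "eventually (\<lambda>x. b * u x \<le> u (x / 2) \<and> 0 < u x) (at_right 0)"
    using pos upos by eventually_elim (auto simp: field_simps)
  then obtain x0 where x0: "0 < x0" "\<And>x. 0 < x \<Longrightarrow> x < x0 \<Longrightarrow> b * u x \<le> u (x / 2) \<and> 0 < u x"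
    unfolding eventually_at_right_field by auto
  define x1 where "x1 = x0 / 2"
  have x1: "0 < x1" "x1 < x0" using x0 by (auto simp: x1_def)
  have it: "b ^ k * u x1 \<le> u (x1 / 2 ^ k)" for k
  proof (induction k)
    case (Suc k)
    have "x1 / 2 ^ k \<le> x1" using x1 by (simp add: divide_le_eq)
    then have "b * u (x1 / 2 ^ k) \<le> u (x1 / 2 ^ k / 2)" using x0(2)[of "x1 / 2 ^ k"] x1 by auto
    moreover have "b * (b ^ k * u x1) \<le> b * u (x1 / 2 ^ k)" using Suc b by (intro mult_left_mono) auto
    ultimately show ?case by (simp add: mult_ac)
  qed simp
  show lim: "filterlim u at_top (at_right 0)"
    unfolding filterlim_at_top
  proof
    fix Z :: real
    obtain k where "Z / u x1 < b ^ k" using real_arch_pow[OF b(1)] by blast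
    then have k: "Z \<le> b ^ k * u x1" using x0(2)[OF x1] by (simp add: field_simps)
    have "Z \<le> u x" if "0 < x" "x < x1 / 2 ^ k" for x
      using anti[of x "x1 / 2 ^ k"] it[of k] k that by simp
    then show "eventually (\<lambda>x. Z \<le> u x) (at_right 0)"
      unfolding eventually_at_right_field using x1 by (intro exI[of _ "x1 / 2 ^ k"]) auto
  qed
  have "((\<lambda>x. inverse (u x / g x)) \<longlongrightarrow> inverse c) (at_right 0)"
    using u c by (intro tendsto_inverse) auto
  then have "filterlim (\<lambda>x. inverse (u x / g x) * u x) at_top (at_right 0)"
    by (rule filterlim_tendsto_pos_mult_at_top) (use c lim in auto)
  moreover have "eventually (\<lambda>x. inverse (u x / g x) * u x = g x) (at_right 0)"
    using upos by eventually_elim simp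
  ultimately show "filterlim g at_top (at_right 0)"
    by (rule filterlim_mono_eventually[OF _ order_refl order_refl])
qed

lemma gen_inverse_upper: "0 < x \<Longrightarrow> g x < \<Lambda> \<Longrightarrow> gen_inverse g \<Lambda> \<le> x"
  unfolding gen_inverse_def by (rule cInf_lower) (auto intro!: bdd_belowI[of _ 0])

lemma gen_inverse_lower: "0 < x \<Longrightarrow> x < gen_inverse g \<Lambda> \<Longrightarrow> \<Lambda> \<le> g x"
  using gen_inverse_upper[of x g \<Lambda>] by force

lemma gen_inverse_approx:
  assumes "\<exists>x>0. g x < \<Lambda>" "gen_inverse g \<Lambda> < z"
  obtains x where "0 < x" "gen_inverse g \<Lambda> \<le> x" "x < z" "g x < \<Lambda>"
proof -
  have "\<exists>x\<in>{x. 0 < x \<and> g x < \<Lambda>}. x < z"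
    using assms unfolding gen_inverse_def by (intro cInf_lessD) auto
  then show ?thesis using that gen_inverse_upper by blast
qed

locale blowup_inverse =
  fixes g :: "real \<Rightarrow> real" and \<alpha> :: real
  assumes rv: "regularly_varying_at_zero g (- \<alpha>)" and \<alpha>_pos: "0 < \<alpha>"
    and blowup: "filterlim g at_top (at_right 0)"
begin

abbreviation G :: "real \<Rightarrow> real" where "G \<equiv> gen_inverse g"

lemma nonempty: "eventually (\<lambda>\<Lambda>. \<exists>x>0. g x < \<Lambda>) at_top"
  using eventually_gt_at_top[of "g 1"] by eventually_elim (auto intro: exI[of _ 1])

lemma G_pos: "eventually (\<lambda>\<Lambda>. 0 < G \<Lambda>) at_top"
  using nonempty
proof eventually_elim
  case (elim \<Lambda>)
  have "eventually (\<lambda>x. \<Lambda> \<le> g x) (at_right 0)" using blowup by (auto simp: filterlim_at_top)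
  then obtain \<eta> where \<eta>: "0 < \<eta>" "\<And>x. 0 < x \<Longrightarrow> x < \<eta> \<Longrightarrow> \<Lambda> \<le> g x"
    unfolding eventually_at_right_field by auto
  have "\<eta> \<le> G \<Lambda>" unfolding gen_inverse_def
    using elim by (intro cInf_greatest) (auto simp: not_less[symmetric] dest: \<eta>(2))
  with \<eta> show ?case by simp
qed

lemma G_antimono: "\<lbrakk>\<exists>x>0. g x < \<Lambda>; \<Lambda> \<le> \<Lambda>'\<rbrakk> \<Longrightarrow> G \<Lambda>' \<le> G \<Lambda>"
  unfolding gen_inverse_def
  by (rule cInf_superset_mono) (auto intro!: bdd_belowI[of _ 0])

lemma G_small: "0 < \<eta> \<Longrightarrow> eventually (\<lambda>\<Lambda>. G \<Lambda> < \<eta>) at_top"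
  using eventually_gt_at_top[of "g (\<eta> / 2)"]
  by eventually_elim (use gen_inverse_upper[of "\<eta> / 2" g] in \<open>force\<close>)

lemma G_at_right_0: "filterlim G (at_right 0) at_top"
  unfolding filterlim_at
proof
  show "(G \<longlongrightarrow> 0) at_top"
  proof (rule order_tendstoI)
    fix a :: real assume "a < 0"
    show "eventually (\<lambda>\<Lambda>. a < G \<Lambda>) at_top"
      using G_pos by eventually_elim (use \<open>a < 0\<close> in simp)
  qed (rule G_small)
  show "eventually (\<lambda>\<Lambda>. G \<Lambda> \<in> {0<..} \<and> G \<Lambda> \<noteq> 0) at_top"
    using G_pos by eventually_elim simp
qed

text \<open>Monotonicity of \<open>g\<close> is not assumed; what replaces it is that \<open>g \<ge> \<Lambda>\<close> everywhere below
  \<open>G \<Lambda>\<close>, while \<open>g < \<Lambda>\<close> at points arbitrarily close above. Moving such a point by a factor \<open>t\<close>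
  close to \<open>l powr (- 1 / \<alpha>)\<close> multiplies \<open>g\<close> by nearly \<open>t powr (- \<alpha>)\<close>, which is just below or
  just above \<open>l\<close>, and this places \<open>G (l * \<Lambda>)\<close> on the correct side of \<open>t * G \<Lambda>\<close>.\<close>

lemma G_regularly_varying:
  assumes l: "0 < l"
  shows "((\<lambda>\<Lambda>. G (l * \<Lambda>) / G \<Lambda>) \<longlongrightarrow> l powr (- (1 / \<alpha>))) at_top"
proof (rule order_tendstoI)
  note pos = regularly_varying_at_zero_eventually_pos[OF rv]
  have scale: "filterlim (\<lambda>\<Lambda>. l * \<Lambda>) at_top at_top"
    using l by (intro filterlim_tendsto_pos_mult_at_top[OF tendsto_const]) (auto simp: filterlim_ident)
  define L where "L = l powr (- (1 / \<alpha>))"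
  have L: "0 < L" "L powr (- \<alpha>) = l" using l \<alpha>_pos by (auto simp: L_def powr_powr)
  note ne = nonempty eventually_compose_filterlim[OF nonempty scale]
  note Gp = G_pos eventually_compose_filterlim[OF G_pos scale]
  {
    fix a assume "l powr (- (1 / \<alpha>)) < a"
    then have a: "L < a" by (simp add: L_def)
    define t where "t = (L + a) / 2"
    have t: "L < t" "t < a" "0 < t" using a L by (auto simp: t_def)
    have "t powr (- \<alpha>) < l" using t L \<alpha>_pos powr_less_mono2_neg[of "- \<alpha>" L t] by simp
    then have "eventually (\<lambda>x. g (t * x) / g x < l) (at_right 0)"
      using rv t L by (intro order_tendstoD(2)) (auto simp: regularly_varying_at_zero_def)
    with pos have "eventually (\<lambda>x. g (t * x) < l * g x) (at_right 0)"
      by eventually_elim (simp add: field_simps)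
    then obtain x0 where x0: "0 < x0" "\<And>x. 0 < x \<Longrightarrow> x < x0 \<Longrightarrow> g (t * x) < l * g x"
      unfolding eventually_at_right_field by auto
    have "eventually (\<lambda>\<Lambda>. G \<Lambda> < x0 * t / a) at_top" using x0 t L a by (intro G_small) auto
    then show "eventually (\<lambda>\<Lambda>. G (l * \<Lambda>) / G \<Lambda> < a) at_top"
      using ne Gp
    proof eventually_elim
      case (elim \<Lambda>)
      have "G \<Lambda> < G \<Lambda> * a / t" using elim t by (simp add: field_simps)
      then obtain x where x: "0 < x" "x < G \<Lambda> * a / t" "g x < \<Lambda>" using gen_inverse_approx elim by metis
      have "G \<Lambda> * a / t < x0" using elim(1) t L a by (simp add: field_simps)
      then have "g (t * x) < l * g x" using x x0 by auto
      also have "\<dots> < l * \<Lambda>" using x l by simp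
      finally have "G (l * \<Lambda>) \<le> t * x" using x t by (intro gen_inverse_upper) auto
      also have "\<dots> < a * G \<Lambda>" using x t by (simp add: field_simps)
      finally show ?case using elim by (simp add: field_simps)
    qed
  }
  {
    fix a assume "a < l powr (- (1 / \<alpha>))"
    then have a: "a < L" by (simp add: L_def)
    define t where "t = (L + max a 0) / 2"
    have t: "a < t" "t < L" "0 < t" using a L by (auto simp: t_def)
    have "l < t powr (- \<alpha>)" using t L \<alpha>_pos powr_less_mono2_neg[of "- \<alpha>" t L] by simp
    then have lt: "(1 / t) powr (- \<alpha>) < 1 / l" using L l t
      by (simp add: powr_divide powr_minus field_simps)
    have "((\<lambda>x. g ((1 / t) * x) / g x) \<longlongrightarrow> (1 / t) powr (- \<alpha>)) (at_right 0)"
      using rv t unfolding regularly_varying_at_zero_def by (metis zero_less_divide_1_iff)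
    then have "eventually (\<lambda>x. g ((1 / t) * x) / g x < 1 / l) (at_right 0)"
      using lt by (rule order_tendstoD(2))
    with pos have "eventually (\<lambda>x. l * g (x / t) < g x) (at_right 0)"
      by eventually_elim (use l in \<open>simp add: field_simps\<close>)
    then obtain x0 where x0: "0 < x0" "\<And>x. 0 < x \<Longrightarrow> x < x0 \<Longrightarrow> l * g (x / t) < g x"
      unfolding eventually_at_right_field by auto
    have "eventually (\<lambda>\<Lambda>. G \<Lambda> < x0 / t) at_top" using x0 t by (intro G_small) auto
    then show "eventually (\<lambda>\<Lambda>. a < G (l * \<Lambda>) / G \<Lambda>) at_top"
      using ne Gp
    proof eventually_elim
      case (elim \<Lambda>)
      show ?case
      proof (rule ccontr)
        assume "\<not> ?case"
        then have "G (l * \<Lambda>) \<le> a * G \<Lambda>" using elim by (simp add: field_simps)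
        also have "\<dots> < t * G \<Lambda>" using t elim by simp
        finally obtain x where x: "0 < x" "x < t * G \<Lambda>" "g x < l * \<Lambda>"
          using gen_inverse_approx elim by metis
        have "t * G \<Lambda> < x0" using elim(1) t by (simp add: field_simps)
        then have "l * g (x / t) < g x" using x x0 by auto
        moreover have "\<Lambda> \<le> g (x / t)" using x t by (intro gen_inverse_lower) (auto simp: field_simps)
        then have "l * \<Lambda> \<le> l * g (x / t)" using l by simp
        ultimately show False using x by linarith
      qed
    qed
  }
qed

lemma rate_regularly_varying:
  "regularly_varying_at_infinity (\<lambda>\<Lambda>. G \<Lambda> ^ n * \<Lambda>) (1 - real n / \<alpha>)"
  unfolding regularly_varying_at_infinity_def
proof (intro conjI allI impI)
  have "eventually (\<lambda>\<Lambda>. 0 < G \<Lambda> \<and> 0 < \<Lambda> \<and> (\<exists>x>0. g x < \<Lambda>)) at_top"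
    by (intro eventually_conj G_pos eventually_gt_at_top nonempty)
  then obtain X where X: "\<And>\<Lambda>. X \<le> \<Lambda> \<Longrightarrow> 0 < G \<Lambda> \<and> 0 < \<Lambda> \<and> (\<exists>x>0. g x < \<Lambda>)"
    unfolding eventually_at_top_linorder by auto
  have "mono_on {X<..} (\<lambda>\<Lambda>. - G \<Lambda>)"
    using X G_antimono by (intro mono_onI) (metis greaterThan_iff less_imp_le neg_le_iff_le)
  then have "(\<lambda>\<Lambda>. - G \<Lambda>) \<in> borel_measurable (restrict_space borel {X<..})"
    by (rule borel_measurable_mono_on_fnc)
  then have [measurable]: "G \<in> borel_measurable (restrict_space borel {X<..})" by simp
  have [measurable]: "(\<lambda>\<Lambda>. \<Lambda>) \<in> borel_measurable (restrict_space borel {X<..})"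
    by (intro measurable_restrict_space1) simp
  have "(\<lambda>\<Lambda>. G \<Lambda> ^ n * \<Lambda>) \<in> borel_measurable (restrict_space borel {X<..})" by measurable
  then show "\<exists>X. (\<forall>x\<in>{X<..}. 0 < G x ^ n * x) \<and>
      (\<lambda>\<Lambda>. G \<Lambda> ^ n * \<Lambda>) \<in> borel_measurable (restrict_space borel {X<..})"
    using X by (intro exI[of _ X]) auto
next
  fix l :: real assume l: "0 < l"
  have "((\<lambda>\<Lambda>. (G (l * \<Lambda>) / G \<Lambda>) ^ n * l) \<longlongrightarrow> (l powr (- (1 / \<alpha>))) ^ n * l) at_top"
    by (intro tendsto_intros G_regularly_varying l)
  also have "(l powr (- (1 / \<alpha>))) ^ n * l = l powr (1 - real n / \<alpha>)"
  proof -
    have "(l powr (- (1 / \<alpha>))) ^ n = l powr (- (real n / \<alpha>))"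
      using l by (simp add: powr_powr flip: powr_realpow)
    then show ?thesis using l by (simp add: powr_diff powr_minus field_simps)
  qed
  finally show "((\<lambda>\<Lambda>. G (l * \<Lambda>) ^ n * (l * \<Lambda>) / (G \<Lambda> ^ n * \<Lambda>)) \<longlongrightarrow> l powr (1 - real n / \<alpha>)) at_top"
  proof (rule Lim_transform_eventually)
    show "eventually (\<lambda>\<Lambda>. (G (l * \<Lambda>) / G \<Lambda>) ^ n * l = G (l * \<Lambda>) ^ n * (l * \<Lambda>) / (G \<Lambda> ^ n * \<Lambda>)) at_top"
      using eventually_gt_at_top[of 0] by eventually_elim (simp add: power_divide)
  qed
qed

context
  fixes u :: "real \<Rightarrow> real" and c :: real
  assumes u: "((\<lambda>x. u x / g x) \<longlongrightarrow> c) (at_right 0)" and c: "0 < c"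
    and anti: "\<And>x y. 0 < x \<Longrightarrow> x \<le> y \<Longrightarrow> u y \<le> u x"
begin

text \<open>At \<open>G \<Lambda> / 2\<close> the function \<open>g\<close> is at least \<open>\<Lambda>\<close>. Going down by a further factor \<open>l\<close>
  multiplies it by about \<open>l powr (- \<alpha>) = 8 / c + 1\<close>, which is enough for \<open>u\<close> to exceed \<open>2 * \<Lambda>\<close>.\<close>

lemma tail_large_below_inverse:
  obtains \<delta> where "0 < \<delta>" "eventually (\<lambda>\<Lambda>. 2 * \<Lambda> \<le> u (\<delta> * G \<Lambda>)) at_top"
proof -
  note pos = regularly_varying_at_zero_eventually_pos[OF rv]
  define b where "b = 8 / c"
  define l where "l = (b + 1) powr (- (1 / \<alpha>))"
  have b: "0 < b" using c by (simp add: b_def)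
  have l: "0 < l" "l powr (- \<alpha>) = b + 1" using b \<alpha>_pos by (auto simp: l_def powr_powr)
  have "((\<lambda>x. u (l * x) / g x) \<longlongrightarrow> c * l powr (- \<alpha>)) (at_right 0)"
    by (rule regularly_varying_ratio[OF rv u pos l(1)])
  moreover have "2 < c * l powr (- \<alpha>)" using l c by (simp add: b_def field_simps)
  ultimately have "eventually (\<lambda>x. 2 < u (l * x) / g x) (at_right 0)"
    by (rule order_tendstoD(1))
  with pos have "eventually (\<lambda>x. 2 * g x \<le> u (l * x)) (at_right 0)"
    by eventually_elim (simp add: field_simps)
  then have "eventually (\<lambda>\<Lambda>. 2 * g (1/2 * G \<Lambda>) \<le> u (l * (1/2 * G \<Lambda>))) at_top"
    by (rule eventually_compose_filterlim)
       (intro filterlim_compose[OF filterlim_scale_at_right_0 G_at_right_0], simp)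
  then have "eventually (\<lambda>\<Lambda>. 2 * \<Lambda> \<le> u (l / 2 * G \<Lambda>)) at_top"
    using G_pos
  proof eventually_elim
    case (elim \<Lambda>)
    have "\<Lambda> \<le> g (1/2 * G \<Lambda>)" using elim by (intro gen_inverse_lower) auto
    then show ?case using elim by simp
  qed
  then show ?thesis using l by (intro that[of "l / 2"]) auto
qed

text \<open>The counterpart on the other side: \<open>g < \<Lambda>\<close> at some point below \<open>2 * G \<Lambda>\<close>, and \<open>u\<close> is monotone.\<close>

lemma tail_small_above_inverse:
  assumes \<epsilon>: "0 < \<epsilon>"
  obtains k where "0 < k" "eventually (\<lambda>\<Lambda>. u (k * G \<Lambda>) \<le> \<epsilon> * \<Lambda>) at_top"
proof -
  note pos = regularly_varying_at_zero_eventually_pos[OF rv]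
  define b where "b = \<epsilon> / (2 * c)"
  define l where "l = b powr (- (1 / \<alpha>))"
  have b: "0 < b" using c \<epsilon> by (simp add: b_def)
  have l: "0 < l" "l powr (- \<alpha>) = b" using b \<alpha>_pos by (auto simp: l_def powr_powr)
  have "((\<lambda>x. u (l * x) / g x) \<longlongrightarrow> c * l powr (- \<alpha>)) (at_right 0)"
    by (rule regularly_varying_ratio[OF rv u pos l(1)])
  moreover have "c * l powr (- \<alpha>) < \<epsilon>" using l c \<epsilon> by (simp add: b_def)
  ultimately have "eventually (\<lambda>x. u (l * x) / g x < \<epsilon>) (at_right 0)"
    by (rule order_tendstoD(2))
  with pos have "eventually (\<lambda>x. u (l * x) \<le> \<epsilon> * g x) (at_right 0)"
    by eventually_elim (simp add: field_simps)
  then obtain x0 where x0: "0 < x0" "\<And>x. 0 < x \<Longrightarrow> x < x0 \<Longrightarrow> u (l * x) \<le> \<epsilon> * g x"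
    unfolding eventually_at_right_field by auto
  have "eventually (\<lambda>\<Lambda>. G \<Lambda> < x0 / 2) at_top" using x0 by (intro G_small) auto
  then have "eventually (\<lambda>\<Lambda>. u (2 * l * G \<Lambda>) \<le> \<epsilon> * \<Lambda>) at_top"
    using G_pos nonempty
  proof eventually_elim
    case (elim \<Lambda>)
    then have "G \<Lambda> < 2 * G \<Lambda>" by simp
    then obtain x where x: "0 < x" "x < 2 * G \<Lambda>" "g x < \<Lambda>" using gen_inverse_approx elim by metis
    have "u (2 * l * G \<Lambda>) \<le> u (l * x)" using x l by (intro anti) auto
    also have "\<dots> \<le> \<epsilon> * g x" using x elim by (intro x0) auto
    also have "\<dots> \<le> \<epsilon> * \<Lambda>" using x \<epsilon> by simp
    finally show ?case .
  qed
  then show ?thesis using l by (intro that[of "2 * l"]) auto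
qed

end

end

section \<open>Moving moments from the origin to a larger scale\<close>

lemma integrable_weighted_poly:
  fixes \<nu> :: "real measure"
  assumes b: "sets \<nu> = sets borel"
    and int: "integrable \<nu> (\<lambda>y. y\<^sup>2 * indicator {y. \<bar>y\<bar> \<le> R} y)"
    and E: "E \<in> sets borel" "E \<subseteq> {y. \<bar>y\<bar> \<le> R}"
  shows "integrable \<nu> (\<lambda>y. y\<^sup>2 * poly p (a * y) * indicator E y)"
proof -
  have "bounded ((\<lambda>y. poly p (a * y)) ` {-R..R})"
    by (intro compact_imp_bounded compact_continuous_image continuous_intros compact_Icc)
  then obtain M where M0: "\<And>z. z \<in> (\<lambda>y. poly p (a * y)) ` {-R..R} \<Longrightarrow> norm z \<le> M"
    unfolding bounded_iff by blast
  have M: "\<bar>poly p (a * y)\<bar> \<le> M" if "\<bar>y\<bar> \<le> R" for y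
    using M0[OF imageI, of y] that by (simp add: abs_le_iff)
  have [measurable]: "(\<lambda>y. y\<^sup>2 * poly p (a * y) * indicator E y) \<in> borel_measurable \<nu>"
    unfolding measurable_cong_sets[OF b refl] using E(1)
    by (intro borel_measurable_times borel_measurable_indicator borel_measurable_continuous_onI
        continuous_intros) auto
  show ?thesis
  proof (rule Bochner_Integration.integrable_bound[OF integrable_mult_right[OF int, of M]])
    show "AE y in \<nu>. norm (y\<^sup>2 * poly p (a * y) * indicator E y) \<le> norm (M * (y\<^sup>2 * indicator {y. \<bar>y\<bar> \<le> R} y))"
    proof (intro AE_I2)
      fix y
      show "norm (y\<^sup>2 * poly p (a * y) * indicator E y) \<le> norm (M * (y\<^sup>2 * indicator {y. \<bar>y\<bar> \<le> R} y))"
      proof (cases "y \<in> E")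
        case True
        then have y: "\<bar>y\<bar> \<le> R" using E by auto
        then have "y\<^sup>2 * \<bar>poly p (a * y)\<bar> \<le> y\<^sup>2 * \<bar>M\<bar>" using M[OF y] by (intro mult_left_mono) auto
        then show ?thesis using True y by (simp add: abs_mult mult_ac)
      qed simp
    qed
  qed measurable
qed

lemma weighted_average_is_value:
  fixes \<nu> :: "real measure"
  assumes b: "sets \<nu> = sets borel"
    and int: "integrable \<nu> (\<lambda>y. y\<^sup>2 * indicator {y. \<bar>y\<bar> \<le> R} y)"
    and E: "E \<in> sets borel" "E \<subseteq> {y. \<bar>y\<bar> \<le> R}"
    and w: "w = (\<integral>y. y\<^sup>2 * indicator E y \<partial>\<nu>)" "0 < w"
    and range: "\<And>y. y \<in> E \<Longrightarrow> a * y \<in> {l..u}" and lu: "l \<le> u"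
  shows "\<exists>t\<in>{l..u}. (\<integral>y. y\<^sup>2 * poly p (a * y) * indicator E y \<partial>\<nu>) / w = poly p t"
proof -
  let ?I = "\<integral>y. y\<^sup>2 * poly p (a * y) * indicator E y \<partial>\<nu>"
  have i: "integrable \<nu> (\<lambda>y. y\<^sup>2 * poly q (a * y) * indicator E y)" for q
    by (rule integrable_weighted_poly[OF b int E])
  have i0: "integrable \<nu> (\<lambda>y. y\<^sup>2 * indicator E y)" using i[of 1] by simp
  obtain c d where cd: "poly p ` {l..u} = {c..d}"
    using continuous_image_closed_interval[OF lu continuous_at_imp_continuous_on[OF ballI[OF poly_isCont]]]
    by blast
  have bd: "c \<le> poly p (a * y) \<and> poly p (a * y) \<le> d" if "y \<in> E" for y
    using range[OF that] cd by (metis atLeastAtMost_iff image_eqI)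
  have "c * w = (\<integral>y. c * (y\<^sup>2 * indicator E y) \<partial>\<nu>)" using w by simp
  also have "\<dots> \<le> ?I"
    using bd i0 i by (intro integral_mono) (auto simp: indicator_def mult.commute intro!: mult_right_mono)
  finally have "c * w \<le> ?I" .
  moreover
  have "?I \<le> (\<integral>y. d * (y\<^sup>2 * indicator E y) \<partial>\<nu>)"
    using bd i0 i by (intro integral_mono) (auto simp: indicator_def mult.commute intro!: mult_right_mono)
  then have "?I \<le> d * w" using w by simp
  ultimately have "?I / w \<in> {c..d}" using w(2) by (simp add: field_simps)
  then obtain t where "t \<in> {l..u}" "?I / w = poly p t" unfolding cd[symmetric] by auto
  then show ?thesis by blast
qed

text \<open>The idea of the upper bound. Removing the mass of \<open>\<nu>\<close> in \<open>[-\<delta> r, \<delta> r]\<close> disturbs the moments of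
  order \<open>2, ..., d + 1\<close>, and the disturbance is repaired by reweighting \<open>\<nu>\<close> on the \<open>d\<close> shells \<open>A i\<close> at scale
  \<open>r\<close>, all on one side of the origin. After rescaling by \<open>r\<close> and weighting by \<open>y\<^sup>2\<close>, the averages over the shells are
  the functionals \<open>L i\<close> of the dual basis \<open>P i\<close>, and the removed moment functional \<open>T\<close> is
  \<open>\<Sum>i. T (P i) * L i\<close>. So the weight on shell \<open>i\<close> must change by the constant \<open>T (P i) / w i\<close>. The
  dual polynomials are uniformly bounded on \<open>[-1, 1]\<close>, so this change has absolute value at most \<open>1\<close> as soon as the
  removed second moment is a small multiple of that of each shell, and the reweighted measure stays
  nonnegative.\<close>

lemma moment_transfer:
  fixes \<nu> :: "real measure" and r \<delta> s :: real and d :: nat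
  defines "A \<equiv> \<lambda>i. {y. (real i + 1) * r < s * y \<and> s * y \<le> (real i + 3/2) * r}"
  assumes b: "sets \<nu> = sets borel" and s: "s = 1 \<or> s = -1" and r: "0 < r" and \<delta>: "0 < \<delta>" "\<delta> \<le> 1"
    and int: "integrable \<nu> (\<lambda>y. y\<^sup>2 * indicator {y. \<bar>y\<bar> \<le> (real d + 1) * r} y)"
    and w_pos: "\<And>i. i < d \<Longrightarrow> 0 < (\<integral>y. y\<^sup>2 * indicator (A i) y \<partial>\<nu>)"
    and small: "\<And>i. i < d \<Longrightarrow> (2 * (real d + 3)) ^ d * (\<integral>y. y\<^sup>2 * indicator {y. \<bar>y\<bar> \<le> \<delta> * r} y \<partial>\<nu>)
                  \<le> (\<integral>y. y\<^sup>2 * indicator (A i) y \<partial>\<nu>)"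
  obtains h :: "real \<Rightarrow> real" where "h \<in> borel_measurable borel" "\<And>y. 0 \<le> h y" "\<And>y. h y \<le> 2"
    "\<And>y. \<bar>y\<bar> \<le> \<delta> * r \<Longrightarrow> h y = 0" "\<And>y. (real d + 1) * r < \<bar>y\<bar> \<Longrightarrow> h y = 1"
    "\<And>k. k < d \<Longrightarrow> integrable \<nu> (\<lambda>y. y ^ (k + 2) * (h y - 1)) \<and> (\<integral>y. y ^ (k + 2) * (h y - 1) \<partial>\<nu>) = 0"
proof -
  define R where "R = (real d + 1) * r"
  define D where "D = {y :: real. \<bar>y\<bar> \<le> \<delta> * r}"
  define a where "a = s / r"
  have s2: "s * s = 1" "\<bar>s\<bar> = 1" using s by auto
  have D: "D \<in> sets borel" "D \<subseteq> {y. \<bar>y\<bar> \<le> R}"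
  proof -
    show "D \<in> sets borel" unfolding D_def by measurable
    have "\<delta> * r \<le> R" unfolding R_def using r \<delta> by (intro mult_right_mono) auto
    then show "D \<subseteq> {y. \<bar>y\<bar> \<le> R}" by (auto simp: D_def)
  qed
  have absA: "(real i + 1) * r < \<bar>y\<bar>" "\<bar>y\<bar> \<le> (real i + 3/2) * r" if "y \<in> A i" for i y
  proof -
    have "0 \<le> (real i + 1) * r" using r by simp
    then have "\<bar>s * y\<bar> = s * y" using that by (auto simp: A_def)
    then have "\<bar>y\<bar> = s * y" using s2 by (simp add: abs_mult)
    then show "(real i + 1) * r < \<bar>y\<bar>" "\<bar>y\<bar> \<le> (real i + 3/2) * r" using that by (auto simp: A_def)
  qed
  have A: "A i \<in> sets borel" "i < d \<Longrightarrow> A i \<subseteq> {y. \<bar>y\<bar> \<le> R}" for i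
  proof -
    show "A i \<in> sets borel" unfolding A_def by measurable
    assume "i < d"
    then have "(real i + 3/2) * r \<le> R" unfolding R_def using r by (intro mult_right_mono) auto
    then show "A i \<subseteq> {y. \<bar>y\<bar> \<le> R}" using absA(2)[of _ i] by fastforce
  qed
  have int': "integrable \<nu> (\<lambda>y. y\<^sup>2 * indicator {y. \<bar>y\<bar> \<le> R} y)" using int by (simp add: R_def)
  note ip = integrable_weighted_poly[OF b int']
  have disj: "i = j" if "y \<in> A i" "y \<in> A j" for i j y
  proof (rule ccontr)
    have *: False if "i < j" "y \<in> A i" "y \<in> A j" for i j
    proof -
      have "real i + 1 \<le> real j" using that by linarith
      then have "(real i + 3/2) * r \<le> (real j + 1) * r" using r by (intro mult_right_mono) auto
      then show False using absA(2)[OF that(2)] absA(1)[OF that(3)] by linarith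
    qed
    assume "i \<noteq> j"
    then show False using *[of i j] *[of j i] that by linarith
  qed
  have AD: "y \<notin> D" if "y \<in> A i" for i y
  proof -
    have "\<delta> * r \<le> (real i + 1) * r" using r \<delta> by (intro mult_right_mono) auto
    then show ?thesis using absA(1)[OF that] by (simp add: D_def)
  qed
  define w where "w i = (\<integral>y. y\<^sup>2 * indicator (A i) y \<partial>\<nu>)" for i
  define L where "L i p = (\<integral>y. y\<^sup>2 * poly p (a * y) * indicator (A i) y \<partial>\<nu>) / w i" for i p
  define T where "T p = (\<integral>y. y\<^sup>2 * poly p (a * y) * indicator D y \<partial>\<nu>)" for p
  have w: "0 < w i" if "i < d" for i using w_pos[OF that] by (simp add: w_def)
  have L_add: "L i (p + q) = L i p + L i q" if "i < d" for i p q
    using ip[OF A(1) A(2)[OF that], of p a] ip[OF A(1) A(2)[OF that], of q a]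
    by (simp add: L_def distrib_left distrib_right add_divide_distrib)
  have L_smult: "L i (smult c p) = c * L i p" if "i < d" for i c p
  proof -
    have "(\<integral>y. y\<^sup>2 * poly (smult c p) (a * y) * indicator (A i) y \<partial>\<nu>)
        = (\<integral>y. c * (y\<^sup>2 * poly p (a * y) * indicator (A i) y) \<partial>\<nu>)"
      by (intro Bochner_Integration.integral_cong) (auto simp: mult_ac)
    then show ?thesis by (simp add: L_def)
  qed
  have L_mean: "\<exists>t\<in>{real i + 1..real i + 3/2}. L i p = poly p t" if "i < d" for i p
    unfolding L_def
  proof (rule weighted_average_is_value[OF b int' A(1) A(2)[OF that] w_def w[OF that]])
    fix y assume "y \<in> A i"
    then show "a * y \<in> {real i + 1..real i + 3/2}" using r by (auto simp: A_def a_def field_simps)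
  qed simp
  show thesis
  proof (rule mean_value_dual_basis[of d L, OF L_add L_smult L_mean])
    fix P assume P: "\<And>q. degree q < d \<Longrightarrow> q = (\<Sum>i<d. smult (L i q) (P i))"
      "\<And>i y. i < d \<Longrightarrow> \<bar>y\<bar> \<le> 1 \<Longrightarrow> \<bar>poly (P i) y\<bar> \<le> (2 * (real d + 3)) ^ d"
    define \<beta> where "\<beta> i = T (P i)" for i
    have \<beta>_le: "\<bar>\<beta> i\<bar> \<le> w i" if i: "i < d" for i
    proof -
      have "\<bar>\<beta> i\<bar> \<le> (\<integral>y. \<bar>y\<^sup>2 * poly (P i) (a * y) * indicator D y\<bar> \<partial>\<nu>)"
        unfolding \<beta>_def T_def by (rule integral_abs_bound)
      also have "\<dots> \<le> (\<integral>y. (2 * (real d + 3)) ^ d * (y\<^sup>2 * indicator D y) \<partial>\<nu>)"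
      proof (rule integral_mono)
        show "integrable \<nu> (\<lambda>y. \<bar>y\<^sup>2 * poly (P i) (a * y) * indicator D y\<bar>)"
          by (intro integrable_abs ip D)
        show "integrable \<nu> (\<lambda>y. (2 * (real d + 3)) ^ d * (y\<^sup>2 * indicator D y))"
          using ip[OF D, of 1] by (intro integrable_mult_right) simp
        fix y
        have "\<bar>poly (P i) (a * y)\<bar> \<le> (2 * (real d + 3)) ^ d" if "y \<in> D"
        proof (rule P(2)[OF i])
          have "\<bar>y\<bar> \<le> 1 * r" using that \<delta> r by (auto simp: D_def intro: order_trans mult_right_mono)
          then show "\<bar>a * y\<bar> \<le> 1" using r s2 by (simp add: a_def abs_mult)
        qed
        then show "\<bar>y\<^sup>2 * poly (P i) (a * y) * indicator D y\<bar> \<le> (2 * (real d + 3)) ^ d * (y\<^sup>2 * indicator D y)"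
          by (auto simp: indicator_def abs_mult intro!: mult_left_mono simp: mult.commute[of "_ ^ d"])
      qed
      also have "\<dots> \<le> w i" using small[OF i] by (simp add: D_def w_def)
      finally show ?thesis .
    qed
    have T_rep: "T q = (\<Sum>i<d. \<beta> i / w i * (\<integral>y. y\<^sup>2 * poly q (a * y) * indicator (A i) y \<partial>\<nu>))"
      if "degree q < d" for q
    proof -
      have "T q = (\<integral>y. y\<^sup>2 * poly (\<Sum>i<d. smult (L i q) (P i)) (a * y) * indicator D y \<partial>\<nu>)"
        unfolding T_def using P(1)[OF that] by simp
      also have "\<dots> = (\<integral>y. (\<Sum>i<d. L i q * (y\<^sup>2 * poly (P i) (a * y) * indicator D y)) \<partial>\<nu>)"
        by (intro Bochner_Integration.integral_cong)
           (auto simp: poly_sum sum_distrib_left sum_distrib_right mult_ac)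
      also have "\<dots> = (\<Sum>i<d. L i q * T (P i))"
        using ip[OF D] by (subst Bochner_Integration.integral_sum) (auto simp: T_def)
      finally show ?thesis by (simp add: \<beta>_def L_def mult_ac)
    qed
    define S where "S y = (\<Sum>i<d. \<beta> i / w i * indicator (A i) y)" for y
    define h where "h y = 1 - indicator D y + S y" for y
    have S: "\<bar>S y\<bar> \<le> 1 \<and> (y \<in> D \<longrightarrow> S y = 0)" for y
    proof (cases "\<exists>i<d. y \<in> A i")
      case True
      then obtain i where i: "i < d" "y \<in> A i" by auto
      have "\<beta> j / w j * indicator (A j) y = (if j = i then \<beta> i / w i else 0)" for j
        using disj[OF i(2), of j] i(2) by (cases "j = i") (auto simp: indicator_def)
      then have "S y = (\<Sum>j<d. if j = i then \<beta> i / w i else 0)"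
        unfolding S_def by simp
      then have "S y = \<beta> i / w i" using i by simp
      then show ?thesis using \<beta>_le[OF i(1)] w[OF i(1)] AD[OF i(2)] by simp
    next
      case False
      then have "S y = 0" unfolding S_def by (intro sum.neutral) auto
      then show ?thesis by simp
    qed
    show thesis
    proof (rule that[of h])
      show "h \<in> borel_measurable borel"
        unfolding h_def S_def using A(1) D(1) by measurable
      show "0 \<le> h y" "h y \<le> 2" for y using S[of y] by (auto simp: h_def indicator_def)
      show "h y = 0" if "\<bar>y\<bar> \<le> \<delta> * r" for y using S[of y] that by (auto simp: h_def D_def)
      show "h y = 1" if "(real d + 1) * r < \<bar>y\<bar>" for y
      proof -
        have "y \<notin> D" "i < d \<Longrightarrow> y \<notin> A i" for i using that A(2)[of i] D(2) by (auto simp: R_def)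
        then show ?thesis by (simp add: h_def S_def)
      qed
      fix k assume k: "k < d"
      define q where "q = monom (1::real) k"
      have deg: "degree q < d" using k by (simp add: q_def degree_monom_eq)
      define F where "F y = - (y\<^sup>2 * poly q (a * y) * indicator D y)
          + (\<Sum>i<d. \<beta> i / w i * (y\<^sup>2 * poly q (a * y) * indicator (A i) y))" for y
      have eq: "y ^ (k + 2) * (h y - 1) = (1 / a ^ k) * F y" for y
      proof -
        have "a \<noteq> 0" using r s by (auto simp: a_def)
        then have "y ^ (k + 2) = (1 / a ^ k) * (y\<^sup>2 * poly q (a * y))"
          by (simp add: q_def poly_monom power_mult_distrib power_add power2_eq_square)
        then show ?thesis
          by (simp add: F_def h_def S_def sum_distrib_left sum_divide_distrib algebra_simps)
      qed
      have i1: "integrable \<nu> (\<lambda>y. - (y\<^sup>2 * poly q (a * y) * indicator D y))"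
        by (intro Bochner_Integration.integrable_minus ip D)
      have i2: "integrable \<nu> (\<lambda>y. \<Sum>i<d. \<beta> i / w i * (y\<^sup>2 * poly q (a * y) * indicator (A i) y))"
        by (intro Bochner_Integration.integrable_sum integrable_mult_right ip A) auto
      have "(\<integral>y. (\<Sum>i<d. \<beta> i / w i * (y\<^sup>2 * poly q (a * y) * indicator (A i) y)) \<partial>\<nu>)
          = (\<Sum>i<d. \<integral>y. \<beta> i / w i * (y\<^sup>2 * poly q (a * y) * indicator (A i) y) \<partial>\<nu>)"
        by (intro Bochner_Integration.integral_sum integrable_mult_right ip A) auto
      also have "\<dots> = T q" unfolding T_rep[OF deg] by (intro sum.cong integral_mult_right_zero refl)
      finally have "(\<integral>y. F y \<partial>\<nu>) = - T q + T q"
        unfolding F_def by (subst Bochner_Integration.integral_add[OF i1 i2]) (simp add: T_def)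
      moreover have "integrable \<nu> F"
        unfolding F_def by (rule Bochner_Integration.integrable_add[OF i1 i2])
      ultimately show "integrable \<nu> (\<lambda>y. y ^ (k + 2) * (h y - 1)) \<and> (\<integral>y. y ^ (k + 2) * (h y - 1) \<partial>\<nu>) = 0"
        unfolding eq by simp
    qed
  qed
qed

section \<open>Levy measures with regularly varying tails\<close>

lemma levy_tail_finite:
  assumes "levy_measure \<nu>" "0 < x"
  shows "emeasure \<nu> {y. x < \<bar>y\<bar>} < \<infinity>"
proof -
  have b: "sets \<nu> = sets borel" and fin: "(\<integral>\<^sup>+y. ennreal (min 1 (y\<^sup>2)) \<partial>\<nu>) < \<infinity>"
    using assms by (auto simp: levy_measure_def)
  define m where "m = min 1 (x\<^sup>2)"
  have m: "0 < m" using assms by (simp add: m_def)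
  have T: "{y. x < \<bar>y\<bar>} \<in> sets \<nu>" unfolding b by measurable
  have "ennreal m * emeasure \<nu> {y. x < \<bar>y\<bar>} = (\<integral>\<^sup>+y. ennreal m * indicator {y. x < \<bar>y\<bar>} y \<partial>\<nu>)"
    using T by (subst nn_integral_cmult_indicator) auto
  also have "\<dots> \<le> (\<integral>\<^sup>+y. ennreal (min 1 (y\<^sup>2)) \<partial>\<nu>)"
  proof (intro nn_integral_mono)
    fix y :: real
    have "x\<^sup>2 \<le> y\<^sup>2" if "x < \<bar>y\<bar>" using that assms by (simp add: abs_le_square_iff[symmetric])
    then show "ennreal m * indicator {y. x < \<bar>y\<bar>} y \<le> ennreal (min 1 (y\<^sup>2))"
      by (auto simp: indicator_def m_def intro!: ennreal_leI)
  qed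
  finally have "ennreal m * emeasure \<nu> {y. x < \<bar>y\<bar>} < \<infinity>" using fin by (rule le_less_trans)
  then show ?thesis using m by (auto simp: ennreal_mult_less_top)
qed

lemma levy_sigma_finite:
  assumes "levy_measure \<nu>"
  shows "sigma_finite_measure \<nu>"
proof -
  have b: "sets \<nu> = sets borel" and z: "emeasure \<nu> {0} = 0"
    using assms by (auto simp: levy_measure_def)
  have sp: "space \<nu> = UNIV" using sets_eq_imp_space_eq[OF b] by simp
  define F where "F = insert {0::real} (range (\<lambda>k::nat. {y. 1 / (real k + 1) < \<bar>y\<bar>}))"
  have "{y. c < \<bar>y\<bar>} \<in> sets borel" for c :: real by measurable
  then have "F \<subseteq> sets \<nu>" unfolding b F_def by auto
  moreover have "y \<in> \<Union>F" for y :: real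
  proof (cases "y = 0")
    case False
    then obtain k where "inverse (real (Suc k)) < \<bar>y\<bar>" using reals_Archimedean[of "\<bar>y\<bar>"] by auto
    then show ?thesis by (auto simp: F_def field_simps)
  qed (simp add: F_def)
  moreover have "\<forall>a\<in>F. emeasure \<nu> a \<noteq> \<infinity>"
    using z levy_tail_finite[OF assms] by (auto simp: F_def less_top)
  ultimately show ?thesis
    by unfold_locales (use sp in \<open>auto intro!: exI[of _ F] simp: F_def\<close>)
qed

text \<open>Dyadic decomposition. The halving condition with \<open>q < 4\<close> makes the second moments of the dyadic
  shells a geometric series of ratio \<open>q / 4\<close>; for regularly varying tails this is where \<open>\<alpha> < 2\<close> enters.\<close>

lemma second_moment_of_tail:
  fixes \<nu> :: "real measure"
  assumes levy: "levy_measure \<nu>"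
  defines "U \<equiv> \<lambda>x. measure \<nu> {y. x < \<bar>y\<bar>}"
  assumes q: "0 < q" "q < 4" and x: "0 < x"
    and half: "\<And>z. 0 < z \<Longrightarrow> z \<le> x \<Longrightarrow> U (z / 2) \<le> q * U z"
  shows "(\<integral>\<^sup>+y. ennreal (y\<^sup>2) * indicator {y. \<bar>y\<bar> \<le> x} y \<partial>\<nu>) \<le> ennreal (q / (1 - q / 4) * (x\<^sup>2 * U x))"
proof -
  have b: "sets \<nu> = sets borel" using levy by (simp add: levy_measure_def)
  have T: "{y. z < \<bar>y\<bar>} \<in> sets \<nu>" for z unfolding b by measurable
  have Ux: "0 \<le> U x" by (simp add: U_def)
  have it: "U (x / 2 ^ k) \<le> q ^ k * U x" for k
  proof (induction k)
    case (Suc k)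
    have "x / 2 ^ k \<le> x" using x by (simp add: divide_le_eq)
    then have "U (x / 2 ^ k / 2) \<le> q * U (x / 2 ^ k)" using half[of "x / 2 ^ k"] x by auto
    also have "\<dots> \<le> q * (q ^ k * U x)" using Suc q by (intro mult_left_mono) auto
    finally show ?case by (simp add: mult_ac)
  qed simp
  define t where "t j y = ennreal ((x / 2 ^ j)\<^sup>2) * indicator {y. x / 2 ^ Suc j < \<bar>y\<bar>} y" for j :: nat and y
  have pt: "ennreal (y\<^sup>2) * indicator {y. \<bar>y\<bar> \<le> x} y \<le> (\<Sum>j. t j y)" for y
  proof (cases "y \<noteq> 0 \<and> \<bar>y\<bar> \<le> x")
    case True
    have ex: "\<exists>k. x / 2 ^ k < \<bar>y\<bar>"
    proof -
      obtain k where "x / \<bar>y\<bar> < 2 ^ k" using real_arch_pow[of 2 "x / \<bar>y\<bar>"] by auto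
      then show ?thesis using True by (intro exI[of _ k]) (simp add: field_simps)
    qed
    define k where "k = (LEAST k. x / 2 ^ k < \<bar>y\<bar>)"
    have k: "x / 2 ^ k < \<bar>y\<bar>" unfolding k_def by (rule LeastI_ex[OF ex])
    then have "k \<noteq> 0" using True by (intro notI) simp
    then obtain j where j: "k = Suc j" by (cases k) auto
    have "\<not> x / 2 ^ j < \<bar>y\<bar>" using not_less_Least[of j "\<lambda>k. x / 2 ^ k < \<bar>y\<bar>"] j by (simp add: k_def)
    then have "y\<^sup>2 \<le> (x / 2 ^ j)\<^sup>2" using x by (simp add: abs_le_square_iff[symmetric])
    then have "ennreal (y\<^sup>2) * indicator {y. \<bar>y\<bar> \<le> x} y \<le> t j y"
      using k True by (auto simp: t_def j intro!: ennreal_leI)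
    also have "\<dots> \<le> (\<Sum>j. t j y)" using sum_le_suminf[of "\<lambda>j. t j y" "{j}"] by simp
    finally show ?thesis .
  qed (auto simp: indicator_def)
  have "(\<integral>\<^sup>+y. ennreal (y\<^sup>2) * indicator {y. \<bar>y\<bar> \<le> x} y \<partial>\<nu>) \<le> (\<integral>\<^sup>+y. (\<Sum>j. t j y) \<partial>\<nu>)"
    by (intro nn_integral_mono pt)
  also have "\<dots> = (\<Sum>j. \<integral>\<^sup>+y. t j y \<partial>\<nu>)"
    unfolding t_def using T by (intro nn_integral_suminf) auto
  also have "\<dots> \<le> (\<Sum>j. ennreal (x\<^sup>2 * U x * q * (q / 4) ^ j))"
  proof (intro suminf_le allI summableI)
    fix j
    have em: "emeasure \<nu> {y. z < \<bar>y\<bar>} = ennreal (U z)" if "0 < z" for z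
      using levy_tail_finite[OF levy that] by (simp add: U_def emeasure_eq_ennreal_measure less_top)
    have "(\<integral>\<^sup>+y. t j y \<partial>\<nu>) = ennreal ((x / 2 ^ j)\<^sup>2) * ennreal (U (x / 2 ^ Suc j))"
      unfolding t_def using T x by (subst nn_integral_cmult_indicator) (auto simp: em)
    also have "\<dots> = ennreal ((x / 2 ^ j)\<^sup>2 * U (x / 2 ^ Suc j))"
      by (simp add: U_def ennreal_mult')
    also have "\<dots> \<le> ennreal ((x / 2 ^ j)\<^sup>2 * (q ^ Suc j * U x))"
      by (intro ennreal_leI mult_left_mono it) auto
    also have "(x / 2 ^ j)\<^sup>2 * (q ^ Suc j * U x) = x\<^sup>2 * U x * q * (q / 4) ^ j"
    proof -
      have "((2::real) ^ j)\<^sup>2 = 4 ^ j" by (simp add: power_mult_distrib[symmetric] power2_eq_square)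
      then show ?thesis by (simp add: power_divide)
    qed
    finally show "(\<integral>\<^sup>+y. t j y \<partial>\<nu>) \<le> ennreal (x\<^sup>2 * U x * q * (q / 4) ^ j)" .
  qed
  also have "\<dots> = ennreal (x\<^sup>2 * U x * q * (1 / (1 - q / 4)))"
    using q Ux by (intro suminf_ennreal_eq sums_mult geometric_sums) auto
  finally show ?thesis by (simp add: mult_ac)
qed

text \<open>Assumption \<open>(R\<^sub>\<alpha>)\<close>. The two-sided tail \<open>U\<close> below is monotone and satisfies
  \<open>U \<sim> (c_plus + c_minus) g\<close> with a positive constant, so it can stand in for \<open>g\<close>.\<close>

locale regularly_varying_levy =
  fixes \<nu> :: "real measure" and g :: "real \<Rightarrow> real" and \<alpha> c_plus c_minus :: real
  assumes levy: "levy_measure \<nu>" and \<alpha>: "0 < \<alpha>" "\<alpha> < 2"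
    and c_nonneg: "0 \<le> c_plus" "0 \<le> c_minus" and c_pos: "0 < c_plus + c_minus"
    and rv: "regularly_varying_at_zero g (- \<alpha>)"
    and plus: "equiv_at_zero (\<lambda>x. measure \<nu> {x<..}) c_plus g"
    and minus: "equiv_at_zero (\<lambda>x. measure \<nu> {..<-x}) c_minus g"
begin

lemma sets_\<nu> [measurable_cong, simp]: "sets \<nu> = sets borel"
  using levy by (simp add: levy_measure_def)

lemma space_\<nu> [simp]: "space \<nu> = UNIV"
  using sets_eq_imp_space_eq[OF sets_\<nu>] by simp

definition U :: "real \<Rightarrow> real" where "U x = measure \<nu> {y. x < \<bar>y\<bar>}"

definition side_tail :: "real \<Rightarrow> real \<Rightarrow> real" where "side_tail s x = measure \<nu> {y. x < s * y}"

lemma tail_sets: "{y. x < \<bar>y\<bar>} \<in> sets \<nu>" "{y. x < s * y} \<in> sets \<nu>" for x s :: real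
  by (simp_all, measurable)

lemma emeasure_tail: "0 < x \<Longrightarrow> emeasure \<nu> {y. x < \<bar>y\<bar>} = ennreal (U x)"
  using levy_tail_finite[OF levy, of x] by (simp add: U_def emeasure_eq_ennreal_measure less_top)

lemma U_nonneg: "0 \<le> U x"
  by (simp add: U_def)

lemma fmeasurable_tail: "0 < x \<Longrightarrow> {y. x < \<bar>y\<bar>} \<in> fmeasurable \<nu>"
  using tail_sets levy_tail_finite[OF levy] by (auto simp: fmeasurable_def)

lemma fmeasurable_side_tail: "0 < x \<Longrightarrow> \<bar>s\<bar> = 1 \<Longrightarrow> {y. x < s * y} \<in> fmeasurable \<nu>"
  by (rule fmeasurableI2[OF fmeasurable_tail[of x] _ tail_sets(2)])
     (auto simp: abs_if split: if_splits)

lemma U_antimono: "0 < x \<Longrightarrow> x \<le> y \<Longrightarrow> U y \<le> U x"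
  unfolding U_def by (rule measure_mono_fmeasurable) (auto intro!: fmeasurable_tail simp: tail_sets simp del: sets_\<nu>)

lemma U_split:
  assumes "0 < x" shows "U x = side_tail 1 x + side_tail (-1) x"
proof -
  have "{y. x < \<bar>y\<bar>} = {y. x < 1 * y} \<union> {y. x < -1 * y}" using assms by auto
  then show ?thesis unfolding U_def side_tail_def using assms
      fmeasurable_side_tail[OF assms, of 1] fmeasurable_side_tail[OF assms, of "-1"]
    by (simp only:) (rule measure_Union; auto simp: tail_sets simp del: sets_\<nu> intro!: fmeasurableD2)
qed

lemma g_pos: "eventually (\<lambda>x. 0 < g x) (at_right 0)"
  by (rule regularly_varying_at_zero_eventually_pos[OF rv])

lemma side_tail_ratio:
  "((\<lambda>x. side_tail 1 x / g x) \<longlongrightarrow> c_plus) (at_right 0)"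
  "((\<lambda>x. side_tail (-1) x / g x) \<longlongrightarrow> c_minus) (at_right 0)"
proof -
  have "{y. x < 1 * y} = {x<..}" "{y. x < -1 * y} = {..<-x}" for x :: real by auto
  then show "((\<lambda>x. side_tail 1 x / g x) \<longlongrightarrow> c_plus) (at_right 0)"
    "((\<lambda>x. side_tail (-1) x / g x) \<longlongrightarrow> c_minus) (at_right 0)"
    using equiv_at_zero_ratio[OF plus g_pos] equiv_at_zero_ratio[OF minus g_pos]
    by (simp_all add: side_tail_def)
qed

lemma U_ratio: "((\<lambda>x. U x / g x) \<longlongrightarrow> c_plus + c_minus) (at_right 0)"
proof (rule Lim_transform_eventually[OF tendsto_add[OF side_tail_ratio]])
  show "eventually (\<lambda>x. side_tail 1 x / g x + side_tail (-1) x / g x = U x / g x) (at_right 0)"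
    using eventually_at_right_less[of 0] by eventually_elim (simp add: U_split add_divide_distrib)
qed

lemma U_pos: "eventually (\<lambda>x. 0 < U x) (at_right 0)"
  using order_tendstoD(1)[OF U_ratio c_pos] g_pos by eventually_elim (simp add: zero_less_divide_iff)

lemma scaled_ratio:
  assumes u: "((\<lambda>x. u x / g x) \<longlongrightarrow> c) (at_right 0)" and l: "0 < l"
  shows "((\<lambda>x. u (l * x) / U x) \<longlongrightarrow> c / (c_plus + c_minus) * l powr (- \<alpha>)) (at_right 0)"
proof -
  have "((\<lambda>x. (u (l * x) / g x) / (U x / g x)) \<longlongrightarrow> (c * l powr (- \<alpha>)) / (c_plus + c_minus)) (at_right 0)"
    using c_pos by (intro tendsto_divide regularly_varying_ratio[OF rv u g_pos l] U_ratio) auto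
  moreover have "eventually (\<lambda>x. (u (l * x) / g x) / (U x / g x) = u (l * x) / U x) (at_right 0)"
    using g_pos by eventually_elim simp
  ultimately show ?thesis using Lim_transform_eventually by fastforce
qed

lemma U_scaled: "0 < l \<Longrightarrow> ((\<lambda>x. U (l * x) / U x) \<longlongrightarrow> l powr (- \<alpha>)) (at_right 0)"
  using scaled_ratio[OF U_ratio, of l] c_pos by simp

definition V :: "real \<Rightarrow> real" where
  "V x = (\<integral>y. y\<^sup>2 * indicator {y. \<bar>y\<bar> \<le> x} y \<partial>\<nu>)"

lemma square_integrable_near_0: "integrable \<nu> (\<lambda>y. y\<^sup>2 * indicator {y. \<bar>y\<bar> \<le> x} y)"
proof -
  have fin: "(\<integral>\<^sup>+y. ennreal (min 1 (y\<^sup>2)) \<partial>\<nu>) < \<infinity>" using levy by (auto simp: levy_measure_def)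
  have int: "integrable \<nu> (\<lambda>y. min 1 (y\<^sup>2))"
    by (rule integrableI_bounded) (use fin in auto)
  show ?thesis
  proof (rule Bochner_Integration.integrable_bound[OF integrable_mult_right[OF int, of "1 + x\<^sup>2"]])
    show "AE y in \<nu>. norm (y\<^sup>2 * indicator {y. \<bar>y\<bar> \<le> x} y) \<le> norm ((1 + x\<^sup>2) * min 1 (y\<^sup>2))"
    proof (rule AE_I2)
      fix y :: real
      have "y\<^sup>2 \<le> x\<^sup>2" if "\<bar>y\<bar> \<le> x" using that by (simp add: abs_le_square_iff[symmetric])
      then show "norm (y\<^sup>2 * indicator {y. \<bar>y\<bar> \<le> x} y) \<le> norm ((1 + x\<^sup>2) * min 1 (y\<^sup>2))"
        by (auto simp: indicator_def min_def abs_mult algebra_simps)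
    qed
  qed measurable
qed

lemma V_nn_integral: "(\<integral>\<^sup>+y. ennreal (y\<^sup>2 * indicator {y. \<bar>y\<bar> \<le> x} y) \<partial>\<nu>) = ennreal (V x)"
  unfolding V_def by (rule nn_integral_eq_integral[OF square_integrable_near_0]) auto

lemma V_nonneg: "0 \<le> V x"
  unfolding V_def by (rule integral_nonneg_AE) auto

lemma V_le_tail:
  obtains C where "0 < C" "eventually (\<lambda>x. V x \<le> C * (x\<^sup>2 * U x)) (at_right 0)"
proof -
  define q where "q = ((1/2) powr (- \<alpha>) + 4) / 2"
  have "(1/2) powr (- \<alpha>) = (2::real) powr \<alpha>" by (simp add: powr_minus powr_divide)
  also have "\<dots> < 2 powr 2" using \<alpha> by (intro powr_less_mono) auto
  finally have h: "(1/2::real) powr (- \<alpha>) < 4" by simp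
  then have q: "(1/2) powr (- \<alpha>) < q" "0 < q" "q < 4" by (auto simp: q_def add_nonneg_pos)
  have "eventually (\<lambda>x. U (1/2 * x) / U x < q) (at_right 0)"
    by (rule order_tendstoD(2)[OF U_scaled q(1)]) simp
  with U_pos have "eventually (\<lambda>x. U (x / 2) \<le> q * U x) (at_right 0)"
    by eventually_elim (simp add: field_simps)
  then obtain x0 where x0: "0 < x0" "\<And>x. 0 < x \<Longrightarrow> x < x0 \<Longrightarrow> U (x / 2) \<le> q * U x"
    unfolding eventually_at_right_field by auto
  have "V x \<le> q / (1 - q / 4) * (x\<^sup>2 * U x)" if x: "0 < x" "x < x0" for x
  proof -
    have "ennreal (V x) = (\<integral>\<^sup>+y. ennreal (y\<^sup>2) * indicator {y. \<bar>y\<bar> \<le> x} y \<partial>\<nu>)"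
      unfolding V_nn_integral[symmetric]
      by (intro nn_integral_cong) (auto simp: indicator_def)
    also have "\<dots> \<le> ennreal (q / (1 - q / 4) * (x\<^sup>2 * U x))"
      unfolding U_def using x x0(2) by (intro second_moment_of_tail levy q) (auto simp: U_def)
    finally show ?thesis using q U_nonneg by (subst (asm) ennreal_le_iff) auto
  qed
  then show ?thesis using q x0
    by (intro that[of "q / (1 - q / 4)"]) (auto simp: eventually_at_right_field)
qed

text \<open>Regular variation turns \<open>V (\<delta> r) \<le> C (\<delta> r)\<^sup>2 U (\<delta> r)\<close> into a multiple of
  \<open>\<delta> powr (2 - \<alpha>)\<close>, and the exponent is positive.\<close>

lemma V_negligible:
  assumes \<epsilon>: "0 < \<epsilon>"
  obtains \<delta> where "0 < \<delta>" "\<delta> < 1" "eventually (\<lambda>r. V (\<delta> * r) \<le> \<epsilon> * (r\<^sup>2 * U r)) (at_right 0)"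
proof -
  obtain C where C: "0 < C" "eventually (\<lambda>x. V x \<le> C * (x\<^sup>2 * U x)) (at_right 0)" by (rule V_le_tail)
  define \<delta> where "\<delta> = min (1/2) ((\<epsilon> / (2 * C)) powr (1 / (2 - \<alpha>)))"
  have \<delta>: "0 < \<delta>" "\<delta> < 1" using \<epsilon> C by (auto simp: \<delta>_def)
  have "\<delta> powr (2 - \<alpha>) \<le> ((\<epsilon> / (2 * C)) powr (1 / (2 - \<alpha>))) powr (2 - \<alpha>)"
    using \<delta> \<alpha> by (intro powr_mono2) (auto simp: \<delta>_def)
  also have "\<dots> = \<epsilon> / (2 * C)" using \<alpha> \<epsilon> C by (simp add: powr_powr)
  finally have "2 * C * \<delta> powr (2 - \<alpha>) \<le> \<epsilon>" using C by (simp add: field_simps)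
  moreover have "\<delta> powr (2 - \<alpha>) = \<delta>\<^sup>2 * \<delta> powr (- \<alpha>)"
    using \<delta> by (simp add: powr_diff powr_minus divide_inverse)
  ultimately have key: "C * \<delta>\<^sup>2 * (2 * \<delta> powr (- \<alpha>)) \<le> \<epsilon>" by (simp add: mult_ac)
  have "eventually (\<lambda>r. U (\<delta> * r) / U r < 2 * \<delta> powr (- \<alpha>)) (at_right 0)"
    by (rule order_tendstoD(2)[OF U_scaled]) (use \<delta> in auto)
  moreover have "eventually (\<lambda>r. V (\<delta> * r) \<le> C * ((\<delta> * r)\<^sup>2 * U (\<delta> * r))) (at_right 0)"
    by (rule eventually_compose_filterlim[OF C(2) filterlim_scale_at_right_0[OF \<delta>(1)]])
  ultimately have "eventually (\<lambda>r. V (\<delta> * r) \<le> \<epsilon> * (r\<^sup>2 * U r)) (at_right 0)"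
    using U_pos
  proof eventually_elim
    case (elim r)
    then have "U (\<delta> * r) \<le> 2 * \<delta> powr (- \<alpha>) * U r" by (simp add: field_simps)
    then have "C * ((\<delta> * r)\<^sup>2 * U (\<delta> * r)) \<le> C * ((\<delta> * r)\<^sup>2 * (2 * \<delta> powr (- \<alpha>) * U r))"
      using C by (intro mult_left_mono) auto
    also have "\<dots> = (C * \<delta>\<^sup>2 * (2 * \<delta> powr (- \<alpha>))) * (r\<^sup>2 * U r)" by (simp add: power_mult_distrib)
    also have "\<dots> \<le> \<epsilon> * (r\<^sup>2 * U r)" using key elim by (intro mult_right_mono) auto
    finally show ?case using elim by linarith
  qed
  then show ?thesis using \<delta> that by blast
qed

lemma heavy_side:
  obtains s c where "s = 1 \<or> s = -1" "0 < c" "((\<lambda>x. side_tail s x / g x) \<longlongrightarrow> c) (at_right 0)"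
proof (cases "0 < c_plus")
  case True
  then show ?thesis using that[of 1 c_plus] side_tail_ratio by auto
next
  case False
  then have "0 < c_minus" using c_nonneg c_pos by linarith
  then show ?thesis using that[of "-1" c_minus] side_tail_ratio by auto
qed

text \<open>On a side with positive constant \<open>c\<close>, the mass of shell \<open>i\<close> is a difference of two tails, whose ratio to \<open>U r\<close>
  tends to a positive limit because \<open>x powr (- \<alpha>)\<close> is strictly decreasing.\<close>

lemma shell_mass:
  fixes d :: nat
  obtains s \<kappa> where "s = 1 \<or> s = -1" "0 < \<kappa>"
    "eventually (\<lambda>r. \<forall>i<d. \<kappa> * (r\<^sup>2 * U r)
       \<le> (\<integral>y. y\<^sup>2 * indicator {y. (real i + 1) * r < s * y \<and> s * y \<le> (real i + 3/2) * r} y \<partial>\<nu>)) (at_right 0)"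
proof -
  obtain s c where s: "s = 1 \<or> s = -1" and c: "0 < c"
    and lim: "((\<lambda>x. side_tail s x / g x) \<longlongrightarrow> c) (at_right 0)" by (rule heavy_side)
  have s1: "\<bar>s\<bar> = 1" using s by auto
  define a where "a i = c / (c_plus + c_minus) * ((real i + 1) powr (- \<alpha>) - (real i + 3/2) powr (- \<alpha>))" for i :: nat
  have a: "0 < a i" for i
    unfolding a_def using c c_pos \<alpha> by (intro mult_pos_pos) (auto intro: powr_less_mono2_neg)
  define \<kappa> where "\<kappa> = Min (insert 1 (a ` {..<d})) / 2"
  have \<kappa>: "0 < \<kappa>" using a by (auto simp: \<kappa>_def)
  have \<kappa>a: "\<kappa> < a i" if "i < d" for i
  proof -
    have "Min (insert 1 (a ` {..<d})) \<le> a i" using that by (intro Min_le) auto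
    then show ?thesis using a[of i] \<kappa> by (simp add: \<kappa>_def)
  qed
  define A where "A i r = {y. (real i + 1) * r < s * y \<and> s * y \<le> (real i + 3/2) * r}" for i :: nat and r
  have mA: "measure \<nu> (A i r) = side_tail s ((real i + 1) * r) - side_tail s ((real i + 3/2) * r)"
    if "0 < r" for i r
  proof -
    have "A i r = {y. (real i + 1) * r < s * y} - {y. (real i + 3/2) * r < s * y}" by (auto simp: A_def)
    moreover have "(real i + 1) * r \<le> (real i + 3/2) * r" using that by (intro mult_right_mono) auto
    then have "{y. (real i + 3/2) * r < s * y} \<subseteq> {y. (real i + 1) * r < s * y}" by auto
    moreover have "0 < (real i + 1) * r" using that by simp
    ultimately show ?thesis unfolding side_tail_def using s1
      by (simp only:) (rule measurable_measure_Diff[OF fmeasurable_side_tail tail_sets(2)])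
  qed
  have ev: "eventually (\<lambda>r. \<kappa> * U r \<le> measure \<nu> (A i r)) (at_right 0)" if i: "i < d" for i
  proof -
    have "((\<lambda>r. side_tail s ((real i + 1) * r) / U r - side_tail s ((real i + 3/2) * r) / U r) \<longlongrightarrow>
        c / (c_plus + c_minus) * (real i + 1) powr (- \<alpha>) - c / (c_plus + c_minus) * (real i + 3/2) powr (- \<alpha>)) (at_right 0)"
      by (intro tendsto_diff scaled_ratio[OF lim]) auto
    also have "c / (c_plus + c_minus) * (real i + 1) powr (- \<alpha>) - c / (c_plus + c_minus) * (real i + 3/2) powr (- \<alpha>) = a i"
      by (simp add: a_def right_diff_distrib)
    finally have "eventually (\<lambda>r. \<kappa> < side_tail s ((real i + 1) * r) / U r - side_tail s ((real i + 3/2) * r) / U r) (at_right 0)"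
      using \<kappa>a[OF i] by (rule order_tendstoD(1))
    then show ?thesis
      using U_pos eventually_at_right_less[of 0]
      by eventually_elim (simp add: mA field_simps)
  qed
  have "eventually (\<lambda>r. \<forall>i\<in>{..<d}. \<kappa> * U r \<le> measure \<nu> (A i r)) (at_right 0)"
    using ev by (intro eventually_ball_finite) auto
  then have "eventually (\<lambda>r. \<forall>i<d. \<kappa> * (r\<^sup>2 * U r) \<le> (\<integral>y. y\<^sup>2 * indicator (A i r) y \<partial>\<nu>)) (at_right 0)"
    using eventually_at_right_less[of 0]
  proof eventually_elim
    case (elim r)
    show ?case
    proof (intro allI impI)
      fix i assume i: "i < d"
      have A: "A i r \<in> sets borel" unfolding A_def by measurable
      have abs: "r \<le> \<bar>y\<bar> \<and> \<bar>y\<bar> \<le> (real i + 3/2) * r" if "y \<in> A i r" for y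
      proof -
        have "1 * r \<le> (real i + 1) * r" using elim by (intro mult_right_mono) auto
        then have "r < s * y" using that by (simp add: A_def)
        moreover from this have "\<bar>y\<bar> = s * y" using s elim by auto
        ultimately show ?thesis using that by (auto simp: A_def)
      qed
      have fA: "A i r \<in> fmeasurable \<nu>"
        by (rule fmeasurableI2[OF fmeasurable_tail[of "r / 2"]]) (use abs elim A in force)+
      have i2: "integrable \<nu> (\<lambda>y. y\<^sup>2 * indicator (A i r) y)"
      proof (rule Bochner_Integration.integrable_bound[OF square_integrable_near_0[of "(real i + 3/2) * r"]])
        show "AE y in \<nu>. norm (y\<^sup>2 * indicator (A i r) y) \<le> norm (y\<^sup>2 * indicator {y. \<bar>y\<bar> \<le> (real i + 3/2) * r} y)"
          using abs by (intro AE_I2) (auto simp: indicator_def)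
        show "(\<lambda>y. y\<^sup>2 * indicator (A i r) y) \<in> borel_measurable \<nu>" using A by measurable
      qed
      have "\<kappa> * (r\<^sup>2 * U r) \<le> r\<^sup>2 * measure \<nu> (A i r)"
        using elim i by (auto simp: mult.left_commute intro!: mult_left_mono)
      also have "\<dots> = (\<integral>y. r\<^sup>2 * indicator (A i r) y \<partial>\<nu>)" by simp
      also have "\<dots> \<le> (\<integral>y. y\<^sup>2 * indicator (A i r) y \<partial>\<nu>)"
      proof (rule integral_mono[OF _ i2])
        show "integrable \<nu> (\<lambda>y. r\<^sup>2 * indicator (A i r) y)"
          using fA by (intro integrable_mult_right) (auto simp: fmeasurable_def less_top)
        show "r\<^sup>2 * indicator (A i r) y \<le> y\<^sup>2 * indicator (A i r) y" for y
          using abs[of y] elim by (auto simp: indicator_def abs_le_square_iff[symmetric])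
      qed
      finally show "\<kappa> * (r\<^sup>2 * U r) \<le> (\<integral>y. y\<^sup>2 * indicator (A i r) y \<partial>\<nu>)" .
    qed
  qed
  then show ?thesis by (intro that[OF s \<kappa>]) (simp add: A_def)
qed

end

section \<open>Bounds for the minimal error\<close>

lemma has_bochner_integral_sum_measure:
  fixes f :: "'a \<Rightarrow> real"
  assumes N: "sets N = sets M" and f: "integrable M f" "integrable N f"
  shows "has_bochner_integral (sum_measure M N) f ((\<integral>x. f x \<partial>M) + (\<integral>x. f x \<partial>N))"
proof -
  have [measurable]: "f \<in> borel_measurable M" using f by auto
  have add: "(\<integral>\<^sup>+x. ennreal (g x) \<partial>sum_measure M N) = (\<integral>\<^sup>+x. ennreal (g x) \<partial>M) + (\<integral>\<^sup>+x. ennreal (g x) \<partial>N)"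
    if "g \<in> borel_measurable M" for g :: "'a \<Rightarrow> real"
    using that by (intro nn_integral_sum_measure[OF N]) auto
  have fin: "(\<integral>\<^sup>+x. ennreal (f x) \<partial>P) \<noteq> \<infinity>" "(\<integral>\<^sup>+x. ennreal (- f x) \<partial>P) \<noteq> \<infinity>" if "integrable P f" for P
    using that by (auto simp: real_integrable_def)
  have int: "integrable (sum_measure M N) f"
    unfolding real_integrable_def using fin[OF f(1)] fin[OF f(2)] by (simp add: add)
  have "(\<integral>x. f x \<partial>sum_measure M N) = (\<integral>x. f x \<partial>M) + (\<integral>x. f x \<partial>N)"
    unfolding real_lebesgue_integral_def[OF int] real_lebesgue_integral_def[OF f(1)]
      real_lebesgue_integral_def[OF f(2)]
    using fin[OF f(1)] fin[OF f(2)] by (simp add: add enn2real_plus less_top)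
  with int show ?thesis by (simp add: has_bochner_integral_iff)
qed

definition atom_at_0 :: "real \<Rightarrow> real measure" where
  "atom_at_0 m = density (return borel 0) (\<lambda>_. ennreal m)"

lemma sets_atom_at_0 [simp, measurable_cong]: "sets (atom_at_0 m) = sets borel"
  by (simp add: atom_at_0_def)

lemma nn_integral_atom_at_0:
  assumes [measurable]: "u \<in> borel_measurable borel"
  shows "(\<integral>\<^sup>+y. u y \<partial>atom_at_0 m) = ennreal m * u 0"
  unfolding atom_at_0_def by (simp add: nn_integral_density nn_integral_return)

lemma emeasure_atom_at_0_UNIV: "emeasure (atom_at_0 m) UNIV = ennreal m"
  using nn_integral_atom_at_0[of "\<lambda>_. 1" m] sets_eq_imp_space_eq[OF sets_atom_at_0[of m]] by simp

lemma atom_at_0_power: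
  assumes "0 \<le> m" "0 < k"
  shows "integrable (atom_at_0 m) (\<lambda>y. y ^ k)" "(\<integral>y. y ^ k \<partial>atom_at_0 m) = 0"
proof -
  have z: "(\<integral>\<^sup>+y. ennreal (u y) \<partial>atom_at_0 m) = 0" if "u \<in> borel_measurable borel" "u 0 = 0" for u
    using that by (subst nn_integral_atom_at_0) auto
  show i: "integrable (atom_at_0 m) (\<lambda>y. y ^ k)"
    unfolding real_integrable_def using assms by (simp add: z)
  show "(\<integral>y. y ^ k \<partial>atom_at_0 m) = 0"
    unfolding real_lebesgue_integral_def[OF i] using assms by (simp add: z)
qed

context regularly_varying_levy
begin

lemma integrable_moment:
  assumes "integrable \<nu> (\<lambda>y. \<bar>y\<bar> ^ n)" "2 \<le> k" "k \<le> n"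
  shows "integrable \<nu> (\<lambda>y. y ^ k)"
proof (rule Bochner_Integration.integrable_bound)
  show "integrable \<nu> (\<lambda>y. y\<^sup>2 * indicator {y. \<bar>y\<bar> \<le> 1} y + \<bar>y\<bar> ^ n)"
    by (intro Bochner_Integration.integrable_add square_integrable_near_0 assms)
  show "AE y in \<nu>. norm (y ^ k) \<le> norm (y\<^sup>2 * indicator {y. \<bar>y\<bar> \<le> 1} y + \<bar>y\<bar> ^ n)"
  proof (rule AE_I2)
    fix y :: real
    show "norm (y ^ k) \<le> norm (y\<^sup>2 * indicator {y. \<bar>y\<bar> \<le> 1} y + \<bar>y\<bar> ^ n)"
    proof (cases "\<bar>y\<bar> \<le> 1")
      case True
      have "\<bar>y\<bar> ^ k \<le> \<bar>y\<bar> ^ 2" using True assms by (intro power_decreasing) auto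
      then have "\<bar>y\<bar> ^ k \<le> \<bar>y\<bar> ^ 2 + \<bar>y\<bar> ^ n" by (simp add: add_increasing2)
      then show ?thesis using True by (simp add: power_abs)
    next
      case False
      then have "\<bar>y\<bar> ^ k \<le> \<bar>y\<bar> ^ n" using assms by (intro power_increasing) auto
      then show ?thesis using False by (simp add: power_abs)
    qed
  qed
qed simp

text \<open>Where \<open>\<nu>\<close> has mass at least \<open>2 * \<Lambda>\<close>, a measure of total mass \<open>\<Lambda>\<close> misses at least \<open>\<Lambda>\<close> of it, at
  distance more than \<open>x\<close> from the origin.\<close>

lemma error_lower_bound:
  assumes \<mu>: "\<mu> \<in> admissible \<nu> n \<Lambda>" and \<Lambda>: "0 \<le> \<Lambda>" and x: "0 < x" and U: "2 * \<Lambda> \<le> U x"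
  shows "ennreal (x ^ n * \<Lambda>) \<le> J \<nu> n \<mu>"
proof -
  let ?T = "{y. x < \<bar>y\<bar>}"
  have s: "finite_measure \<mu>" "sets \<mu> = sets \<nu>" "measure \<mu> UNIV = \<Lambda>" using \<mu> by (auto simp: admissible_def)
  interpret \<mu>: finite_measure \<mu> by fact
  have T: "?T \<in> sets borel" by measurable
  have tv: "sets (tv_diff \<nu> \<mu>) = sets borel"
    using sets_tv_diff[OF levy_sigma_finite[OF levy] s(1,2)] by simp
  have "ennreal (U x) = (\<integral>\<^sup>+y. indicator ?T y \<partial>\<nu>)" using T x by (simp add: emeasure_tail)
  also have "\<dots> \<le> (\<integral>\<^sup>+y. indicator ?T y \<partial>\<mu>) + (\<integral>\<^sup>+y. indicator ?T y \<partial>tv_diff \<nu> \<mu>)"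
    using T by (intro nn_integral_le_tv_diff(1)[OF levy_sigma_finite[OF levy] s(1,2)]) auto
  also have "\<dots> = emeasure \<mu> ?T + emeasure (tv_diff \<nu> \<mu>) ?T" using T s(2) tv by simp
  also have "emeasure \<mu> ?T \<le> ennreal \<Lambda>"
    unfolding s(3)[symmetric] \<mu>.emeasure_eq_measure
    using s(2) by (intro ennreal_leI \<mu>.finite_measure_mono) auto
  finally have "ennreal (U x) \<le> ennreal \<Lambda> + emeasure (tv_diff \<nu> \<mu>) ?T" by (simp add: add_right_mono)
  moreover have "ennreal \<Lambda> + ennreal \<Lambda> \<le> ennreal (U x)"
    using U \<Lambda> by (simp flip: ennreal_plus add: ennreal_leI)
  ultimately have "ennreal \<Lambda> + ennreal \<Lambda> \<le> ennreal \<Lambda> + emeasure (tv_diff \<nu> \<mu>) ?T" by (rule order_trans[rotated])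
  then have *: "ennreal \<Lambda> \<le> emeasure (tv_diff \<nu> \<mu>) ?T"
    by (simp add: ennreal_add_left_cancel_le)
  have "ennreal (x ^ n * \<Lambda>) = ennreal (x ^ n) * ennreal \<Lambda>" using \<Lambda> x by (simp add: ennreal_mult)
  also have "\<dots> \<le> ennreal (x ^ n) * emeasure (tv_diff \<nu> \<mu>) ?T" by (intro mult_left_mono *) auto
  also have "\<dots> = (\<integral>\<^sup>+y. ennreal (x ^ n) * indicator ?T y \<partial>tv_diff \<nu> \<mu>)"
    using T tv by (subst nn_integral_cmult_indicator) auto
  also have "\<dots> \<le> J \<nu> n \<mu>"
    unfolding J_def using x
    by (intro nn_integral_mono) (auto simp: indicator_def intro!: ennreal_leI power_mono)
  finally show ?thesis .
qed

text \<open>The reweighted measure \<open>h \<nu>\<close> is finite and has mass at most \<open>2 * U \<rho>\<close>. An atom at the origin fills it up to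
  mass exactly \<open>\<Lambda>\<close>; it contributes neither to the moments nor to the error, since the weight
  \<open>\<bar>y\<bar> ^ n\<close> vanishes there.\<close>

lemma competitor:
  fixes h :: "real \<Rightarrow> real"
  assumes int: "integrable \<nu> (\<lambda>y. \<bar>y\<bar> ^ n)" and n: "2 \<le> n" and \<rho>: "0 < \<rho>" and R: "0 \<le> R"
    and h: "h \<in> borel_measurable borel" "\<And>y. 0 \<le> h y" "\<And>y. h y \<le> 2"
      "\<And>y. \<bar>y\<bar> \<le> \<rho> \<Longrightarrow> h y = 0" "\<And>y. R < \<bar>y\<bar> \<Longrightarrow> h y = 1"
      "\<And>k. k < n - 2 \<Longrightarrow> integrable \<nu> (\<lambda>y. y ^ (k + 2) * (h y - 1)) \<and> (\<integral>y. y ^ (k + 2) * (h y - 1) \<partial>\<nu>) = 0"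
    and \<Lambda>: "2 * U \<rho> \<le> \<Lambda>"
  obtains \<mu> where "\<mu> \<in> admissible \<nu> n \<Lambda>" "J \<nu> n \<mu> \<le> ennreal (R ^ (n - 2) * V R)"
proof -
  have [measurable]: "h \<in> borel_measurable borel" by fact
  define M where "M = density \<nu> (\<lambda>y. ennreal (h y))"
  have sM: "sets M = sets borel" "space M = UNIV" by (auto simp: M_def)
  have mass: "emeasure M UNIV \<le> ennreal \<Lambda>"
  proof -
    have "emeasure M UNIV = (\<integral>\<^sup>+y. ennreal (h y) \<partial>\<nu>)" by (simp add: M_def emeasure_density)
    also have "\<dots> \<le> (\<integral>\<^sup>+y. ennreal 2 * indicator {y. \<rho> < \<bar>y\<bar>} y \<partial>\<nu>)"
    proof (intro nn_integral_mono)
      fix y show "ennreal (h y) \<le> ennreal 2 * indicator {y. \<rho> < \<bar>y\<bar>} y"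
        using h(3)[of y] h(4)[of y] by (auto simp: indicator_def not_less intro: ennreal_leI simp del: ennreal_numeral)
    qed
    also have "\<dots> = ennreal 2 * ennreal (U \<rho>)"
      using \<rho> tail_sets(1) by (subst nn_integral_cmult_indicator) (auto simp: emeasure_tail)
    also have "\<dots> \<le> ennreal \<Lambda>"
      using \<Lambda> U_nonneg by (subst ennreal_mult[symmetric]) (auto intro: ennreal_leI)
    finally show ?thesis .
  qed
  have \<Lambda>0: "0 \<le> \<Lambda>" using \<Lambda> U_nonneg[of \<rho>] by linarith
  define m where "m = \<Lambda> - enn2real (emeasure M UNIV)"
  have fM: "emeasure M UNIV = ennreal (\<Lambda> - m)"
  proof -
    have "emeasure M UNIV < top" using mass by (rule le_less_trans) simp
    then show ?thesis by (simp add: m_def)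
  qed
  have m: "0 \<le> m" "m \<le> \<Lambda>"
    using mass \<Lambda>0 enn2real_mono[OF mass] by (auto simp: m_def)
  let ?N = "atom_at_0 m"
  define \<mu> where "\<mu> = sum_measure M ?N"
  have sN: "sets ?N = sets M" using sM by simp
  have s\<mu>: "sets \<mu> = sets borel" "space \<mu> = UNIV" using sM by (auto simp: \<mu>_def)
  have em: "emeasure \<mu> UNIV = ennreal \<Lambda>"
    using m by (simp add: \<mu>_def emeasure_sum_measure[OF sN] fM emeasure_atom_at_0_UNIV flip: ennreal_plus)
  have fin: "finite_measure \<mu>" using em s\<mu> by (intro finite_measureI) auto
  have mom: "has_bochner_integral \<mu> (\<lambda>y. y ^ k) (\<integral>y. y ^ k \<partial>\<nu>)" if k: "k \<in> {2..n - 1}" for k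
  proof -
    define j where "j = k - 2"
    have j: "k = j + 2" "j < n - 2" using k n by (auto simp: j_def)
    have ik: "integrable \<nu> (\<lambda>y. y ^ k)" using integrable_moment[OF int, of k] k by auto
    have hk: "integrable \<nu> (\<lambda>y. y ^ k * (h y - 1))" "(\<integral>y. y ^ k * (h y - 1) \<partial>\<nu>) = 0"
      using h(6)[OF j(2)] by (auto simp: j(1))
    have eq: "h y *\<^sub>R y ^ k = y ^ k + y ^ k * (h y - 1)" for y by (simp add: algebra_simps)
    have iM: "integrable M (\<lambda>y. y ^ k)" "(\<integral>y. y ^ k \<partial>M) = (\<integral>y. y ^ k \<partial>\<nu>)"
      unfolding M_def using h(2) ik hk
      by (simp_all add: integrable_density integral_density eq del: real_scaleR_def)
    have "0 < k" using k by auto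
    then show ?thesis
      using has_bochner_integral_sum_measure[OF sN iM(1) atom_at_0_power(1)[OF m(1)]] 
        atom_at_0_power(2)[OF m(1)] iM(2) by (simp add: \<mu>_def)
  qed
  have adm: "\<mu> \<in> admissible \<nu> n \<Lambda>"
    using s\<mu> fin em \<Lambda>0 mom by (auto simp: admissible_def measure_def)
  define E where "E = density \<nu> (\<lambda>y. ennreal \<bar>1 - h y\<bar>)"
  define D where "D = sum_measure E ?N"
  have sE: "sets ?N = sets E" by (simp add: E_def)
  have "J \<nu> n \<mu> \<le> (\<integral>\<^sup>+y. ennreal (\<bar>y\<bar> ^ n) \<partial>D)"
    unfolding J_def
  proof (rule nn_integral_tv_diff_le[OF levy_sigma_finite[OF levy] fin])
    show "sets \<mu> = sets \<nu>" "sets D = sets \<nu>" using s\<mu> by (auto simp: D_def E_def)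
    fix B assume "B \<in> sets \<nu>"
    then have [measurable]: "B \<in> sets borel" by simp
    have e\<nu>: "emeasure \<nu> B = (\<integral>\<^sup>+y. indicator B y \<partial>\<nu>)" by simp
    have eM: "emeasure M B = (\<integral>\<^sup>+y. ennreal (h y) * indicator B y \<partial>\<nu>)"
      by (simp add: M_def emeasure_density)
    have eE: "emeasure E B = (\<integral>\<^sup>+y. ennreal \<bar>1 - h y\<bar> * indicator B y \<partial>\<nu>)"
      by (simp add: E_def emeasure_density)
    have "1 \<le> h y + \<bar>1 - h y\<bar>" "h y \<le> 1 + \<bar>1 - h y\<bar>" for y by linarith+
    then have "ennreal 1 \<le> ennreal (h y) + ennreal \<bar>1 - h y\<bar>" "ennreal (h y) \<le> ennreal 1 + ennreal \<bar>1 - h y\<bar>" for y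
      using h(2)[of y] by (simp_all only: ennreal_plus[symmetric] ennreal_leI abs_ge_zero zero_le_one)
    then have pt: "indicator B y \<le> ennreal (h y) * indicator B y + ennreal \<bar>1 - h y\<bar> * indicator B y"
      "ennreal (h y) * indicator B y \<le> indicator B y + ennreal \<bar>1 - h y\<bar> * indicator B y" for y
      by (auto simp: indicator_def)
    have "emeasure \<nu> B \<le> emeasure M B + emeasure E B"
      unfolding e\<nu> eM eE
      by (subst nn_integral_add[symmetric]) (measurable, intro nn_integral_mono pt)
    also have "\<dots> \<le> emeasure \<mu> B + emeasure D B"
      unfolding \<mu>_def D_def emeasure_sum_measure[OF sN] emeasure_sum_measure[OF sE]
      by (intro add_mono) (simp_all add: add_increasing2)
    finally show "emeasure \<nu> B \<le> emeasure \<mu> B + emeasure D B" .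
    have "emeasure M B \<le> emeasure \<nu> B + emeasure E B"
      unfolding e\<nu> eM eE
      by (subst nn_integral_add[symmetric]) (measurable, intro nn_integral_mono pt)
    then show "emeasure \<mu> B \<le> emeasure \<nu> B + emeasure D B"
      by (simp add: \<mu>_def D_def emeasure_sum_measure[OF sN] emeasure_sum_measure[OF sE] add.assoc[symmetric] add_right_mono)
  qed
  also have "\<dots> = (\<integral>\<^sup>+y. ennreal (\<bar>y\<bar> ^ n) \<partial>E)"
    unfolding D_def using n by (subst nn_integral_sum_measure[OF sE]) (auto simp: E_def nn_integral_atom_at_0)
  also have "\<dots> = (\<integral>\<^sup>+y. ennreal (\<bar>1 - h y\<bar> * \<bar>y\<bar> ^ n) \<partial>\<nu>)"
    unfolding E_def by (subst nn_integral_density) (auto simp: ennreal_mult)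
  also have "\<dots> \<le> (\<integral>\<^sup>+y. ennreal (R ^ (n - 2)) * ennreal (y\<^sup>2 * indicator {y. \<bar>y\<bar> \<le> R} y) \<partial>\<nu>)"
  proof (intro nn_integral_mono)
    fix y
    have "\<bar>1 - h y\<bar> * \<bar>y\<bar> ^ n \<le> R ^ (n - 2) * (y\<^sup>2 * indicator {y. \<bar>y\<bar> \<le> R} y)"
    proof (cases "\<bar>y\<bar> \<le> R")
      case True
      have "\<bar>1 - h y\<bar> * \<bar>y\<bar> ^ n \<le> 1 * \<bar>y\<bar> ^ n" using h(2,3)[of y] by (intro mult_right_mono) auto
      also have "\<dots> = \<bar>y\<bar> ^ (n - 2) * y\<^sup>2"
        using n power_add[of "\<bar>y\<bar>" "n - 2" 2] by (simp only: le_add_diff_inverse2 power2_abs)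
      also have "\<dots> \<le> R ^ (n - 2) * y\<^sup>2" using True by (intro mult_right_mono power_mono) auto
      finally show ?thesis using True by simp
    qed (use h(5) in auto)
    then show "ennreal (\<bar>1 - h y\<bar> * \<bar>y\<bar> ^ n) \<le> ennreal (R ^ (n - 2)) * ennreal (y\<^sup>2 * indicator {y. \<bar>y\<bar> \<le> R} y)"
      using R by (subst ennreal_mult[symmetric]) (auto intro: ennreal_leI)
  qed
  also have "\<dots> = ennreal (R ^ (n - 2)) * ennreal (V R)"
    unfolding V_nn_integral[symmetric] by (rule nn_integral_cmult) measurable
  also have "\<dots> = ennreal (R ^ (n - 2) * V R)" using R V_nonneg by (simp add: ennreal_mult)
  finally show ?thesis using adm that by blast
qed

text \<open>All lengths are multiples of \<open>G = gen_inverse g \<Lambda>\<close>. The scale \<open>r\<close> is so large that the tail beyond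
  \<open>\<delta> * r\<close> is at most \<open>\<Lambda> / 2\<close>, which leaves room for the atom. The competitor differs from
  \<open>\<nu>\<close> away from the origin only within distance \<open>R\<close> of it, a fixed multiple of \<open>G\<close>, and there its error is at most
  \<open>R ^ (n - 2) * V R\<close>, which is of order \<open>R ^ n * U R\<close> and hence of order \<open>G ^ n * \<Lambda>\<close>.\<close>

lemma error_upper_bound:
  assumes int: "integrable \<nu> (\<lambda>y. \<bar>y\<bar> ^ n)" and n: "2 \<le> n"
  obtains C where "0 < C"
    "eventually (\<lambda>\<Lambda>. \<exists>\<mu>\<in>admissible \<nu> n \<Lambda>. J \<nu> n \<mu> \<le> ennreal (C * (gen_inverse g \<Lambda> ^ n * \<Lambda>))) at_top"
proof -
  interpret inv: blowup_inverse g \<alpha>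
    using rv \<alpha> regularly_varying_at_zero_blowup(2)[OF rv \<alpha>(1) U_ratio c_pos U_antimono]
    by unfold_locales auto
  let ?G = "gen_inverse g"
  define d where "d = n - 2"
  define B where "B = (2 * (real d + 3)) ^ d"
  have B: "0 < B" by (simp add: B_def)
  obtain s \<kappa> where s: "s = 1 \<or> s = -1" and \<kappa>: "0 < \<kappa>"
    and shell: "eventually (\<lambda>r. \<forall>i<d. \<kappa> * (r\<^sup>2 * U r)
       \<le> (\<integral>y. y\<^sup>2 * indicator {y. (real i + 1) * r < s * y \<and> s * y \<le> (real i + 3/2) * r} y \<partial>\<nu>)) (at_right 0)"
    by (rule shell_mass[of d])
  obtain \<delta> where \<delta>: "0 < \<delta>" "\<delta> < 1" and Vsmall: "eventually (\<lambda>r. V (\<delta> * r) \<le> \<kappa> / B * (r\<^sup>2 * U r)) (at_right 0)"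
    using V_negligible[of "\<kappa> / B"] \<kappa> B by auto
  obtain C where C: "0 < C" and VC: "eventually (\<lambda>x. V x \<le> C * (x\<^sup>2 * U x)) (at_right 0)" by (rule V_le_tail)
  obtain k where k: "0 < k" and Uk: "eventually (\<lambda>\<Lambda>. U (k * ?G \<Lambda>) \<le> 1/2 * \<Lambda>) at_top"
    using inv.tail_small_above_inverse[OF U_ratio c_pos U_antimono, of "1/2"] by auto
  \<comment> \<open>The removed interval \<open>[-\<delta> r, \<delta> r]\<close> then has half-length exactly \<open>k * G\<close>.\<close>
  define K where "K = k / \<delta>"
  have K: "0 < K" using k \<delta> by (simp add: K_def)
  define W where "W = (real d + 1) * K"
  have W: "0 < W" using K by (simp add: W_def)
  have lim: "filterlim (\<lambda>\<Lambda>. c * ?G \<Lambda>) (at_right 0) at_top" if "0 < c" for c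
    by (rule filterlim_compose[OF filterlim_scale_at_right_0[OF that] inv.G_at_right_0])
  note ev = eventually_compose_filterlim[OF _ lim[OF K]]
  have "eventually (\<lambda>\<Lambda>. \<exists>\<mu>\<in>admissible \<nu> n \<Lambda>. J \<nu> n \<mu> \<le> ennreal (C * W ^ n * (?G \<Lambda> ^ n * \<Lambda>))) at_top"
    using ev[OF shell] ev[OF Vsmall] eventually_compose_filterlim[OF VC lim[OF W]] Uk inv.G_pos
      ev[OF U_pos] eventually_gt_at_top[of 0]
  proof eventually_elim
    case (elim \<Lambda>)
    define r where "r = K * ?G \<Lambda>"
    define R where "R = (real d + 1) * r"
    have r: "0 < r" using K elim by (simp add: r_def)
    have R: "0 < R" "R = W * ?G \<Lambda>" using r by (auto simp: R_def r_def W_def)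
    have \<rho>: "\<delta> * r = k * ?G \<Lambda>" "0 < \<delta> * r"
      using \<delta> r by (simp add: r_def K_def) (rule mult_pos_pos[OF \<delta>(1) r])
    have "0 < U r" using elim by (simp add: r_def)
    then have pos: "0 < \<kappa> * (r\<^sup>2 * U r)" using \<kappa> r by (intro mult_pos_pos zero_less_power)
    obtain h :: "real \<Rightarrow> real" where h: "h \<in> borel_measurable borel" "\<And>y. 0 \<le> h y" "\<And>y. h y \<le> 2"
      "\<And>y. \<bar>y\<bar> \<le> \<delta> * r \<Longrightarrow> h y = 0" "\<And>y. (real d + 1) * r < \<bar>y\<bar> \<Longrightarrow> h y = 1"
      "\<And>k. k < d \<Longrightarrow> integrable \<nu> (\<lambda>y. y ^ (k + 2) * (h y - 1)) \<and> (\<integral>y. y ^ (k + 2) * (h y - 1) \<partial>\<nu>) = 0"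
    proof (rule moment_transfer[of \<nu> s r \<delta> d])
      fix i assume i: "i < d"
      let ?w = "\<integral>y. y\<^sup>2 * indicator {y. (real i + 1) * r < s * y \<and> s * y \<le> (real i + 3/2) * r} y \<partial>\<nu>"
      have w: "\<kappa> * (r\<^sup>2 * U r) \<le> ?w" using elim(1) i by (simp add: r_def)
      show "0 < ?w" using pos w by linarith
      have "B * V (\<delta> * r) \<le> B * (\<kappa> / B * (r\<^sup>2 * U r))" using elim B by (intro mult_left_mono) (auto simp: r_def)
      also have "\<dots> = \<kappa> * (r\<^sup>2 * U r)" using B by simp
      finally show "(2 * (real d + 3)) ^ d * (\<integral>y. y\<^sup>2 * indicator {y. \<bar>y\<bar> \<le> \<delta> * r} y \<partial>\<nu>) \<le> ?w"
        using w by (simp add: B_def V_def)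
    qed (use s r \<delta> square_integrable_near_0 in auto)
    have "2 * U (\<delta> * r) \<le> \<Lambda>" using elim by (simp add: \<rho>)
    then obtain \<mu> where \<mu>: "\<mu> \<in> admissible \<nu> n \<Lambda>" "J \<nu> n \<mu> \<le> ennreal (R ^ (n - 2) * V R)"
      using competitor[OF int n \<rho>(2), of R h \<Lambda>] h R by (auto simp: d_def R_def)
    have "U R \<le> U (\<delta> * r)"
    proof (rule U_antimono[OF \<rho>(2)])
      show "\<delta> * r \<le> R" unfolding R_def using \<delta> r by (intro mult_right_mono) auto
    qed
    then have UR: "U R \<le> \<Lambda>" using elim by (simp add: \<rho>)
    have "R ^ (n - 2) * V R \<le> R ^ (n - 2) * (C * (R\<^sup>2 * \<Lambda>))"
    proof (intro mult_left_mono)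
      have "V R \<le> C * (R\<^sup>2 * U R)" using elim R by simp
      also have "\<dots> \<le> C * (R\<^sup>2 * \<Lambda>)" using UR C by (intro mult_left_mono) auto
      finally show "V R \<le> C * (R\<^sup>2 * \<Lambda>)" .
    qed (use R in auto)
    also have "\<dots> = C * (R ^ (n - 2) * R\<^sup>2) * \<Lambda>" by simp
    also have "R ^ (n - 2) * R\<^sup>2 = R ^ n"
      using n power_add[of R "n - 2" 2] by (simp only: le_add_diff_inverse2)
    also have "C * R ^ n * \<Lambda> = C * W ^ n * (?G \<Lambda> ^ n * \<Lambda>)" by (simp add: R(2) power_mult_distrib)
    finally have "J \<nu> n \<mu> \<le> ennreal (C * W ^ n * (?G \<Lambda> ^ n * \<Lambda>))"
      using \<mu>(2) by (meson ennreal_leI order_trans)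
    with \<mu>(1) show ?case by blast
  qed
  then show ?thesis using C W by (intro that[of "C * W ^ n"]) auto
qed

end

theorem theorem27:
  fixes \<nu> :: "real measure" and n :: nat and \<alpha> c_plus c_minus :: real and g :: "real \<Rightarrow> real"
  assumes "even n" and "n > 0"
    and "levy_measure \<nu>"
    and "integrable \<nu> (\<lambda>y. \<bar>y\<bar> ^ n)"
    and "0 < \<alpha>" and "\<alpha> < 2"
    and "c_plus \<ge> 0" and "c_minus \<ge> 0" and "c_plus + c_minus > 0"
    and "regularly_varying_at_zero g (- \<alpha>)"
    and "equiv_at_zero (\<lambda>x. measure \<nu> {x<..}) c_plus g"
    and "equiv_at_zero (\<lambda>x. measure \<nu> {..<-x}) c_minus g"
  shows "\<exists>f c_low c_up. (\<forall>\<Lambda>. f \<Lambda> = gen_inverse g \<Lambda> ^ n * \<Lambda>) \<and>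
           regularly_varying_at_infinity f (1 - real n / \<alpha>) \<and>
           0 < c_low \<and> c_low \<le> c_up \<and>
           (\<forall>\<^sub>F \<Lambda> in at_top. ennreal (c_low * f \<Lambda>) \<le> min_error \<nu> n \<Lambda> \<and>
              min_error \<nu> n \<Lambda> \<le> ennreal (c_up * f \<Lambda>))"
proof -
  interpret regularly_varying_levy \<nu> g \<alpha> c_plus c_minus
    using assms by unfold_locales auto
  interpret inv: blowup_inverse g \<alpha>
    using rv \<alpha> regularly_varying_at_zero_blowup(2)[OF rv \<alpha>(1) U_ratio c_pos U_antimono]
    by unfold_locales auto
  have n: "2 \<le> n" using assms(1,2) by (auto elim!: evenE)
  define f where "f \<Lambda> = gen_inverse g \<Lambda> ^ n * \<Lambda>" for \<Lambda>
  obtain \<delta> where \<delta>: "0 < \<delta>" and low: "eventually (\<lambda>\<Lambda>. 2 * \<Lambda> \<le> U (\<delta> * gen_inverse g \<Lambda>)) at_top"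
    by (rule inv.tail_large_below_inverse[OF U_ratio c_pos U_antimono])
  obtain C where C: "0 < C"
    and up: "eventually (\<lambda>\<Lambda>. \<exists>\<mu>\<in>admissible \<nu> n \<Lambda>. J \<nu> n \<mu> \<le> ennreal (C * f \<Lambda>)) at_top"
    unfolding f_def by (rule error_upper_bound[OF assms(4) n])
  have "\<forall>\<^sub>F \<Lambda> in at_top. ennreal (\<delta> ^ n * f \<Lambda>) \<le> min_error \<nu> n \<Lambda> \<and>
      min_error \<nu> n \<Lambda> \<le> ennreal (max C (\<delta> ^ n) * f \<Lambda>)"
    using low up inv.G_pos eventually_gt_at_top[of 0]
  proof eventually_elim
    case (elim \<Lambda>)
    have f0: "0 \<le> f \<Lambda>" using elim by (simp add: f_def)
    obtain \<mu>1 where \<mu>1: "\<mu>1 \<in> admissible \<nu> n \<Lambda>" "J \<nu> n \<mu>1 \<le> ennreal (C * f \<Lambda>)" using elim by blast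
    have fin: "J \<nu> n \<mu>1 < \<infinity>" using \<mu>1(2) by (rule le_less_trans) simp
    obtain \<mu> where \<mu>: "\<mu> \<in> admissible \<nu> n \<Lambda>" "\<forall>\<mu>'\<in>admissible \<nu> n \<Lambda>. J \<nu> n \<mu> \<le> J \<nu> n \<mu>'"
      using moment_functional_attains_minimum[OF levy_sigma_finite[OF levy] sets_\<nu> assms(4,2) _ \<mu>1(1) fin]
        elim(4) by blast
    have min: "min_error \<nu> n \<Lambda> = J \<nu> n \<mu>"
      unfolding min_error_def using \<mu> by (intro Least_equality) auto
    have "ennreal (\<delta> ^ n * f \<Lambda>) = ennreal ((\<delta> * gen_inverse g \<Lambda>) ^ n * \<Lambda>)"
      by (simp add: f_def power_mult_distrib mult_ac)
    also have "\<dots> \<le> J \<nu> n \<mu>" using elim \<delta> by (intro error_lower_bound \<mu>) auto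
    finally have "ennreal (\<delta> ^ n * f \<Lambda>) \<le> min_error \<nu> n \<Lambda>" by (simp add: min)
    moreover have "J \<nu> n \<mu> \<le> ennreal (C * f \<Lambda>)" using \<mu>(2) \<mu>1 order_trans by blast
    then have "min_error \<nu> n \<Lambda> \<le> ennreal (max C (\<delta> ^ n) * f \<Lambda>)"
      unfolding min using f0 by (elim order_trans) (intro ennreal_leI mult_right_mono, auto)
    ultimately show ?case by blast
  qed
  then show ?thesis
    using inv.rate_regularly_varying[of n] \<delta>
    by (intro exI[of _ f] exI[of _ "\<delta> ^ n"] exI[of _ "max C (\<delta> ^ n)"]) (auto simp: f_def[abs_def])
qed

end
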